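(* Let $(\mathcal W,[h])$ be a shearfree structure on a manifold $M$, with kernel distribution $\mathcal K_h$. (1) For any triple $(h,\mathrm p,(\mathcal W',\mathrm q))$ formed by (a) a degenerate metric $h\in[h]$, (b) a nowhere vanishing vector field $\mathrm p\in\mathcal K_h$, and (c) a rigging $(\mathcal W',\mathrm q)$ for $(\mathcal W,[h])$, the metric $$g=h+2\,\mathrm q^*\vee\mathrm p^*\qquad(\ast)$$ together with the vector field $\mathrm p$ gives a shearfree pair $(g,\mathrm p)$ which is compatible with $(\mathcal W,[h])$. (2) Conversely, if $(g,\mathrm p)$ is a shearfree pair compatible with $(\mathcal W,[h])$, then locally there is a rigging $(\mathcal W',\mathrm q)$ such that $g$ is the metric $(\ast)$ determined by some triple $(h=g|_{\mathcal W},\mathrm p,(\mathcal W',\mathrm q))$. Such a rigging can be determined in two different ways: (a) either by choosing a subdistribution $\mathcal W'\subset\mathcal W$ which is complementary to $\mathcal K_h$ and setting $\mathrm q$ to be the vector field with $g(\mathrm q,\mathcal W'+\langle\mathrm q\rangle)=0$ and $g(\mathrm q,\mathrm p)=1$; (b) or by choosing a vector field $\mathrm q$ which is transversal to $\mathcal W$ and setting $\mathcal W'=\langle\mathrm p,\mathrm q\rangle^\perp$.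
   Context: Conventions: $\alpha\vee\beta=\frac12(\alpha\otimes\beta+\beta\otimes\alpha)$; $\mathrm p^\flat=g(\mathrm p,\cdot)$; Lorentzian metrics have signature $(-,+,\dots,+)$. A shearfree structure on $M$ is a pair $(\mathcal W,[h])$ of a codimension one distribution $\mathcal W\subset TM$ and a conformal class $[h]$ of semipositive degenerate metrics on $\mathcal W$ with one-dimensional kernel $\mathcal K_h=\ker h\subset\mathcal W$, such that one (hence each) nowhere vanishing vector field $\mathrm p$ in $\mathcal K_h$ satisfies $\mathcal L_{\mathrm p}\mathcal W\subset\mathcal W$ and $\mathcal L_{\mathrm p}[h]=[h]$ (i.e. $\mathcal L_{\mathrm p}h=fh$ for some function $f$). A shearfree pair $(g,\mathrm p)$ is a Lorentzian metric $g$ with a (nowhere vanishing) $g$-null vector field $\mathrm p$ such that $\mathcal L_{\mathrm p}X\in\mathrm p^\perp$ for all $X\in\mathrm p^\perp$ and $\mathcal L_{\mathrm p}(g|_{\mathrm p^\perp})=f\,g|_{\mathrm p^\perp}$ for some function $f$. It is compatible with $(\mathcal W,[h])$ if $\ker\mathrm p^\flat=\mathcal W$ and $[g|_{\mathcal W}]=[h]$. A rigging for $(\mathcal W,[h])$ is a pair $(\mathcal W',\mathrm q)$ of a subdistribution $\mathcal W'\subset\mathcal W$ complementary to $\mathcal K_h$ in $\mathcal W$ and a vector field $\mathrm q$ transversal to $\mathcal W$. Given also a nowhere vanishing $\mathrm p\in\mathcal K_h$, one has $TM=\mathcal K_h+\mathcal W'+\langle\mathrm q\rangle$, and $\mathrm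 p^*,\mathrm q^*$ denote the 1-forms with $\mathrm p^*(\mathrm p)=1$, $\ker\mathrm p^*=\mathcal W'+\langle\mathrm q\rangle$, and $\mathrm q^*(\mathrm q)=1$, $\ker\mathrm q^*=\mathcal W$. In $(\ast)$, $h$ is regarded as a degenerate metric on $TM$ with kernel $\mathcal K_h+\langle\mathrm q\rangle$; $(\ast)$ is the unique Lorentzian metric with $g(\mathrm p,\mathrm q)=1$, $g|_{\mathcal W}=h$, $g(\mathrm p,\mathrm p)=g(\mathrm q,\mathrm q)=0$ and $\mathcal W'=\langle\mathrm p,\mathrm q\rangle^\perp$.
   Formalization: In (2)(b) an arbitrary transversal q fails (2q in place of q breaks g(p,q)=1); it is shown that (W',q) is always a rigging, gives g exactly when g(q,q)=0 and g(p,q)=1, and that the unique such vector field in ⟨p,q⟩, with the same W', always gives g. *)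

theory Defs
  imports "HOL-Analysis.Analysis"
begin

fun Ck_on :: "nat \<Rightarrow> 'e::euclidean_space set \<Rightarrow> ('e \<Rightarrow> 'f::real_normed_vector) \<Rightarrow> bool" where
  "Ck_on 0 S f \<longleftrightarrow> continuous_on S f"
| "Ck_on (Suc k) S f \<longleftrightarrow>
     (\<forall>x\<in>S. f differentiable (at x)) \<and>
     (\<forall>v. Ck_on k S (\<lambda>x. frechet_derivative f (at x) v))"

definition Cinf_on :: "'e::euclidean_space set \<Rightarrow> ('e \<Rightarrow> 'f::real_normed_vector) \<Rightarrow> bool" where
  "Cinf_on S f \<longleftrightarrow> (\<forall>k. Ck_on k S f)"

text \<open>A chart is a pair of its domain and its coordinate map; values of the coordinate map outside
  the domain are irrelevant.  The manifold is the whole type \<open>'a\<close>, its dimension is \<open>DIM('e)\<close>.\<close>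

type_synonym ('a, 'e) chart = "'a set \<times> ('a \<Rightarrow> 'e)"

definition chart_inv :: "('a, 'e) chart \<Rightarrow> 'e \<Rightarrow> 'a" where
  "chart_inv c = inv_into (fst c) (snd c)"

definition smooth_atlas ::
  "('a::{t2_space,second_countable_topology}, 'e::euclidean_space) chart set \<Rightarrow> bool" where
  "smooth_atlas A \<longleftrightarrow>
     (\<Union>c\<in>A. fst c) = UNIV \<and>
     (\<forall>c\<in>A. open (fst c) \<and> open (snd c ` fst c) \<and>
        homeomorphism (fst c) (snd c ` fst c) (snd c) (chart_inv c)) \<and>
     (\<forall>c\<in>A. \<forall>d\<in>A. Cinf_on (snd c ` (fst c \<inter> fst d)) (snd d \<circ> chart_inv c))"

text \<open>Every point \<open>x\<close> gets a preferred chart, and \<open>T\<^sub>x M\<close> is identified with the model space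
  \<open>'e\<close> by means of that chart.  Thus a vector field is a function \<open>'a \<Rightarrow> 'e\<close>, and
  \<open>tcoord A c x v\<close> are the components, in an arbitrary chart \<open>c\<close> around \<open>x\<close>, of the tangent
  vector \<open>v\<close> at \<open>x\<close>.\<close>

definition chart_at :: "('a, 'e) chart set \<Rightarrow> 'a \<Rightarrow> ('a, 'e) chart" where
  "chart_at A x = (SOME c. c \<in> A \<and> x \<in> fst c)"

definition tcoord ::
  "('a, 'e::euclidean_space) chart set \<Rightarrow> ('a, 'e) chart \<Rightarrow> 'a \<Rightarrow> 'e \<Rightarrow> 'e" where
  "tcoord A c x v =
     frechet_derivative (snd c \<circ> chart_inv (chart_at A x)) (at (snd (chart_at A x) x)) v"

definition coord_field ::
  "('a, 'e::euclidean_space) chart set \<Rightarrow> ('a, 'e) chart \<Rightarrow> ('a \<Rightarrow> 'e) \<Rightarrow> 'e \<Rightarrow> 'e" where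
  "coord_field A c X y = tcoord A c (chart_inv c y) (X (chart_inv c y))"

definition smooth_fun ::
  "('a, 'e::euclidean_space) chart set \<Rightarrow> 'a set \<Rightarrow> ('a \<Rightarrow> real) \<Rightarrow> bool" where
  "smooth_fun A U f \<longleftrightarrow> (\<forall>c\<in>A. Cinf_on (snd c ` (fst c \<inter> U)) (f \<circ> chart_inv c))"

definition smooth_field ::
  "('a, 'e::euclidean_space) chart set \<Rightarrow> 'a set \<Rightarrow> ('a \<Rightarrow> 'e) \<Rightarrow> bool" where
  "smooth_field A U X \<longleftrightarrow> (\<forall>c\<in>A. Cinf_on (snd c ` (fst c \<inter> U)) (coord_field A c X))"

definition vec_deriv ::
  "('a, 'e::euclidean_space) chart set \<Rightarrow> 'a \<Rightarrow> 'e \<Rightarrow> ('a \<Rightarrow> real) \<Rightarrow> real" where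
  "vec_deriv A x v f =
     frechet_derivative (f \<circ> chart_inv (chart_at A x)) (at (snd (chart_at A x) x)) v"

text \<open>The Lie bracket \<open>[X, Y] = \<L>\<^sub>X Y\<close> at \<open>x\<close>, computed in the preferred chart at \<open>x\<close> as
  \<open>DY(X) - DX(Y)\<close>.  The components of \<open>X x\<close> in that chart are \<open>X x\<close> itself.\<close>

definition lie_bracket ::
  "('a, 'e::euclidean_space) chart set \<Rightarrow> ('a \<Rightarrow> 'e) \<Rightarrow> ('a \<Rightarrow> 'e) \<Rightarrow> 'a \<Rightarrow> 'e" where
  "lie_bracket A X Y x =
     (let c = chart_at A x in
       frechet_derivative (coord_field A c Y) (at (snd c x)) (X x)
       - frechet_derivative (coord_field A c X) (at (snd c x)) (Y x))"

definition distribution_on ::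
  "('a::topological_space, 'e::euclidean_space) chart set \<Rightarrow> 'a set \<Rightarrow> nat \<Rightarrow> ('a \<Rightarrow> 'e set) \<Rightarrow> bool" where
  "distribution_on A U k D \<longleftrightarrow>
     (\<forall>x\<in>U. subspace (D x) \<and> dim (D x) = k) \<and>
     (\<forall>x\<in>U. \<exists>V F. open V \<and> x \<in> V \<and> V \<subseteq> U \<and>
        (\<forall>i<k. smooth_field A V (F i)) \<and>
        (\<forall>y\<in>V. D y = span ((\<lambda>i::nat. F i y) ` {..<k})))"

definition section_of ::
  "('a, 'e::euclidean_space) chart set \<Rightarrow> 'a set \<Rightarrow> ('a \<Rightarrow> 'e set) \<Rightarrow> ('a \<Rightarrow> 'e) \<Rightarrow> bool" where
  "section_of A U D X \<longleftrightarrow> smooth_field A U X \<and> (\<forall>x\<in>U. X x \<in> D x)"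

definition nonvanishing_section ::
  "('a, 'e::euclidean_space) chart set \<Rightarrow> 'a set \<Rightarrow> ('a \<Rightarrow> 'e set) \<Rightarrow> ('a \<Rightarrow> 'e) \<Rightarrow> bool" where
  "nonvanishing_section A U D X \<longleftrightarrow> section_of A U D X \<and> (\<forall>x\<in>U. X x \<noteq> 0)"

type_synonym ('a, 'e) form = "'a \<Rightarrow> 'e \<Rightarrow> 'e \<Rightarrow> real"

text \<open>A form on \<open>D\<close> is represented by a function whose values \<open>h x u v\<close> are relevant only for
  \<open>u, v \<in> D x\<close>; no notion below depends on other values.  Forms on the tangent bundle are the
  case \<open>D = (\<lambda>x. UNIV)\<close>.\<close>

definition smooth_sym_form ::
  "('a::topological_space, 'e::euclidean_space) chart set \<Rightarrow> ('a \<Rightarrow> 'e set) \<Rightarrow> ('a, 'e) form \<Rightarrow> bool" where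
  "smooth_sym_form A D h \<longleftrightarrow>
     (\<forall>x. \<forall>u\<in>D x. \<forall>v\<in>D x. h x u v = h x v u) \<and>
     (\<forall>x. \<forall>u\<in>D x. \<forall>v\<in>D x. \<forall>w\<in>D x. h x (u + v) w = h x u w + h x v w) \<and>
     (\<forall>x. \<forall>u\<in>D x. \<forall>w\<in>D x. \<forall>r. h x (r *\<^sub>R u) w = r * h x u w) \<and>
     (\<forall>V X Y. open V \<longrightarrow> section_of A V D X \<longrightarrow> section_of A V D Y \<longrightarrow>
        smooth_fun A V (\<lambda>x. h x (X x) (Y x)))"

definition restrict_form :: "('a \<Rightarrow> 'e set) \<Rightarrow> ('a, 'e) form \<Rightarrow> ('a, 'e::euclidean_space) form" where
  "restrict_form D g = (\<lambda>x u v. if u \<in> D x \<and> v \<in> D x then g x u v else 0)"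

definition form_kernel :: "('a \<Rightarrow> 'e set) \<Rightarrow> ('a, 'e::euclidean_space) form \<Rightarrow> 'a \<Rightarrow> 'e set" where
  "form_kernel D h x = {v \<in> D x. \<forall>w\<in>D x. h x v w = 0}"

definition degenerate_metric ::
  "('a::topological_space, 'e::euclidean_space) chart set \<Rightarrow> ('a \<Rightarrow> 'e set) \<Rightarrow> ('a, 'e) form \<Rightarrow> bool" where
  "degenerate_metric A W h \<longleftrightarrow>
     smooth_sym_form A W h \<and>
     (\<forall>x. \<forall>v\<in>W x. h x v v \<ge> 0) \<and>
     (\<forall>x. dim (form_kernel W h x) = 1)"

definition conformal_class ::
  "('a, 'e::euclidean_space) chart set \<Rightarrow> ('a \<Rightarrow> 'e set) \<Rightarrow> ('a, 'e) form \<Rightarrow> ('a, 'e) form set" where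
  "conformal_class A W h =
     {k. \<exists>l. smooth_fun A UNIV l \<and> (\<forall>x. l x > 0) \<and>
          (\<forall>x. \<forall>u\<in>W x. \<forall>v\<in>W x. k x u v = l x * h x u v)}"

definition lie_deriv_form ::
  "('a, 'e::euclidean_space) chart set \<Rightarrow> ('a \<Rightarrow> 'e) \<Rightarrow> ('a, 'e) form \<Rightarrow>
     ('a \<Rightarrow> 'e) \<Rightarrow> ('a \<Rightarrow> 'e) \<Rightarrow> 'a \<Rightarrow> real" where
  "lie_deriv_form A p h X Y x =
     vec_deriv A x (p x) (\<lambda>y. h y (X y) (Y y))
     - h x (lie_bracket A p X x) (Y x) - h x (X x) (lie_bracket A p Y x)"

text \<open>Sections of \<open>W\<close> in the next two definitions may be local.\<close>

definition lie_preserves_distribution ::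
  "('a::topological_space, 'e::euclidean_space) chart set \<Rightarrow> 'a set \<Rightarrow> ('a \<Rightarrow> 'e) \<Rightarrow>
     ('a \<Rightarrow> 'e set) \<Rightarrow> bool" where
  "lie_preserves_distribution A U p W \<longleftrightarrow>
     (\<forall>V X. open V \<longrightarrow> V \<subseteq> U \<longrightarrow> section_of A V W X \<longrightarrow>
        (\<forall>x\<in>V. lie_bracket A p X x \<in> W x))"

definition lie_conformal ::
  "('a::topological_space, 'e::euclidean_space) chart set \<Rightarrow> 'a set \<Rightarrow> ('a \<Rightarrow> 'e) \<Rightarrow>
     ('a \<Rightarrow> 'e set) \<Rightarrow> ('a, 'e) form \<Rightarrow> bool" where
  "lie_conformal A U p W h \<longleftrightarrow>
     (\<exists>f. smooth_fun A U f \<and>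
        (\<forall>V X Y. open V \<longrightarrow> V \<subseteq> U \<longrightarrow> section_of A V W X \<longrightarrow> section_of A V W Y \<longrightarrow>
           (\<forall>x\<in>V. lie_deriv_form A p h X Y x = f x * h x (X x) (Y x))))"

text \<open>\<open>C\<close> is the conformal class \<open>[h]\<close>.  Since the line bundle \<open>K\<^sub>h\<close> need not have a nowhere
  vanishing global section, the field \<open>p\<close> in the definition is only required locally.\<close>

definition shearfree_structure ::
  "('a::topological_space, 'e::euclidean_space) chart set \<Rightarrow> ('a \<Rightarrow> 'e set) \<Rightarrow>
     ('a, 'e) form set \<Rightarrow> bool" where
  "shearfree_structure A W C \<longleftrightarrow>
     distribution_on A UNIV (DIM('e) - 1) W \<and>
     (\<exists>h. degenerate_metric A W h \<and> C = conformal_class A W h \<and>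
        (\<forall>x. \<exists>U p. open U \<and> x \<in> U \<and>
           nonvanishing_section A U (form_kernel W h) p \<and>
           lie_preserves_distribution A U p W \<and>
           lie_conformal A U p W h))"

definition class_kernel ::
  "('a \<Rightarrow> 'e set) \<Rightarrow> ('a, 'e::euclidean_space) form set \<Rightarrow> 'a \<Rightarrow> 'e set" where
  "class_kernel W C x = {v \<in> W x. \<forall>h\<in>C. \<forall>w\<in>W x. h x v w = 0}"

definition lorentzian_metric ::
  "('a::topological_space, 'e::euclidean_space) chart set \<Rightarrow> ('a, 'e) form \<Rightarrow> bool" where
  "lorentzian_metric A g \<longleftrightarrow>
     smooth_sym_form A (\<lambda>x. UNIV) g \<and>
     (\<forall>x. \<exists>B t. independent B \<and> span B = UNIV \<and> t \<in> B \<and>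
        (\<forall>u\<in>B. \<forall>v\<in>B. g x u v = (if u \<noteq> v then 0 else if u = t then -1 else 1)))"

definition perp :: "('a, 'e::euclidean_space) form \<Rightarrow> ('a \<Rightarrow> 'e set) \<Rightarrow> 'a \<Rightarrow> 'e set" where
  "perp g S x = {v. \<forall>u\<in>S x. g x u v = 0}"

definition shearfree_pair ::
  "('a::topological_space, 'e::euclidean_space) chart set \<Rightarrow> ('a, 'e) form \<Rightarrow> ('a \<Rightarrow> 'e) \<Rightarrow> bool" where
  "shearfree_pair A g p \<longleftrightarrow>
     (let P = perp g (\<lambda>x. {p x}) in
       lorentzian_metric A g \<and>
       nonvanishing_section A UNIV (\<lambda>x. UNIV) p \<and>
       (\<forall>x. g x (p x) (p x) = 0) \<and>
       lie_preserves_distribution A UNIV p P \<and>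
       lie_conformal A UNIV p P (restrict_form P g))"

definition compatible ::
  "('a, 'e::euclidean_space) chart set \<Rightarrow> ('a \<Rightarrow> 'e set) \<Rightarrow> ('a, 'e) form set \<Rightarrow>
     ('a, 'e) form \<Rightarrow> ('a \<Rightarrow> 'e) \<Rightarrow> bool" where
  "compatible A W C g p \<longleftrightarrow>
     (\<forall>x. {v. g x (p x) v = 0} = W x) \<and>
     conformal_class A W (restrict_form W g) = C"

definition complementary_in :: "'e::euclidean_space set \<Rightarrow> 'e set \<Rightarrow> 'e set \<Rightarrow> bool" where
  "complementary_in S T W \<longleftrightarrow> S \<inter> T = {0} \<and> span (S \<union> T) = W"

definition complementary_distribution ::
  "('a::topological_space, 'e::euclidean_space) chart set \<Rightarrow> 'a set \<Rightarrow> ('a \<Rightarrow> 'e set) \<Rightarrow>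
     ('a, 'e) form set \<Rightarrow> ('a \<Rightarrow> 'e set) \<Rightarrow> bool" where
  "complementary_distribution A U W C W' \<longleftrightarrow>
     (\<exists>k. distribution_on A U k W') \<and>
     (\<forall>x\<in>U. complementary_in (W' x) (class_kernel W C x) (W x))"

definition transversal_field ::
  "('a, 'e::euclidean_space) chart set \<Rightarrow> 'a set \<Rightarrow> ('a \<Rightarrow> 'e set) \<Rightarrow> ('a \<Rightarrow> 'e) \<Rightarrow> bool" where
  "transversal_field A U W q \<longleftrightarrow> smooth_field A U q \<and> (\<forall>x\<in>U. q x \<notin> W x)"

definition rigging ::
  "('a::topological_space, 'e::euclidean_space) chart set \<Rightarrow> 'a set \<Rightarrow> ('a \<Rightarrow> 'e set) \<Rightarrow>
     ('a, 'e) form set \<Rightarrow> ('a \<Rightarrow> 'e set) \<Rightarrow> ('a \<Rightarrow> 'e) \<Rightarrow> bool" where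
  "rigging A U W C W' q \<longleftrightarrow>
     complementary_distribution A U W C W' \<and> transversal_field A U W q"

text \<open>The following descriptions are uniquely satisfied when they are evaluated at a rigging.\<close>

definition dual_covector :: "'e::euclidean_space \<Rightarrow> 'e set \<Rightarrow> 'e \<Rightarrow> real" where
  "dual_covector v S = (THE \<alpha>. linear \<alpha> \<and> \<alpha> v = 1 \<and> {u. \<alpha> u = 0} = S)"

definition sym_prod :: "('e \<Rightarrow> real) \<Rightarrow> ('e \<Rightarrow> real) \<Rightarrow> 'e \<Rightarrow> 'e \<Rightarrow> real" where
  "sym_prod \<alpha> \<beta> u v = 1/2 * (\<alpha> u * \<beta> v + \<beta> u * \<alpha> v)"

definition extend_by_kernel ::
  "'e::euclidean_space set \<Rightarrow> 'e set \<Rightarrow> ('e \<Rightarrow> 'e \<Rightarrow> real) \<Rightarrow> 'e \<Rightarrow> 'e \<Rightarrow> real" where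
  "extend_by_kernel S N b =
     (THE k. bilinear k \<and> (\<forall>u v. k u v = k v u) \<and>
        (\<forall>u\<in>S. \<forall>v\<in>S. k u v = b u v) \<and>
        {v. \<forall>w. k v w = 0} = N)"

definition star_metric ::
  "('a \<Rightarrow> 'e set) \<Rightarrow> ('a, 'e::euclidean_space) form set \<Rightarrow>
     ('a, 'e) form \<Rightarrow> ('a \<Rightarrow> 'e) \<Rightarrow> ('a \<Rightarrow> 'e set) \<Rightarrow> ('a \<Rightarrow> 'e) \<Rightarrow> ('a, 'e) form" where
  "star_metric W C h p W' q x u v =
     (let p_star = dual_covector (p x) (span (W' x \<union> {q x}));
          q_star = dual_covector (q x) (W x)
      in extend_by_kernel (W x) (span (class_kernel W C x \<union> {q x})) (h x) u v
         + 2 * sym_prod q_star p_star u v)"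

definition is_star_metric_on ::
  "'a set \<Rightarrow> ('a \<Rightarrow> 'e set) \<Rightarrow> ('a, 'e::euclidean_space) form set \<Rightarrow> ('a, 'e) form \<Rightarrow>
     ('a \<Rightarrow> 'e) \<Rightarrow> ('a \<Rightarrow> 'e set) \<Rightarrow> ('a \<Rightarrow> 'e) \<Rightarrow> bool" where
  "is_star_metric_on U W C g p W' q \<longleftrightarrow>
     (\<forall>x\<in>U. \<forall>u v. g x u v = star_metric W C (restrict_form W g) p W' q x u v)"

end

theory Submission
  imports Defs
begin

text \<open>
  Pointwise, the theorem is linear algebra in \<open>TM = \<langle>p\<rangle> + W' + \<langle>q\<rangle>\<close>.  The metric \<open>(\<ast>)\<close> is the only
  symmetric bilinear form that restricts to \<open>h\<close> on \<open>W\<close> and satisfies \<open>g(q,q) = 0\<close>, \<open>g(p,q) = 1\<close> and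
  \<open>g(W',q) = 0\<close> (\<open>star_unique\<close>).  It pairs \<open>p\<close> with a vector through \<open>q\<^sup>*\<close>, so that \<open>p\<close> is null with
  \<open>p\<^sup>\<bottom> = W\<close>, and it is Lorentzian because \<open>h\<close> is positive definite on \<open>W'\<close> while \<open>p\<close> and \<open>q\<close> span a
  hyperbolic plane orthogonal to \<open>W'\<close> (\<open>star_lorentzian\<close>).  So a metric \<open>g\<close> compatible with the
  structure is \<open>(\<ast>)\<close> for a rigging if and only if \<open>q\<close> satisfies the three equations above
  (\<open>star_metric_iff\<close>).

  For part (1) it remains to differentiate along \<open>p\<close>.  Locally \<open>p = f r\<close> with \<open>r\<close> the field that the
  shearfree structure provides for one metric \<open>h\<^sub>0\<close> of the class, and \<open>h = l h\<^sub>0\<close>.  Since \<open>r\<close> is in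
  the kernel, the identity \<open>[f r, X] = f [r, X] - X(f) r\<close> shows that \<open>p\<close> preserves \<open>W\<close> and scales
  \<open>h\<close> by \<open>p(l)/l + f f\<^sub>0\<close>, where \<open>f\<^sub>0\<close> belongs to \<open>r\<close> and \<open>h\<^sub>0\<close> (\<open>kernel_field_factor\<close>).  The local factors
  coincide on overlaps (\<open>kernel_field_conformal\<close>).

  For part (2), given \<open>W'\<close>, the equations for \<open>q\<close> have exactly one solution: a difference \<open>d\<close> of two
  is orthogonal to \<open>W\<close>, hence a multiple of \<open>p\<close>, and nullity makes it zero (\<open>adapted_unique\<close>).
  Given a transversal \<open>q\<close>, the only null vector in \<open>\<langle>p,q\<rangle>\<close> with product 1 with \<open>p\<close> is explicit
  (\<open>null_normalisation\<close>).  A field \<open>q\<close> that solves the equations at each point is then smooth,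
  because it agrees locally with one built by smooth operations (\<open>adapted_field_exists\<close>).

  All smoothness statements that involve frames, among them that of \<open>p\<^sup>*\<close> and \<open>q\<^sup>*\<close>, come from one
  lemma: orthogonal projection onto the span of a smooth frame is smooth (\<open>smooth_projection\<close>).
\<close>

section \<open>Smooth maps between Euclidean spaces\<close>

lemma Ck_on_SucD:
  assumes "Ck_on (Suc k) S f" "x \<in> S"
  shows "(f has_derivative frechet_derivative f (at x)) (at x)"
  using assms by (simp add: frechet_derivative_works)

lemma Ck_on_cong:
  assumes "open S" "\<And>x. x \<in> S \<Longrightarrow> f x = g x" "Ck_on k S f"
  shows "Ck_on k S g"
  using assms(2,3)
proof (induction k arbitrary: f g)
  case 0
  then show ?case by (simp cong: continuous_on_cong)
next
  case (Suc k)
  have d: "(g has_derivative frechet_derivative f (at x)) (at x)" if "x \<in> S" for x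
    using has_derivative_transform_within_open[OF Ck_on_SucD[OF Suc.prems(2) that] \<open>open S\<close> that]
      Suc.prems(1) by blast
  have e: "frechet_derivative f (at x) = frechet_derivative g (at x)" if "x \<in> S" for x
    using frechet_derivative_at[OF d[OF that]] .
  have "Ck_on k S (\<lambda>x. frechet_derivative g (at x) v)" for v
    by (rule Suc.IH[of "\<lambda>x. frechet_derivative f (at x) v"]) (use e Suc.prems(2) in auto)
  with d show ?case by (auto simp: differentiable_def)
qed

text \<open>The step by which combinations of smooth maps are shown to be smooth, by induction on \<open>k\<close>: it is
  enough to express the derivative through combinations of the same kind.\<close>

lemma Ck_on_SucI:
  assumes "open S" "\<And>x. x \<in> S \<Longrightarrow> (f has_derivative f' x) (at x)"
    "\<And>v. Ck_on k S (\<lambda>x. f' x v)"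
  shows "Ck_on (Suc k) S f"
proof -
  have "f' x = frechet_derivative f (at x)" if "x \<in> S" for x
    using frechet_derivative_at[OF assms(2)[OF that]] .
  then have "Ck_on k S (\<lambda>x. frechet_derivative f (at x) v)" for v
    using Ck_on_cong[OF assms(1) _ assms(3)[of v], of "\<lambda>x. frechet_derivative f (at x) v"] by simp
  then show ?thesis using assms(2) by (auto simp: differentiable_def)
qed

lemma Ck_on_mono: "Ck_on (Suc k) S f \<Longrightarrow> Ck_on k S f"
proof (induction k arbitrary: f)
  case 0
  then show ?case
    using differentiable_imp_continuous_within by (fastforce intro: continuous_at_imp_continuous_on)
next
  case (Suc k)
  have "\<forall>x\<in>S. f differentiable (at x)" "\<forall>v. Ck_on (Suc k) S (\<lambda>x. frechet_derivative f (at x) v)"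
    using Suc.prems Ck_on.simps(2)[of "Suc k" S f] by blast+
  with Suc.IH show ?case unfolding Ck_on.simps(2)[of k S f] by blast
qed

lemma Ck_on_subset: "Ck_on k S f \<Longrightarrow> T \<subseteq> S \<Longrightarrow> Ck_on k T f"
  by (induction k arbitrary: f) (auto intro: continuous_on_subset)

lemma Ck_on_local:
  assumes "\<And>x. x \<in> S \<Longrightarrow> \<exists>T. open T \<and> x \<in> T \<and> Ck_on k T f"
  shows "Ck_on k S f"
  using assms
proof (induction k arbitrary: f)
  case 0
  have "isCont f x" if x: "x \<in> S" for x
  proof -
    obtain T where "open T" "x \<in> T" "continuous_on T f" using 0[OF x] by auto
    then show ?thesis using continuous_on_eq_continuous_at by blast
  qed
  then show ?case by (simp add: continuous_at_imp_continuous_on)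
next
  case (Suc k)
  show ?case
    unfolding Ck_on.simps
  proof (intro conjI ballI allI)
    show "f differentiable at x" if "x \<in> S" for x
      using Suc.prems[OF that] by auto
    show "Ck_on k S (\<lambda>x. frechet_derivative f (at x) v)" for v
      by (rule Suc.IH) (use Suc.prems in fastforce)
  qed
qed

lemma Ck_on_const: "Ck_on k S (\<lambda>x. c)"
  by (induction k arbitrary: c) auto

lemma Ck_on_linear:
  assumes "open S" "bounded_linear L" "Ck_on k S f"
  shows "Ck_on k S (\<lambda>x. L (f x))"
  using assms(3)
proof (induction k arbitrary: f)
  case 0
  then show ?case using assms(2) by (simp add: bounded_linear.continuous_on)
next
  case (Suc k)
  show ?case
  proof (rule Ck_on_SucI[OF assms(1)])
    show "((\<lambda>x. L (f x)) has_derivative (\<lambda>v. L (frechet_derivative f (at x) v))) (at x)"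
      if "x \<in> S" for x
      using bounded_linear.has_derivative[OF assms(2) Ck_on_SucD[OF Suc.prems that]] .
    show "Ck_on k S (\<lambda>x. L (frechet_derivative f (at x) v))" for v
      using Suc by auto
  qed
qed

lemma Ck_on_add:
  assumes "open S" "Ck_on k S f" "Ck_on k S g"
  shows "Ck_on k S (\<lambda>x. f x + g x)"
  using assms(2,3)
proof (induction k arbitrary: f g)
  case 0
  then show ?case by (simp add: continuous_on_add)
next
  case (Suc k)
  show ?case
  proof (rule Ck_on_SucI[OF assms(1)])
    show "((\<lambda>x. f x + g x) has_derivative
        (\<lambda>v. frechet_derivative f (at x) v + frechet_derivative g (at x) v)) (at x)"
      if "x \<in> S" for x
      using has_derivative_add[OF Ck_on_SucD[OF Suc.prems(1) that] Ck_on_SucD[OF Suc.prems(2) that]] .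
    show "Ck_on k S (\<lambda>x. frechet_derivative f (at x) v + frechet_derivative g (at x) v)" for v
      using Suc by auto
  qed
qed

lemma Ck_on_sum:
  assumes "open S" "\<And>i. i \<in> I \<Longrightarrow> Ck_on k S (f i)"
  shows "Ck_on k S (\<lambda>x. \<Sum>i\<in>I. f i x)"
  using assms(2) by (induction I rule: infinite_finite_induct)
    (auto intro: Ck_on_const Ck_on_add[OF assms(1)])

lemma Ck_on_bilinear:
  assumes "open S" "bounded_bilinear B" "Ck_on k S f" "Ck_on k S g"
  shows "Ck_on k S (\<lambda>x. B (f x) (g x))"
  using assms(3,4)
proof (induction k arbitrary: f g)
  case 0
  then show ?case using assms(2) by (simp add: bounded_bilinear.continuous_on)
next
  case (Suc k)
  show ?case
  proof (rule Ck_on_SucI[OF assms(1)])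
    show "((\<lambda>x. B (f x) (g x)) has_derivative
        (\<lambda>v. B (f x) (frechet_derivative g (at x) v) + B (frechet_derivative f (at x) v) (g x))) (at x)"
      if "x \<in> S" for x
      using bounded_bilinear.FDERIV[OF assms(2) Ck_on_SucD[OF Suc.prems(1) that]
          Ck_on_SucD[OF Suc.prems(2) that]] .
    show "Ck_on k S (\<lambda>x. B (f x) (frechet_derivative g (at x) v)
        + B (frechet_derivative f (at x) v) (g x))" for v
      using Suc.prems Ck_on_mono[OF Suc.prems(1)] Ck_on_mono[OF Suc.prems(2)]
      by (intro Ck_on_add assms(1) Suc.IH) auto
  qed
qed

text \<open>The derivative \<open>-f'/f\<^sup>2\<close> contains \<open>1/f\<close> again, to which the induction hypothesis applies.\<close>

lemma Ck_on_inverse: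
  fixes f :: "'e::euclidean_space \<Rightarrow> real"
  assumes "open S" "Ck_on k S f" "\<And>x. x \<in> S \<Longrightarrow> f x \<noteq> 0"
  shows "Ck_on k S (\<lambda>x. inverse (f x))"
  using assms(2)
proof (induction k)
  case 0
  then show ?case using assms(3) by (simp add: continuous_on_inverse)
next
  case (Suc k)
  show ?case
  proof (rule Ck_on_SucI[OF assms(1)])
    show "((\<lambda>x. inverse (f x)) has_derivative
        (\<lambda>v. - (inverse (f x) * frechet_derivative f (at x) v * inverse (f x)))) (at x)"
      if "x \<in> S" for x
      using Deriv.has_derivative_inverse[OF assms(3)[OF that] Ck_on_SucD[OF Suc.prems that]] .
    show "Ck_on k S (\<lambda>x. - (inverse (f x) * frechet_derivative f (at x) v * inverse (f x)))" for v
      using Suc.IH[OF Ck_on_mono[OF Suc.prems]] Suc.prems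
      by (intro Ck_on_linear[OF assms(1) bounded_linear_minus[OF bounded_linear_ident]]
          Ck_on_bilinear[OF assms(1) bounded_bilinear_mult]) auto
  qed
qed

text \<open>By the chain rule a partial derivative of \<open>g \<circ> f\<close> is a sum of products of derivatives of \<open>f\<close> with
  partial derivatives of \<open>g\<close> composed with \<open>f\<close>, which are smooth of one order less.\<close>

lemma Ck_on_compose:
  fixes f :: "'e::euclidean_space \<Rightarrow> 'g::euclidean_space"
  assumes "open S" "open T" "\<And>x. x \<in> S \<Longrightarrow> f x \<in> T" "Ck_on k S f" "Ck_on k T g"
  shows "Ck_on k S (\<lambda>x. g (f x))"
  using assms(4,5)
proof (induction k arbitrary: g)
  case 0
  then show ?case using assms(3) continuous_on_compose2[of T g S f] by auto
next
  case (Suc k)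
  let ?f' = "\<lambda>x. frechet_derivative f (at x)" and ?g' = "\<lambda>y. frechet_derivative g (at y)"
  have d: "(f has_derivative ?f' x) (at x)" "(g has_derivative ?g' (f x)) (at (f x))"
    if "x \<in> S" for x
    using Ck_on_SucD[OF Suc.prems(1) that] Ck_on_SucD[OF Suc.prems(2) assms(3)[OF that]] .
  have eq: "?g' (f x) (?f' x v) = (\<Sum>b\<in>Basis. (?f' x v \<bullet> b) *\<^sub>R ?g' (f x) b)"
    if "x \<in> S" for x v
  proof -
    have "linear (?g' (f x))" using d(2)[OF that] has_derivative_linear by blast
    from linear_sum[OF this, of "\<lambda>b. (?f' x v \<bullet> b) *\<^sub>R b" Basis] linear_scale[OF this]
    show ?thesis by (simp add: euclidean_representation)
  qed
  show ?case
  proof (rule Ck_on_SucI[OF assms(1)])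
    show "((\<lambda>x. g (f x)) has_derivative (\<lambda>v. \<Sum>b\<in>Basis. (?f' x v \<bullet> b) *\<^sub>R ?g' (f x) b)) (at x)"
      if "x \<in> S" for x
      using diff_chain_at[OF d(1)[OF that] d(2)[OF that]] eq[OF that] by (simp add: o_def)
    show "Ck_on k S (\<lambda>x. \<Sum>b\<in>Basis. (?f' x v \<bullet> b) *\<^sub>R ?g' (f x) b)" for v
    proof (intro Ck_on_sum assms(1) Ck_on_bilinear[OF assms(1) bounded_bilinear_scaleR])
      fix b :: 'g
      show "Ck_on k S (\<lambda>x. ?f' x v \<bullet> b)"
        using Suc.prems(1) by (intro Ck_on_linear[OF assms(1) bounded_linear_inner_left]) simp
      show "Ck_on k S (\<lambda>x. ?g' (f x) b)"
        by (rule Suc.IH[OF Ck_on_mono[OF Suc.prems(1)]]) (use Suc.prems in auto)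
    qed
  qed
qed

lemma Ck_on_id: assumes "open S" shows "Ck_on k S (\<lambda>x. x)"
proof (cases k)
  case (Suc j)
  show ?thesis unfolding Suc
    by (rule Ck_on_SucI[OF assms, of _ "\<lambda>x v. v"]) (auto intro: Ck_on_const)
qed simp

lemma Cinf_on_has_derivative:
  assumes "Cinf_on S f" "x \<in> S"
  shows "(f has_derivative frechet_derivative f (at x)) (at x)"
  using assms Ck_on_SucD unfolding Cinf_on_def by blast

lemma Cinf_on_derivative: "Cinf_on S f \<Longrightarrow> Cinf_on S (\<lambda>x. frechet_derivative f (at x) v)"
  unfolding Cinf_on_def using Ck_on.simps(2) by blast

lemma Cinf_on_continuous: "Cinf_on S f \<Longrightarrow> continuous_on S f"
  unfolding Cinf_on_def using Ck_on.simps(1) by blast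

lemma Cinf_on_cong: "open S \<Longrightarrow> (\<And>x. x \<in> S \<Longrightarrow> f x = g x) \<Longrightarrow> Cinf_on S f \<Longrightarrow> Cinf_on S g"
  unfolding Cinf_on_def using Ck_on_cong by blast

lemma Cinf_on_subset: "Cinf_on S f \<Longrightarrow> T \<subseteq> S \<Longrightarrow> Cinf_on T f"
  unfolding Cinf_on_def using Ck_on_subset by blast

lemma Cinf_on_local: "(\<And>x. x \<in> S \<Longrightarrow> \<exists>T. open T \<and> x \<in> T \<and> Cinf_on T f) \<Longrightarrow> Cinf_on S f"
  unfolding Cinf_on_def by (meson Ck_on_local)

lemma Cinf_on_const: "Cinf_on S (\<lambda>x. c)"
  unfolding Cinf_on_def by (blast intro: Ck_on_const)

lemma Cinf_on_add:
  "open S \<Longrightarrow> Cinf_on S f \<Longrightarrow> Cinf_on S g \<Longrightarrow> Cinf_on S (\<lambda>x. f x + g x)"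
  unfolding Cinf_on_def by (blast intro: Ck_on_add)

lemma Cinf_on_sum:
  "open S \<Longrightarrow> (\<And>i. i \<in> I \<Longrightarrow> Cinf_on S (f i)) \<Longrightarrow> Cinf_on S (\<lambda>x. \<Sum>i\<in>I. f i x)"
  unfolding Cinf_on_def by (blast intro: Ck_on_sum)

lemma Cinf_on_bilinear:
  "open S \<Longrightarrow> bounded_bilinear B \<Longrightarrow> Cinf_on S f \<Longrightarrow> Cinf_on S g \<Longrightarrow> Cinf_on S (\<lambda>x. B (f x) (g x))"
  unfolding Cinf_on_def by (blast intro: Ck_on_bilinear)

lemma Cinf_on_inverse:
  fixes f :: "'e::euclidean_space \<Rightarrow> real"
  shows "open S \<Longrightarrow> Cinf_on S f \<Longrightarrow> (\<And>x. x \<in> S \<Longrightarrow> f x \<noteq> 0) \<Longrightarrow> Cinf_on S (\<lambda>x. inverse (f x))"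
  unfolding Cinf_on_def by (blast intro: Ck_on_inverse)

lemma Cinf_on_compose:
  fixes f :: "'e::euclidean_space \<Rightarrow> 'g::euclidean_space"
  shows "open S \<Longrightarrow> open T \<Longrightarrow> (\<And>x. x \<in> S \<Longrightarrow> f x \<in> T) \<Longrightarrow> Cinf_on S f \<Longrightarrow> Cinf_on T g \<Longrightarrow>
    Cinf_on S (\<lambda>x. g (f x))"
  unfolding Cinf_on_def by (blast intro: Ck_on_compose)

text \<open>This covers the coordinate expressions of the differential of a function along a vector field and of
  the change of components of a vector field between charts.\<close>

lemma Cinf_on_apply_derivative:
  fixes f :: "'e::euclidean_space \<Rightarrow> 'f::real_normed_vector" and X :: "'g::euclidean_space \<Rightarrow> 'e"
  assumes "open S" "open T" "\<And>x. x \<in> S \<Longrightarrow> t x \<in> T" "Cinf_on T f" "Cinf_on S t" "Cinf_on S X"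
  shows "Cinf_on S (\<lambda>x. frechet_derivative f (at (t x)) (X x))"
proof (rule Cinf_on_cong[OF assms(1)])
  show "(\<Sum>b\<in>Basis. (X x \<bullet> b) *\<^sub>R frechet_derivative f (at (t x)) b)
    = frechet_derivative f (at (t x)) (X x)" if "x \<in> S" for x
  proof -
    have l: "linear (frechet_derivative f (at (t x)))"
      using Cinf_on_has_derivative[OF assms(4) assms(3)[OF that]] has_derivative_linear by blast
    from linear_sum[OF l, of "\<lambda>b. (X x \<bullet> b) *\<^sub>R b" Basis] linear_scale[OF l]
    show ?thesis by (simp add: euclidean_representation)
  qed
  show "Cinf_on S (\<lambda>x. \<Sum>b\<in>Basis. (X x \<bullet> b) *\<^sub>R frechet_derivative f (at (t x)) b)"
  proof (intro Cinf_on_sum assms(1) Cinf_on_bilinear[OF assms(1) bounded_bilinear_scaleR])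
    fix b :: 'e
    show "Cinf_on S (\<lambda>x. X x \<bullet> b)"
      using Cinf_on_bilinear[OF assms(1) bounded_bilinear_inner assms(6) Cinf_on_const] .
    show "Cinf_on S (\<lambda>x. frechet_derivative f (at (t x)) b)"
      using Cinf_on_compose[OF assms(1-3,5) Cinf_on_derivative[OF assms(4)]] .
  qed
qed

section \<open>Smooth functions and vector fields on a manifold\<close>

text \<open>Vectors at \<open>x\<close> are given by their components in the chart preferred at \<open>x\<close>, a choice that need not
  depend continuously on \<open>x\<close>.  Every analytic statement is therefore transported by \<open>tcoord\<close> to a
  chart that stays fixed near the point.\<close>

locale atlas =
  fixes A :: "('a::{t2_space,second_countable_topology}, 'e::euclidean_space) chart set"
  assumes atlas: "smooth_atlas A"
begin

lemma open_domain: "c \<in> A \<Longrightarrow> open (fst c)"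
  and chart_homeomorphism:
    "c \<in> A \<Longrightarrow> homeomorphism (fst c) (snd c ` fst c) (snd c) (chart_inv c)"
  and open_range: "c \<in> A \<Longrightarrow> open (snd c ` fst c)"
  using atlas unfolding smooth_atlas_def by auto

lemma transition_smooth:
  "c \<in> A \<Longrightarrow> d \<in> A \<Longrightarrow> Cinf_on (snd c ` (fst c \<inter> fst d)) (snd d \<circ> chart_inv c)"
  using atlas unfolding smooth_atlas_def by blast

lemma chart_inv_coord [simp]: "c \<in> A \<Longrightarrow> x \<in> fst c \<Longrightarrow> chart_inv c (snd c x) = x"
  using chart_homeomorphism homeomorphism_apply1 by blast

lemma open_chart_image:
  assumes "c \<in> A" "open U" shows "open (snd c ` (fst c \<inter> U))"
proof -
  have "openin (top_of_set (snd c ` fst c)) (snd c ` (fst c \<inter> U))"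
    using homeomorphism_imp_open_map[OF chart_homeomorphism[OF assms(1)]] assms(2)
    by (metis openin_open)
  then show ?thesis using open_range[OF assms(1)] openin_open_trans by blast
qed

lemma open_chart_image': "c \<in> A \<Longrightarrow> open V \<Longrightarrow> V \<subseteq> fst c \<Longrightarrow> open (snd c ` V)"
  using open_chart_image[of c V] by (simp add: inf.absorb2)

lemma chart_at: "chart_at A x \<in> A" "x \<in> fst (chart_at A x)"
proof -
  have "\<exists>c. c \<in> A \<and> x \<in> fst c" using atlas unfolding smooth_atlas_def by blast
  from someI_ex[OF this] show "chart_at A x \<in> A" "x \<in> fst (chart_at A x)"
    unfolding chart_at_def by auto
qed

lemma transition_has_derivative:
  assumes "c \<in> A" "d \<in> A" "x \<in> fst c" "x \<in> fst d"
  shows "((snd d \<circ> chart_inv c) has_derivative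
    frechet_derivative (snd d \<circ> chart_inv c) (at (snd c x))) (at (snd c x))"
  using Cinf_on_has_derivative[OF transition_smooth[OF assms(1,2)]] assms(3,4) by blast

lemma transition_derivative_chain:
  assumes "b \<in> A" "c \<in> A" "x \<in> fst b" "x \<in> fst c"
    and g: "(g has_derivative g') (at (snd c x))"
    and V: "open V" "x \<in> V" and f: "\<And>y. y \<in> V \<Longrightarrow> y \<in> fst c \<Longrightarrow> f (snd b y) = g (snd c y)"
  shows "(f has_derivative (\<lambda>v. g' (frechet_derivative (snd c \<circ> chart_inv b) (at (snd b x)) v)))
    (at (snd b x))"
proof -
  have "(g has_derivative g') (at ((snd c \<circ> chart_inv b) (snd b x)))"
    using g assms by simp
  from diff_chain_at[OF transition_has_derivative[OF assms(1-4)] this]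
  have "((g \<circ> (snd c \<circ> chart_inv b)) has_derivative
    (\<lambda>v. g' (frechet_derivative (snd c \<circ> chart_inv b) (at (snd b x)) v))) (at (snd b x))"
    by (simp add: o_def)
  then show ?thesis
  proof (rule has_derivative_transform_within_open)
    show "open (snd b ` (fst b \<inter> (fst c \<inter> V)))"
      using open_chart_image assms open_domain by blast
    show "snd b x \<in> snd b ` (fst b \<inter> (fst c \<inter> V))" using assms by blast
    show "(g \<circ> (snd c \<circ> chart_inv b)) y = f y" if "y \<in> snd b ` (fst b \<inter> (fst c \<inter> V))" for y
      using that f assms(1) by auto
  qed
qed

text \<open>A derivative in the preferred chart is a derivative in the chart \<open>c\<close>, in the direction whose
  components in \<open>c\<close> are \<open>tcoord A c x v\<close>.\<close>

lemma tcoord_chain: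
  assumes "c \<in> A" "x \<in> fst c"
    and "(g has_derivative g') (at (snd c x))"
    and "open V" "x \<in> V" and "\<And>y. y \<in> V \<Longrightarrow> y \<in> fst c \<Longrightarrow> f y = g (snd c y)"
  shows "((f \<circ> chart_inv (chart_at A x)) has_derivative (\<lambda>v. g' (tcoord A c x v)))
    (at (snd (chart_at A x) x))"
  unfolding tcoord_def
proof (rule transition_derivative_chain[OF chart_at(1) assms(1) chart_at(2) assms(2,3)])
  show "open (V \<inter> fst (chart_at A x))" using assms open_domain chart_at by blast
  show "x \<in> V \<inter> fst (chart_at A x)" using assms chart_at by blast
qed (use assms(6) chart_at in auto)

text \<open>With \<open>d\<close> the preferred chart, this also shows that \<open>tcoord A c x\<close> is injective.\<close>

lemma tcoord_transition:
  assumes "c \<in> A" "d \<in> A" "x \<in> fst c" "x \<in> fst d"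
  shows "tcoord A d x v = frechet_derivative (snd d \<circ> chart_inv c) (at (snd c x)) (tcoord A c x v)"
proof -
  have "((snd d \<circ> chart_inv (chart_at A x)) has_derivative
     (\<lambda>v. frechet_derivative (snd d \<circ> chart_inv c) (at (snd c x)) (tcoord A c x v)))
     (at (snd (chart_at A x) x))"
    by (rule tcoord_chain[OF assms(1,3) transition_has_derivative[OF assms] open_domain[OF assms(2)] assms(4)])
      (use assms in auto)
  from frechet_derivative_at[OF this] show ?thesis
    unfolding tcoord_def by metis
qed

lemma linear_tcoord:
  assumes "c \<in> A" "x \<in> fst c" shows "linear (tcoord A c x)"
  using has_derivative_linear[OF transition_has_derivative[OF chart_at(1)[of x] assms(1) chart_at(2) assms(2)]]
  unfolding tcoord_def .

lemma tcoord_chart_at [simp]: "tcoord A (chart_at A x) x v = v"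
proof -
  let ?c = "chart_at A x"
  have "((\<lambda>y. y) has_derivative (\<lambda>v. v)) (at (snd ?c x))" by simp
  from tcoord_chain[OF chart_at this open_UNIV]
  have "((snd ?c \<circ> chart_inv ?c) has_derivative tcoord A ?c x) (at (snd ?c x))"
    by simp
  moreover have "((snd ?c \<circ> chart_inv ?c) has_derivative (\<lambda>v. v)) (at (snd ?c x))"
    by (rule has_derivative_transform_within_open[of "\<lambda>y. y", OF _ open_range[OF chart_at(1)[of x]]])
      (use chart_at in auto)
  ultimately show ?thesis using has_derivative_unique by metis
qed

lemma inj_tcoord: assumes "c \<in> A" "x \<in> fst c" shows "inj (tcoord A c x)"
  by (rule injI) (metis tcoord_transition[OF assms(1) chart_at(1) assms(2) chart_at(2)] tcoord_chart_at)

lemma surj_tcoord: assumes "c \<in> A" "x \<in> fst c" shows "surj (tcoord A c x)"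
  using linear_injective_imp_surjective[OF linear_tcoord inj_tcoord] assms by blast

lemma coord_field_coord:
  "c \<in> A \<Longrightarrow> x \<in> fst c \<Longrightarrow> coord_field A c X (snd c x) = tcoord A c x (X x)"
  unfolding coord_field_def by simp

text \<open>One chart around each point suffices, since transition maps are smooth.\<close>

lemma smooth_fun_local:
  assumes "\<And>x. x \<in> U \<Longrightarrow> \<exists>c\<in>A. \<exists>V. open V \<and> x \<in> V \<and> V \<subseteq> fst c \<and> Cinf_on (snd c ` V) (f \<circ> chart_inv c)"
  shows "smooth_fun A U f"
  unfolding smooth_fun_def
proof (intro ballI Cinf_on_local)
  fix d y assume d: "d \<in> A" and "y \<in> snd d ` (fst d \<inter> U)"
  then obtain x where x: "x \<in> fst d" "x \<in> U" "y = snd d x" by blast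
  obtain c V where c: "c \<in> A" "open V" "x \<in> V" "V \<subseteq> fst c" and f: "Cinf_on (snd c ` V) (f \<circ> chart_inv c)"
    using assms[OF x(2)] by blast
  let ?T = "snd d ` (fst d \<inter> V)"
  have T: "open ?T" "open (snd c ` V)" using open_chart_image open_chart_image' d c by auto
  have "Cinf_on ?T (snd c \<circ> chart_inv d)"
    by (rule Cinf_on_subset[OF transition_smooth[OF d c(1)]]) (use c(4) in blast)
  then have "Cinf_on ?T (\<lambda>y. (f \<circ> chart_inv c) ((snd c \<circ> chart_inv d) y))"
    by (intro Cinf_on_compose[OF T _ _ f]) (use d in \<open>auto simp: o_def\<close>)
  then have "Cinf_on ?T (f \<circ> chart_inv d)"
    by (rule Cinf_on_cong[OF T(1), rotated]) (use d c in auto)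
  with T(1) c(3) x show "\<exists>T. open T \<and> y \<in> T \<and> Cinf_on T (f \<circ> chart_inv d)" by blast
qed

text \<open>The components in another chart arise by applying the derivative of the transition map.\<close>

lemma smooth_field_local:
  assumes "\<And>x. x \<in> U \<Longrightarrow> \<exists>c\<in>A. \<exists>V. open V \<and> x \<in> V \<and> V \<subseteq> fst c \<and> Cinf_on (snd c ` V) (coord_field A c X)"
  shows "smooth_field A U X"
  unfolding smooth_field_def
proof (intro ballI Cinf_on_local)
  fix d y assume d: "d \<in> A" and "y \<in> snd d ` (fst d \<inter> U)"
  then obtain x where x: "x \<in> fst d" "x \<in> U" "y = snd d x" by blast
  obtain c V where c: "c \<in> A" "open V" "x \<in> V" "V \<subseteq> fst c" and X: "Cinf_on (snd c ` V) (coord_field A c X)"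
    using assms[OF x(2)] by blast
  let ?T = "snd d ` (fst d \<inter> V)" and ?t = "snd c \<circ> chart_inv d"
  have T: "open ?T" "open (snd c ` V)" using open_chart_image open_chart_image' d c by auto
  have t: "Cinf_on ?T ?t"
    by (rule Cinf_on_subset[OF transition_smooth[OF d c(1)]]) (use c(4) in blast)
  have tT: "?t y \<in> snd c ` V" if "y \<in> ?T" for y using that d by auto
  have O: "open (snd c ` (fst c \<inter> fst d))" using open_chart_image c(1) open_domain[OF d] by blast
  have "Cinf_on ?T (\<lambda>y. frechet_derivative (snd d \<circ> chart_inv c) (at (?t y)) (coord_field A c X (?t y)))"
  proof (rule Cinf_on_apply_derivative[OF T(1) O _ transition_smooth[OF c(1) d] t])
    show "?t y \<in> snd c ` (fst c \<inter> fst d)" if "y \<in> ?T" for y using that d c by auto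
    show "Cinf_on ?T (\<lambda>y. coord_field A c X (?t y))"
      using Cinf_on_compose[OF T tT t X] .
  qed
  then have "Cinf_on ?T (coord_field A d X)"
  proof (rule Cinf_on_cong[OF T(1), rotated])
    fix y assume "y \<in> ?T"
    then obtain z where z: "z \<in> fst d" "z \<in> V" "y = snd d z" by blast
    with c have zc: "z \<in> fst c" by blast
    show "frechet_derivative (snd d \<circ> chart_inv c) (at (?t y)) (coord_field A c X (?t y)) = coord_field A d X y"
      using tcoord_transition[OF c(1) d zc z(1)] z d c(1) zc by (simp add: coord_field_coord)
  qed
  with T(1) c(3) x show "\<exists>T. open T \<and> y \<in> T \<and> Cinf_on T (coord_field A d X)" by blast
qed

lemma smooth_fun_in_chart:
  assumes "c \<in> A" "open V" "V \<subseteq> fst c" "Cinf_on (snd c ` V) (f \<circ> chart_inv c)"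
  shows "smooth_fun A V f"
  using assms by (intro smooth_fun_local) blast

lemma smooth_field_in_chart:
  assumes "c \<in> A" "open V" "V \<subseteq> fst c" "Cinf_on (snd c ` V) (coord_field A c X)"
  shows "smooth_field A V X"
  using assms by (intro smooth_field_local) blast

lemma smooth_fun_chart:
  "smooth_fun A U f \<Longrightarrow> c \<in> A \<Longrightarrow> Cinf_on (snd c ` (fst c \<inter> U)) (f \<circ> chart_inv c)"
  unfolding smooth_fun_def by blast

lemma smooth_field_chart:
  "smooth_field A U X \<Longrightarrow> c \<in> A \<Longrightarrow> Cinf_on (snd c ` (fst c \<inter> U)) (coord_field A c X)"
  unfolding smooth_field_def by blast

lemma smooth_fun_subset: "smooth_fun A U f \<Longrightarrow> V \<subseteq> U \<Longrightarrow> smooth_fun A V f"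
  unfolding smooth_fun_def by (meson Cinf_on_subset Int_mono image_mono order_refl)

lemma smooth_field_subset: "smooth_field A U X \<Longrightarrow> V \<subseteq> U \<Longrightarrow> smooth_field A V X"
  unfolding smooth_field_def by (meson Cinf_on_subset Int_mono image_mono order_refl)

lemma section_of_subset: "section_of A U D X \<Longrightarrow> V \<subseteq> U \<Longrightarrow> section_of A V D X"
  unfolding section_of_def using smooth_field_subset by blast

lemma smooth_fun_cover:
  assumes "\<And>x. x \<in> U \<Longrightarrow> \<exists>V. open V \<and> x \<in> V \<and> smooth_fun A V f"
  shows "smooth_fun A U f"
proof (rule smooth_fun_local)
  fix x assume "x \<in> U"
  then obtain V where V: "open V" "x \<in> V" "smooth_fun A V f" using assms by blast
  let ?c = "chart_at A x"
  have "open (fst ?c \<inter> V)" "x \<in> fst ?c \<inter> V"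
    using V chart_at open_domain[OF chart_at(1)] by auto
  with smooth_fun_chart[OF V(3) chart_at(1)[of x]] chart_at(1)[of x]
  show "\<exists>c\<in>A. \<exists>V. open V \<and> x \<in> V \<and> V \<subseteq> fst c \<and> Cinf_on (snd c ` V) (f \<circ> chart_inv c)"
    by blast
qed

lemma smooth_field_cover:
  assumes "\<And>x. x \<in> U \<Longrightarrow> \<exists>V. open V \<and> x \<in> V \<and> smooth_field A V X"
  shows "smooth_field A U X"
proof (rule smooth_field_local)
  fix x assume "x \<in> U"
  then obtain V where V: "open V" "x \<in> V" "smooth_field A V X" using assms by blast
  let ?c = "chart_at A x"
  have "open (fst ?c \<inter> V)" "x \<in> fst ?c \<inter> V"
    using V chart_at open_domain[OF chart_at(1)] by auto
  with smooth_field_chart[OF V(3) chart_at(1)[of x]] chart_at(1)[of x]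
  show "\<exists>c\<in>A. \<exists>V. open V \<and> x \<in> V \<and> V \<subseteq> fst c \<and> Cinf_on (snd c ` V) (coord_field A c X)"
    by blast
qed

lemma smooth_fun_cong:
  assumes "open U" "\<And>x. x \<in> U \<Longrightarrow> f x = g x" "smooth_fun A U f" shows "smooth_fun A U g"
  unfolding smooth_fun_def
proof
  fix c assume c: "c \<in> A"
  show "Cinf_on (snd c ` (fst c \<inter> U)) (g \<circ> chart_inv c)"
    by (rule Cinf_on_cong[OF open_chart_image[OF c assms(1)] _ smooth_fun_chart[OF assms(3) c]])
      (use assms(2) c in auto)
qed

lemma smooth_field_cong:
  assumes "open U" "\<And>x. x \<in> U \<Longrightarrow> X x = Y x" "smooth_field A U X" shows "smooth_field A U Y"
  unfolding smooth_field_def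
proof
  fix c assume c: "c \<in> A"
  show "Cinf_on (snd c ` (fst c \<inter> U)) (coord_field A c Y)"
    by (rule Cinf_on_cong[OF open_chart_image[OF c assms(1)] _ smooth_field_chart[OF assms(3) c]])
      (use assms(2) c in \<open>auto simp: coord_field_coord\<close>)
qed

lemma smooth_fun_const: "smooth_fun A U (\<lambda>x. r)"
  unfolding smooth_fun_def by (simp add: o_def Cinf_on_const)

lemma smooth_fun_add:
  assumes "open U" "smooth_fun A U f" "smooth_fun A U g"
  shows "smooth_fun A U (\<lambda>x. f x + g x)"
  unfolding smooth_fun_def o_def
  by (intro ballI Cinf_on_add[OF open_chart_image[OF _ assms(1)]]
      assms(2,3)[unfolded smooth_fun_def o_def, rule_format])

lemma smooth_fun_mult:
  assumes "open U" "smooth_fun A U f" "smooth_fun A U g"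
  shows "smooth_fun A U (\<lambda>x. f x * g x)"
  unfolding smooth_fun_def o_def
  by (intro ballI Cinf_on_bilinear[OF open_chart_image[OF _ assms(1)] bounded_bilinear_mult]
      assms(2,3)[unfolded smooth_fun_def o_def, rule_format])

lemma smooth_fun_minus:
  assumes "open U" "smooth_fun A U f" shows "smooth_fun A U (\<lambda>x. - f x)"
  using smooth_fun_mult[OF assms(1) smooth_fun_const[of U "-1"] assms(2)] by simp

lemma smooth_fun_diff:
  assumes "open U" "smooth_fun A U f" "smooth_fun A U g"
  shows "smooth_fun A U (\<lambda>x. f x - g x)"
  using smooth_fun_add[OF assms(1,2) smooth_fun_minus[OF assms(1,3)]] by simp

lemma smooth_fun_divide:
  assumes "open U" "smooth_fun A U f" "smooth_fun A U g" "\<And>x. x \<in> U \<Longrightarrow> g x \<noteq> 0"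
  shows "smooth_fun A U (\<lambda>x. f x / g x)"
proof -
  have "smooth_fun A U (\<lambda>x. inverse (g x))"
    unfolding smooth_fun_def
  proof
    fix c assume c: "c \<in> A"
    have "Cinf_on (snd c ` (fst c \<inter> U)) (\<lambda>x. inverse ((g \<circ> chart_inv c) x))"
      by (rule Cinf_on_inverse[OF open_chart_image[OF c assms(1)] smooth_fun_chart[OF assms(3) c]])
        (use assms(4) c in auto)
    then show "Cinf_on (snd c ` (fst c \<inter> U)) ((\<lambda>x. inverse (g x)) \<circ> chart_inv c)"
      by (simp add: o_def)
  qed
  from smooth_fun_mult[OF assms(1,2) this] show ?thesis by (simp add: divide_inverse)
qed

lemma smooth_field_add:
  assumes "open U" "smooth_field A U X" "smooth_field A U Y"
  shows "smooth_field A U (\<lambda>x. X x + Y x)"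
  unfolding smooth_field_def
proof
  fix c assume c: "c \<in> A"
  let ?S = "snd c ` (fst c \<inter> U)"
  have "Cinf_on ?S (\<lambda>y. coord_field A c X y + coord_field A c Y y)"
    by (rule Cinf_on_add) (use assms c open_chart_image smooth_field_chart in auto)
  then show "Cinf_on ?S (coord_field A c (\<lambda>x. X x + Y x))"
    by (rule Cinf_on_cong[OF open_chart_image[OF c assms(1)], rotated])
      (use c in \<open>auto simp: coord_field_coord linear_add linear_tcoord\<close>)
qed

lemma smooth_field_scale:
  assumes "open U" "smooth_fun A U f" "smooth_field A U X"
  shows "smooth_field A U (\<lambda>x. f x *\<^sub>R X x)"
  unfolding smooth_field_def
proof
  fix c assume c: "c \<in> A"
  let ?S = "snd c ` (fst c \<inter> U)"
  have "Cinf_on ?S (\<lambda>y. (f \<circ> chart_inv c) y *\<^sub>R coord_field A c X y)"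
    using Cinf_on_bilinear[OF open_chart_image[OF c assms(1)] bounded_bilinear_scaleR
        smooth_fun_chart[OF assms(2) c] smooth_field_chart[OF assms(3) c]] .
  then show "Cinf_on ?S (coord_field A c (\<lambda>x. f x *\<^sub>R X x))"
    by (rule Cinf_on_cong[OF open_chart_image[OF c assms(1)], rotated])
      (use c in \<open>auto simp: coord_field_coord linear_scale linear_tcoord\<close>)
qed

lemma smooth_field_diff_scale:
  assumes "open U" "smooth_field A U X" "smooth_fun A U f" "smooth_field A U Y"
  shows "smooth_field A U (\<lambda>x. X x - f x *\<^sub>R Y x)"
  using smooth_field_add[OF assms(1,2) smooth_field_scale[OF assms(1) smooth_fun_minus[OF assms(1,3)] assms(4)]]
  by simp

lemma smooth_field_zero: "open U \<Longrightarrow> smooth_field A U (\<lambda>x. 0)"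
  unfolding smooth_field_def
proof
  fix c assume "open U" and c: "c \<in> A"
  show "Cinf_on (snd c ` (fst c \<inter> U)) (coord_field A c (\<lambda>x. 0))"
    by (rule Cinf_on_cong[OF open_chart_image[OF c \<open>open U\<close>] _ Cinf_on_const[of _ 0]])
      (use c in \<open>auto simp: coord_field_coord linear_0 linear_tcoord\<close>)
qed

lemma open_nonzero:
  assumes "open U" "smooth_fun A U f" shows "open {x \<in> U. f x \<noteq> 0}"
proof -
  have "continuous_on (fst c \<inter> U) f" if c: "c \<in> A" for c
  proof -
    have "continuous_on (fst c \<inter> U) (\<lambda>x. (f \<circ> chart_inv c) (snd c x))"
      by (rule continuous_on_compose2[OF Cinf_on_continuous[OF smooth_fun_chart[OF assms(2) c]]])
        (use chart_homeomorphism[OF c] in \<open>auto simp: homeomorphism_def intro: continuous_on_subset\<close>)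
    then show ?thesis by (rule continuous_on_eq) (use c in simp)
  qed
  then have "isCont f x" if "x \<in> U" for x
    using that chart_at[of x] open_domain[OF chart_at(1)[of x]] assms(1)
    by (meson IntI continuous_on_eq_continuous_at open_Int)
  then have "continuous_on U f" by (simp add: continuous_at_imp_continuous_on)
  from continuous_open_preimage[OF this assms(1) open_Compl[OF closed_singleton[of 0]]] show ?thesis
    by (simp add: vimage_def Int_def Compl_eq)
qed

definition const_field :: "('a, 'e) chart \<Rightarrow> 'e \<Rightarrow> 'a \<Rightarrow> 'e" where
  "const_field c w x = inv (tcoord A c x) w"

lemma tcoord_const_field [simp]:
  "c \<in> A \<Longrightarrow> x \<in> fst c \<Longrightarrow> tcoord A c x (const_field c w x) = w"
  unfolding const_field_def using surj_tcoord surj_f_inv_f by metis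

lemma const_field_tcoord [simp]:
  "c \<in> A \<Longrightarrow> x \<in> fst c \<Longrightarrow> const_field c (tcoord A c x v) x = v"
  unfolding const_field_def using inj_tcoord inv_f_f by metis

lemma smooth_const_field:
  assumes c: "c \<in> A" shows "smooth_field A (fst c) (const_field c w)"
proof (rule smooth_field_in_chart[OF c open_domain[OF c] order_refl])
  show "Cinf_on (snd c ` fst c) (coord_field A c (const_field c w))"
    by (rule Cinf_on_cong[OF open_range[OF c] _ Cinf_on_const[of _ w]])
      (use c in \<open>auto simp: coord_field_coord\<close>)
qed

text \<open>Every form that is used below is an instance of this notion: the metric \<open>g\<close> itself, and the
  Euclidean metric of a chart domain, which stands in where no metric on \<open>TM\<close> is given yet.\<close>

definition smooth_form_on :: "'a set \<Rightarrow> ('a, 'e) form \<Rightarrow> bool" where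
  "smooth_form_on U B \<longleftrightarrow> (\<forall>x\<in>U. bilinear (B x) \<and> (\<forall>u v. B x u v = B x v u)) \<and>
     (\<forall>V X Y. open V \<longrightarrow> V \<subseteq> U \<longrightarrow> smooth_field A V X \<longrightarrow> smooth_field A V Y \<longrightarrow>
        smooth_fun A V (\<lambda>x. B x (X x) (Y x)))"

definition chart_metric :: "('a, 'e) chart \<Rightarrow> ('a, 'e) form" where
  "chart_metric c x u v = tcoord A c x u \<bullet> tcoord A c x v"

lemma smooth_form_chart_metric:
  assumes c: "c \<in> A" shows "smooth_form_on (fst c) (chart_metric c)"
  unfolding smooth_form_on_def
proof (intro conjI ballI allI impI)
  fix x assume x: "x \<in> fst c"
  show "bilinear (chart_metric c x)"
    unfolding bilinear_def chart_metric_def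
    using linear_tcoord[OF c x]
    by (auto intro!: linearI simp: linear_add linear_scale inner_add_left inner_add_right)
  show "chart_metric c x u v = chart_metric c x v u" for u v
    by (simp add: chart_metric_def inner_commute)
next
  fix V X Y assume V: "open V" "V \<subseteq> fst c" and X: "smooth_field A V X" and Y: "smooth_field A V Y"
  from V have [simp]: "fst c \<inter> V = V" by blast
  have S: "open (snd c ` V)" using open_chart_image'[OF c V] .
  show "smooth_fun A V (\<lambda>x. chart_metric c x (X x) (Y x))"
  proof (rule smooth_fun_in_chart[OF c V])
    have "Cinf_on (snd c ` V) (\<lambda>y. coord_field A c X y \<bullet> coord_field A c Y y)"
      using Cinf_on_bilinear[OF S bounded_bilinear_inner] smooth_field_chart[OF X c]
        smooth_field_chart[OF Y c] by simp
    then show "Cinf_on (snd c ` V) ((\<lambda>x. chart_metric c x (X x) (Y x)) \<circ> chart_inv c)"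
      by (simp add: o_def chart_metric_def coord_field_def)
  qed
qed

lemma chart_metric_pos:
  assumes "c \<in> A" "x \<in> fst c" "v \<noteq> 0" shows "chart_metric c x v v > 0"
proof -
  have "tcoord A c x v \<noteq> 0"
    using inj_tcoord[OF assms(1,2)] linear_0[OF linear_tcoord[OF assms(1,2)]] assms(3)
    by (metis injD)
  then show ?thesis by (simp add: chart_metric_def)
qed

lemma vec_deriv_has_derivative:
  assumes "open U" "smooth_fun A U f" "x \<in> U"
  shows "((f \<circ> chart_inv (chart_at A x)) has_derivative (\<lambda>v. vec_deriv A x v f)) (at (snd (chart_at A x) x))"
  unfolding vec_deriv_def
  by (rule Cinf_on_has_derivative[OF smooth_fun_chart[OF assms(2) chart_at(1)[of x]]])
    (use assms chart_at in blast)

lemma vec_deriv_chart: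
  assumes "open U" "smooth_fun A U f" "x \<in> U" "c \<in> A" "x \<in> fst c"
  shows "vec_deriv A x v f = frechet_derivative (f \<circ> chart_inv c) (at (snd c x)) (tcoord A c x v)"
proof -
  have "(f \<circ> chart_inv c has_derivative frechet_derivative (f \<circ> chart_inv c) (at (snd c x))) (at (snd c x))"
    by (rule Cinf_on_has_derivative[OF smooth_fun_chart[OF assms(2,4)]]) (use assms in blast)
  from tcoord_chain[OF assms(4,5) this assms(1,3)]
  have "((f \<circ> chart_inv (chart_at A x)) has_derivative
    (\<lambda>v. frechet_derivative (f \<circ> chart_inv c) (at (snd c x)) (tcoord A c x v))) (at (snd (chart_at A x) x))"
    using assms(4) by simp
  from frechet_derivative_at[OF this] show ?thesis unfolding vec_deriv_def by metis
qed

lemma smooth_vec_deriv: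
  assumes "open U" "smooth_fun A U f" "smooth_field A U X"
  shows "smooth_fun A U (\<lambda>x. vec_deriv A x (X x) f)"
  unfolding smooth_fun_def
proof
  fix c assume c: "c \<in> A"
  let ?S = "snd c ` (fst c \<inter> U)"
  have S: "open ?S" using open_chart_image[OF c assms(1)] .
  have "Cinf_on ?S (\<lambda>y. frechet_derivative (f \<circ> chart_inv c) (at y) (coord_field A c X y))"
    using Cinf_on_apply_derivative[OF S S, of "\<lambda>y. y"] smooth_fun_chart[OF assms(2) c]
      smooth_field_chart[OF assms(3) c] Ck_on_id[OF S] by (auto simp: Cinf_on_def)
  then show "Cinf_on ?S ((\<lambda>x. vec_deriv A x (X x) f) \<circ> chart_inv c)"
    by (rule Cinf_on_cong[OF S, rotated])
      (use vec_deriv_chart[OF assms(1,2) _ c] c in \<open>auto simp: coord_field_coord\<close>)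
qed

end

section \<open>Smooth frames and projections\<close>

lemma dim_span_lessThan_le: "dim ((\<lambda>i. f i) ` {..<k::nat}) \<le> k" for f :: "nat \<Rightarrow> 'e::euclidean_space"
  by (metis card_image_le card_lessThan dim_le_card' finite_imageI finite_lessThan le_trans)

lemma dim_span_lessThan_iff:
  fixes f :: "nat \<Rightarrow> 'e::euclidean_space"
  shows "dim (span (f ` {..<k})) = k \<longleftrightarrow> (\<forall>j<k. f j \<notin> span (f ` {..<j}))"
proof (induction k)
  case (Suc k)
  have "dim (span (f ` {..<Suc k})) =
      (if f k \<in> span (f ` {..<k}) then dim (f ` {..<k}) else Suc (dim (f ` {..<k})))"
    by (simp add: lessThan_Suc dim_insert)
  then show ?case
    using Suc dim_span_lessThan_le[of f k] by (auto simp: less_Suc_eq)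
qed simp

lemma bilinear_simps:
  assumes "bilinear B"
  shows "B (u + v) w = B u w + B v w" "B w (u + v) = B w u + B w v"
    "B (u - v) w = B u w - B v w" "B w (u - v) = B w u - B w v"
    "B (r *\<^sub>R u) w = r *\<^sub>R B u w" "B w (r *\<^sub>R u) = r *\<^sub>R B w u"
    "B 0 w = 0" "B w 0 = 0"
  using assms by (auto simp: bilinear_ladd bilinear_radd bilinear_lsub bilinear_rsub bilinear_lmul
      bilinear_rmul bilinear_lzero bilinear_rzero)

context atlas
begin

lemma smooth_form_bilinear: "smooth_form_on U B \<Longrightarrow> x \<in> U \<Longrightarrow> bilinear (B x)"
  and smooth_form_sym: "smooth_form_on U B \<Longrightarrow> x \<in> U \<Longrightarrow> B x u v = B x v u"
  and smooth_form_smooth: "smooth_form_on U B \<Longrightarrow> open V \<Longrightarrow> V \<subseteq> U \<Longrightarrow> smooth_field A V X \<Longrightarrow>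
    smooth_field A V Y \<Longrightarrow> smooth_fun A V (\<lambda>x. B x (X x) (Y x))"
  unfolding smooth_form_on_def by blast+

lemma smooth_form_on_subset: "smooth_form_on U B \<Longrightarrow> V \<subseteq> U \<Longrightarrow> smooth_form_on V B"
  unfolding smooth_form_on_def by (meson subset_iff subset_trans)

text \<open>Orthogonal projection preserves smoothness.  This is one Gram-Schmidt step per frame field:
  with \<open>N\<close> the component of \<open>F k\<close> orthogonal to the preceding fields, the projection of \<open>X\<close> grows by
  \<open>B(X, N) / B(N, N) N\<close>, so that neither square roots nor matrix inverses occur.  All smoothness
  of components relative to frames below is derived from this lemma.\<close>

lemma smooth_projection:
  fixes F :: "nat \<Rightarrow> 'a \<Rightarrow> 'e"
  assumes U: "open U" and B: "smooth_form_on U B"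
    and "\<And>i. i < k \<Longrightarrow> smooth_field A U (F i)"
    and "\<And>y v. y \<in> U \<Longrightarrow> v \<in> span ((\<lambda>i. F i y) ` {..<k}) \<Longrightarrow> v \<noteq> 0 \<Longrightarrow> B y v v > 0"
    and "\<And>y j. y \<in> U \<Longrightarrow> j < k \<Longrightarrow> F j y \<notin> span ((\<lambda>i. F i y) ` {..<j})"
    and "smooth_field A U X"
  obtains Y where "smooth_field A U Y"
    "\<And>y. y \<in> U \<Longrightarrow> Y y \<in> span ((\<lambda>i. F i y) ` {..<k})"
    "\<And>y v. y \<in> U \<Longrightarrow> v \<in> span ((\<lambda>i. F i y) ` {..<k}) \<Longrightarrow> B y (X y - Y y) v = 0"
proof -
  let ?S = "\<lambda>k y. span ((\<lambda>i. F i y) ` {..<k})"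
  have "\<exists>Y. smooth_field A U Y \<and> (\<forall>y\<in>U. Y y \<in> ?S k y \<and> (\<forall>v\<in>?S k y. B y (X y - Y y) v = 0))"
    using assms(3-6)
  proof (induction k arbitrary: X)
    case 0
    then show ?case
      using smooth_field_zero[OF U] smooth_form_bilinear[OF B]
      by (intro exI[of _ "\<lambda>x. 0"]) (auto simp: bilinear_rzero)
  next
    case (Suc k)
    have mono: "?S k y \<subseteq> ?S (Suc k) y" for y by (intro span_mono image_mono) auto
    have IH: "\<exists>Y. smooth_field A U Y \<and> (\<forall>y\<in>U. Y y \<in> ?S k y \<and> (\<forall>v\<in>?S k y. B y (X y - Y y) v = 0))"
      if "smooth_field A U X" for X
    proof (rule Suc.IH)
      show "B y v v > 0" if "y \<in> U" "v \<in> ?S k y" "v \<noteq> 0" for y v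
        using Suc.prems(2) that mono by blast
    qed (use Suc.prems that in auto)
    obtain P where P: "smooth_field A U P" "\<And>y. y \<in> U \<Longrightarrow> P y \<in> ?S k y"
      "\<And>y v. y \<in> U \<Longrightarrow> v \<in> ?S k y \<Longrightarrow> B y (F k y - P y) v = 0"
      using IH[OF Suc.prems(1)[of k]] by blast
    define N where "N y = F k y - P y" for y
    have NS: "smooth_field A U N"
      using smooth_field_diff_scale[OF U Suc.prems(1)[of k] smooth_fun_const[of U 1] P(1)]
      by (simp add: N_def[abs_def])
    have NF: "F k y \<in> ?S (Suc k) y" for y by (intro span_base) auto
    have Nmem: "N y \<in> ?S (Suc k) y" if "y \<in> U" for y
      unfolding N_def using NF P(2)[OF that] mono by (blast intro: span_diff)
    have Npos: "B y (N y) (N y) > 0" if "y \<in> U" for y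
    proof (rule Suc.prems(2)[OF that Nmem[OF that]])
      show "N y \<noteq> 0" using P(2)[OF that] Suc.prems(3)[OF that, of k] by (auto simp: N_def)
    qed
    have Nperp: "B y (N y) v = 0" if "y \<in> U" "v \<in> ?S k y" for y v
      using P(3)[OF that] by (simp add: N_def)
    obtain Q where Q: "smooth_field A U Q" "\<And>y. y \<in> U \<Longrightarrow> Q y \<in> ?S k y"
      "\<And>y v. y \<in> U \<Longrightarrow> v \<in> ?S k y \<Longrightarrow> B y (X y - Q y) v = 0"
      using IH[OF Suc.prems(4)] by blast
    define t where "t y = B y (X y) (N y) / B y (N y) (N y)" for y
    have tS: "smooth_fun A U t"
      unfolding t_def[abs_def] using Npos
      by (intro smooth_fun_divide U smooth_form_smooth[OF B U order_refl] Suc.prems NS) force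
    show ?case
    proof (intro exI[of _ "\<lambda>y. Q y + t y *\<^sub>R N y"] conjI ballI)
      show "smooth_field A U (\<lambda>y. Q y + t y *\<^sub>R N y)"
        by (intro smooth_field_add smooth_field_scale U Q(1) tS NS)
    next
      fix y assume y: "y \<in> U"
      show "Q y + t y *\<^sub>R N y \<in> ?S (Suc k) y"
        using Q(2)[OF y] Nmem[OF y] mono by (blast intro: span_add span_scale)
      fix v assume "v \<in> ?S (Suc k) y"
      then obtain r where "v - r *\<^sub>R F k y \<in> ?S k y"
        using span_breakdown_eq by (metis image_insert lessThan_Suc)
      then have "(v - r *\<^sub>R F k y) + r *\<^sub>R P y \<in> ?S k y"
        using P(2)[OF y] by (intro span_add span_scale)
      moreover have "v = r *\<^sub>R N y + ((v - r *\<^sub>R F k y) + r *\<^sub>R P y)"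
        by (simp add: N_def algebra_simps)
      ultimately obtain s where s: "s \<in> ?S k y" and v: "v = r *\<^sub>R N y + s" by blast
      note bs = bilinear_simps[OF smooth_form_bilinear[OF B y]]
      have "B y (Q y) (N y) = 0"
        using Nperp[OF y Q(2)[OF y]] smooth_form_sym[OF B y] by metis
      then have "B y (X y - (Q y + t y *\<^sub>R N y)) (N y) = 0"
        using Npos[OF y] by (simp add: bs t_def)
      moreover have "B y (X y - (Q y + t y *\<^sub>R N y)) s = 0"
        using Q(3)[OF y s] Nperp[OF y s] by (simp add: bs)
      ultimately show "B y (X y - (Q y + t y *\<^sub>R N y)) v = 0"
        unfolding v by (simp add: bs(2,6))
    qed
  qed
  then show ?thesis using that by blast
qed

text \<open>With \<open>N\<close> the component of the last field orthogonal to the others, dependence at \<open>y\<close> forces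
  \<open>B(N, N) = 0\<close> there; so \<open>B(N, N) \<noteq> 0\<close> describes a suitable neighbourhood.\<close>

lemma independence_open:
  fixes F :: "nat \<Rightarrow> 'a \<Rightarrow> 'e"
  assumes "open U" "x \<in> U" "\<And>i. i < k \<Longrightarrow> smooth_field A U (F i)"
    and "\<And>j. j < k \<Longrightarrow> F j x \<notin> span ((\<lambda>i. F i x) ` {..<j})"
  obtains V where "open V" "x \<in> V" "V \<subseteq> U"
    "\<And>y j. y \<in> V \<Longrightarrow> j < k \<Longrightarrow> F j y \<notin> span ((\<lambda>i. F i y) ` {..<j})"
proof -
  let ?I = "\<lambda>k V. \<forall>y\<in>V. \<forall>j<k. F j y \<notin> span ((\<lambda>i. F i y) ` {..<j})"
  have "\<exists>V. open V \<and> x \<in> V \<and> V \<subseteq> U \<and> ?I k V"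
    using assms(3,4)
  proof (induction k)
    case 0
    then show ?case using assms(1,2) by auto
  next
    case (Suc k)
    then obtain V0 where V0: "open V0" "x \<in> V0" "V0 \<subseteq> U" "?I k V0" by auto
    define V where "V = V0 \<inter> fst (chart_at A x)"
    let ?B = "chart_metric (chart_at A x)"
    have V: "open V" "x \<in> V" "V \<subseteq> U" "V \<subseteq> fst (chart_at A x)" "?I k V"
      using V0 chart_at[of x] open_domain[OF chart_at(1)[of x]] by (auto simp: V_def)
    have B: "smooth_form_on V ?B"
      using smooth_form_on_subset[OF smooth_form_chart_metric V(4)] chart_at by blast
    have sm: "smooth_field A V (F i)" if "i \<le> k" for i
      using smooth_field_subset Suc.prems(1)[of i] V(3) that by auto
    have pos: "?B y v v > 0" if "y \<in> V" "v \<noteq> 0" for y v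
      using chart_metric_pos chart_at(1) that V(4) by blast
    obtain P where P: "smooth_field A V P" "\<And>y. y \<in> V \<Longrightarrow> P y \<in> span ((\<lambda>i. F i y) ` {..<k})"
      "\<And>y v. y \<in> V \<Longrightarrow> v \<in> span ((\<lambda>i. F i y) ` {..<k}) \<Longrightarrow> ?B y (F k y - P y) v = 0"
      by (rule smooth_projection[OF V(1) B, of k F "F k"]) (use sm pos V(5) in auto)
    define N where "N y = F k y - P y" for y
    have NS: "smooth_field A V N"
      using smooth_field_diff_scale[OF V(1) sm[of k] smooth_fun_const[of V 1] P(1)]
      by (simp add: N_def[abs_def])
    define V' where "V' = {y \<in> V. ?B y (N y) (N y) \<noteq> 0}"
    have "open V'"
      unfolding V'_def using open_nonzero smooth_form_smooth[OF B V(1) order_refl NS NS] V(1) by blast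
    moreover have "x \<in> V'"
    proof -
      have "N x \<noteq> 0" using P(2)[OF V(2)] Suc.prems(2)[of k] by (auto simp: N_def)
      then show ?thesis using pos[OF V(2)] V(2) by (force simp: V'_def)
    qed
    moreover have "F k y \<notin> span ((\<lambda>i. F i y) ` {..<k})" if "y \<in> V'" for y
    proof
      assume "F k y \<in> span ((\<lambda>i. F i y) ` {..<k})"
      moreover have y: "y \<in> V" using that by (simp add: V'_def)
      ultimately have "N y \<in> span ((\<lambda>i. F i y) ` {..<k})"
        using P(2) by (simp add: N_def span_diff)
      from P(3)[OF y this] that show False by (simp add: N_def V'_def)
    qed
    ultimately have "open V' \<and> x \<in> V' \<and> V' \<subseteq> U \<and> ?I (Suc k) V'"
      using V(3,5) by (auto simp: V'_def less_Suc_eq)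
    then show ?case by blast
  qed
  then show ?thesis using that by blast
qed

lemma distribution_frame:
  assumes "distribution_on A U k D" "x \<in> U"
  obtains V F where "open V" "x \<in> V" "V \<subseteq> U" "\<And>i. i < k \<Longrightarrow> smooth_field A V (F i)"
    "\<And>y. y \<in> V \<Longrightarrow> D y = span ((\<lambda>i. F i y) ` {..<k})"
    "\<And>y j. y \<in> V \<Longrightarrow> j < k \<Longrightarrow> F j y \<notin> span ((\<lambda>i. F i y) ` {..<j})"
proof -
  obtain V F where VF: "open V" "x \<in> V" "V \<subseteq> U" "\<forall>i<k. smooth_field A V (F i)"
    "\<forall>y\<in>V. D y = span ((\<lambda>i::nat. F i y) ` {..<k})"
    using assms unfolding distribution_on_def by blast
  have "dim (span ((\<lambda>i. F i y) ` {..<k})) = k" if "y \<in> V" for y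
    using that VF(3,5) assms(1) unfolding distribution_on_def by (metis subsetD)
  then have "\<And>y j. y \<in> V \<Longrightarrow> j < k \<Longrightarrow> F j y \<notin> span ((\<lambda>i. F i y) ` {..<j})"
    using dim_span_lessThan_iff[where f = "\<lambda>i. F i _"] by blast
  with VF show ?thesis using that by blast
qed

text \<open>Sections that are independent at the point alone suffice: they stay independent nearby, and then
  span for reasons of dimension.\<close>

lemma distribution_onI:
  assumes "\<And>x. x \<in> U \<Longrightarrow> subspace (D x) \<and> dim (D x) = k"
    and "\<And>x. x \<in> U \<Longrightarrow> \<exists>V F. open V \<and> x \<in> V \<and> V \<subseteq> U \<and> (\<forall>i<k. smooth_field A V (F i)) \<and>
        (\<forall>i<k. \<forall>y\<in>V. F i y \<in> D y) \<and> (\<forall>j<k. F j x \<notin> span ((\<lambda>i. F i x) ` {..<j}))"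
  shows "distribution_on A U k D"
  unfolding distribution_on_def
proof (intro conjI ballI)
  fix x assume x: "x \<in> U"
  obtain V F where V: "open V" "x \<in> V" "V \<subseteq> U" and F: "\<forall>i<k. smooth_field A V (F i)"
    "\<forall>i<k. \<forall>y\<in>V. F i y \<in> D y" "\<forall>j<k. F j x \<notin> span ((\<lambda>i::nat. F i x) ` {..<j})"
    using assms(2)[OF x] by blast
  obtain V' where V': "open V'" "x \<in> V'" "V' \<subseteq> V"
    "\<And>y j. y \<in> V' \<Longrightarrow> j < k \<Longrightarrow> F j y \<notin> span ((\<lambda>i. F i y) ` {..<j})"
    by (rule independence_open[OF V(1,2), of k F]) (use F in auto)
  have "D y = span ((\<lambda>i. F i y) ` {..<k})" if y: "y \<in> V'" for y
  proof (rule sym, rule subspace_dim_equal)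
    have yU: "y \<in> U" "y \<in> V" using y V V' by auto
    show "span ((\<lambda>i. F i y) ` {..<k}) \<subseteq> D y"
      using F(2) yU assms(1)[OF yU(1)] by (intro span_minimal) auto
    show "dim (span ((\<lambda>i. F i y) ` {..<k})) \<ge> dim (D y)"
      using assms(1)[OF yU(1)] dim_span_lessThan_iff[of "\<lambda>i. F i y" k] V'(4)[OF y] by auto
    show "subspace (D y)" using assms(1) yU by blast
  qed simp
  then show "\<exists>V F. open V \<and> x \<in> V \<and> V \<subseteq> U \<and> (\<forall>i<k. smooth_field A V (F i)) \<and>
      (\<forall>y\<in>V. D y = span ((\<lambda>i::nat. F i y) ` {..<k}))"
    using V V' F(1) smooth_field_subset by (metis subset_trans)
qed (use assms in auto)

text \<open>This applies to \<open>p\<^sup>*\<close> and \<open>q\<^sup>*\<close>: if \<open>N\<close> is a normal of \<open>D\<close> in the Euclidean metric \<open>B\<close> of a chart,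
  then \<open>\<alpha>\<close> is \<open>B(-, N) / B(Z, N)\<close>.\<close>

lemma smooth_hyperplane_covector:
  assumes U: "open U" and D: "distribution_on A U k D"
    and \<alpha>: "\<And>x. x \<in> U \<Longrightarrow> linear (\<alpha> x)" "\<And>x. x \<in> U \<Longrightarrow> {u. \<alpha> x u = 0} = D x"
    and Z: "smooth_field A U Z" "\<And>x. x \<in> U \<Longrightarrow> \<alpha> x (Z x) = (1::real)" and X: "smooth_field A U X"
  shows "smooth_fun A U (\<lambda>x. \<alpha> x (X x))"
proof (rule smooth_fun_cover)
  fix x assume "x \<in> U"
  with distribution_frame[OF D] obtain V0 F where V0: "open V0" "x \<in> V0" "V0 \<subseteq> U"
    "\<And>i. i < k \<Longrightarrow> smooth_field A V0 (F i)"
    "\<And>y. y \<in> V0 \<Longrightarrow> D y = span ((\<lambda>i. F i y) ` {..<k})"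
    "\<And>y j. y \<in> V0 \<Longrightarrow> j < k \<Longrightarrow> F j y \<notin> span ((\<lambda>i. F i y) ` {..<j})" by metis
  define V where "V = V0 \<inter> fst (chart_at A x)"
  let ?B = "chart_metric (chart_at A x)"
  have V: "open V" "x \<in> V" "V \<subseteq> U" "V \<subseteq> fst (chart_at A x)"
    using V0 chart_at[of x] open_domain[OF chart_at(1)[of x]] by (auto simp: V_def)
  have B: "smooth_form_on V ?B"
    using smooth_form_on_subset[OF smooth_form_chart_metric V(4)] chart_at by blast
  have pos: "?B y v v > 0" if "y \<in> V" "v \<noteq> 0" for y v
    using chart_metric_pos chart_at(1) that V(4) by blast
  have ZV: "smooth_field A V Z" and XV: "smooth_field A V X"
    using smooth_field_subset V(3) Z(1) X by blast+
  obtain P where P: "smooth_field A V P" "\<And>y. y \<in> V \<Longrightarrow> P y \<in> D y"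
    "\<And>y v. y \<in> V \<Longrightarrow> v \<in> D y \<Longrightarrow> ?B y (Z y - P y) v = 0"
  proof (rule smooth_projection[OF V(1) B _ _ _ ZV, of k F])
    show "smooth_field A V (F i)" if "i < k" for i
      using smooth_field_subset[OF V0(4)[OF that]] by (simp add: V_def)
  qed (use V0(5,6) pos in \<open>auto simp: V_def\<close>)
  define N where "N y = Z y - P y" for y
  have NS: "smooth_field A V N"
    using smooth_field_diff_scale[OF V(1) ZV smooth_fun_const[of V 1] P(1)]
    by (simp add: N_def[abs_def])
  have ZN: "?B y (Z y) (N y) > 0" and XN: "?B y (X y) (N y) / ?B y (Z y) (N y) = \<alpha> y (X y)"
    if y: "y \<in> V" for y
  proof -
    have yU: "y \<in> U" using y V by blast
    note bs = bilinear_simps[OF smooth_form_bilinear[OF B y]]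
      and sym = smooth_form_sym[OF B y]
    note lin = linear_diff[OF \<alpha>(1)[OF yU]] linear_scale[OF \<alpha>(1)[OF yU]]
    have "\<alpha> y (P y) = 0" using P(2)[OF y] \<alpha>(2)[OF yU] by blast
    then have "N y \<noteq> 0" using Z(2)[OF yU] by (auto simp: N_def)
    moreover have "?B y (P y) (N y) = 0" using P(3)[OF y P(2)[OF y]] sym by (metis N_def)
    then have "?B y (Z y) (N y) = ?B y (N y) (N y)"
      using bs(3)[of "Z y" "P y" "N y"] by (simp add: N_def)
    ultimately show "?B y (Z y) (N y) > 0" using pos[OF y] by simp
    have "X y - \<alpha> y (X y) *\<^sub>R Z y \<in> D y"
      using \<alpha>(2)[OF yU] Z(2)[OF yU] lin by auto
    from P(3)[OF y this] sym have "?B y (X y - \<alpha> y (X y) *\<^sub>R Z y) (N y) = 0"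
      by (metis N_def)
    then have "?B y (X y) (N y) = \<alpha> y (X y) * ?B y (Z y) (N y)" by (simp add: bs)
    with \<open>?B y (Z y) (N y) > 0\<close> show "?B y (X y) (N y) / ?B y (Z y) (N y) = \<alpha> y (X y)"
      by simp
  qed
  have "smooth_fun A V (\<lambda>y. ?B y (X y) (N y) / ?B y (Z y) (N y))"
    using ZN by (intro smooth_fun_divide V(1) smooth_form_smooth[OF B V(1) order_refl] XV NS ZV) force
  from smooth_fun_cong[OF V(1) XN this] V
  show "\<exists>V. open V \<and> x \<in> V \<and> smooth_fun A V (\<lambda>x. \<alpha> x (X x))" by blast
qed

lemma field_through:
  obtains V X where "open V" "x \<in> V" "smooth_field A V X" "X x = v"
  using that[OF open_domain[OF chart_at(1)] chart_at(2) smooth_const_field[OF chart_at(1)]]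
    const_field_tcoord[OF chart_at, of x v] by metis

lemma section_through:
  assumes "distribution_on A U k D" "x \<in> U" "v \<in> D x"
  obtains V X where "open V" "x \<in> V" "V \<subseteq> U" "section_of A V D X" "X x = v"
proof -
  obtain V F where V: "open V" "x \<in> V" "V \<subseteq> U" "\<And>i. i < k \<Longrightarrow> smooth_field A V (F i)"
    "\<And>y. y \<in> V \<Longrightarrow> D y = span ((\<lambda>i. F i y) ` {..<k})"
    using distribution_frame[OF assms(1,2)] by metis
  let ?P = "{v. \<exists>X. section_of A V D X \<and> X x = v}"
  have D: "subspace (D y)" if "y \<in> V" for y using V(5)[OF that] by simp
  have "span ((\<lambda>i. F i x) ` {..<k}) \<subseteq> ?P"
  proof (rule span_minimal)
    have "section_of A V D (F i)" if "i < k" for i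
      unfolding section_of_def using V(4)[OF that] V(5) that by (auto intro: span_base)
    then show "(\<lambda>i. F i x) ` {..<k} \<subseteq> ?P" by blast
    show "subspace ?P"
    proof (rule subspaceI)
      show "0 \<in> ?P" using smooth_field_zero[OF V(1)] D subspace_0
        by (auto simp: section_of_def intro!: exI[of _ "\<lambda>x. 0"])
      show "u + w \<in> ?P" if uw: "u \<in> ?P" "w \<in> ?P" for u w
      proof -
        obtain X Y where "section_of A V D X" "X x = u" "section_of A V D Y" "Y x = w"
          using uw by blast
        then have "section_of A V D (\<lambda>y. X y + Y y)" "X x + Y x = u + w"
          using smooth_field_add[OF V(1)] subspace_add[OF D] by (auto simp: section_of_def)
        then show ?thesis by blast
      qed
      show "r *\<^sub>R u \<in> ?P" if u: "u \<in> ?P" for u r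
      proof -
        obtain X where "section_of A V D X" "X x = u" using u by blast
        then have "section_of A V D (\<lambda>y. r *\<^sub>R X y)" "r *\<^sub>R X x = r *\<^sub>R u"
          using smooth_field_scale[OF V(1) smooth_fun_const] subspace_scale[OF D]
          by (auto simp: section_of_def)
        then show ?thesis by blast
      qed
    qed
  qed
  then have "v \<in> ?P" using assms(3) V(5)[OF V(2)] by blast
  then show ?thesis using that V by blast
qed

end

section \<open>Linear algebra in one tangent space\<close>

text \<open>Degenerate metrics carry meaning on \<open>W\<close> only, so bilinearity is relative to a subspace.\<close>

definition sym_bilinear_on :: "'e::real_vector set \<Rightarrow> ('e \<Rightarrow> 'e \<Rightarrow> real) \<Rightarrow> bool" where
  "sym_bilinear_on W b \<longleftrightarrow>
     (\<forall>u\<in>W. \<forall>v\<in>W. b u v = b v u) \<and>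
     (\<forall>u\<in>W. \<forall>v\<in>W. \<forall>w\<in>W. b (u + v) w = b u w + b v w) \<and>
     (\<forall>u\<in>W. \<forall>w\<in>W. \<forall>r. b (r *\<^sub>R u) w = r * b u w)"

lemma sym_bilinear_onD:
  assumes "subspace W" "sym_bilinear_on W b" "u \<in> W" "v \<in> W"
  shows "b u v = b v u"
    "w \<in> W \<Longrightarrow> b (u + v) w = b u w + b v w" "w \<in> W \<Longrightarrow> b w (u + v) = b w u + b w v"
    "b (r *\<^sub>R u) v = r * b u v" "b v (r *\<^sub>R u) = r * b v u" "b 0 u = 0" "b u 0 = 0"
proof -
  have s: "\<And>u v. u \<in> W \<Longrightarrow> v \<in> W \<Longrightarrow> b u v = b v u"
    and a: "\<And>u v w. u \<in> W \<Longrightarrow> v \<in> W \<Longrightarrow> w \<in> W \<Longrightarrow> b (u + v) w = b u w + b v w"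
    and m: "\<And>u w r. u \<in> W \<Longrightarrow> w \<in> W \<Longrightarrow> b (r *\<^sub>R u) w = r * b u w"
    using assms(2) unfolding sym_bilinear_on_def by blast+
  have cl: "\<And>u v. u \<in> W \<Longrightarrow> v \<in> W \<Longrightarrow> u + v \<in> W" "\<And>u r. u \<in> W \<Longrightarrow> r *\<^sub>R u \<in> W"
    using assms(1) subspace_add subspace_scale by blast+
  show "b u v = b v u" using s assms by blast
  show "b (u + v) w = b u w + b v w" if "w \<in> W" using a assms that by blast
  show "b w (u + v) = b w u + b w v" if "w \<in> W" using a s cl assms that by metis
  show "b (r *\<^sub>R u) v = r * b u v" using m assms by blast
  show "b v (r *\<^sub>R u) = r * b v u" using m s cl assms by metis
  show "b 0 u = 0" using m[OF assms(3,3), of 0] by simp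
  then show "b u 0 = 0" using s[OF assms(3) subspace_0[OF assms(1)]] by simp
qed

text \<open>The nonnegative polynomial \<open>t \<mapsto> b(w + t v, w + t v)\<close> is affine with slope \<open>2 b(v, w)\<close>.\<close>

lemma semidefinite_null_in_kernel:
  assumes "subspace W" "sym_bilinear_on W b" "\<And>v. v \<in> W \<Longrightarrow> b v v \<ge> 0"
    and "v \<in> W" "b v v = 0" "w \<in> W"
  shows "b v w = 0"
proof (rule ccontr)
  assume ne: "b v w \<noteq> 0"
  \<comment> \<open>the parameter at which the affine polynomial takes the value \<open>-1\<close>\<close>
  define t where "t = - (b w w + 1) / (2 * b v w)"
  note D = sym_bilinear_onD[OF assms(1,2)]
  have tv: "t *\<^sub>R v \<in> W" and W: "w + t *\<^sub>R v \<in> W"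
    using assms subspace_add subspace_scale by blast+
  have "b (w + t *\<^sub>R v) (w + t *\<^sub>R v) = b w w + 2 * t * b v w"
    using assms tv W D(1)[OF assms(4,6)] by (simp add: D)
  also have "\<dots> = -1" using ne by (simp add: t_def field_simps)
  finally show False using assms(3)[OF W] by simp
qed

lemma definite_on_complement:
  assumes "subspace W" "sym_bilinear_on W b" "\<And>v. v \<in> W \<Longrightarrow> b v v \<ge> 0"
    and "{v \<in> W. \<forall>w\<in>W. b v w = 0} = K" "complementary_in T K W" "v \<in> T" "v \<noteq> 0"
  shows "b v v > 0"
proof -
  have v: "v \<in> W" "v \<notin> K"
    using assms(5-7) span_superset[of "T \<union> K"] unfolding complementary_in_def by blast+
  then have "b v v \<noteq> 0"
    using semidefinite_null_in_kernel[OF assms(1-3) v(1)] assms(4) by blast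
  then show ?thesis using assms(3)[OF v(1)] by simp
qed

lemma complement_line_decomp:
  assumes "complementary_in T (span {p}) W" "subspace T" "w \<in> W"
  obtains r w' where "w' \<in> T" "w = r *\<^sub>R p + w'"
proof -
  have "W = span (T \<union> span {p})" using assms(1) unfolding complementary_in_def by simp
  also have "\<dots> \<subseteq> span (insert p T)"
  proof (rule span_minimal)
    show "T \<union> span {p} \<subseteq> span (insert p T)"
      using span_mono[of "{p}" "insert p T"] by (auto intro: span_base)
  qed simp
  finally obtain r where "w - r *\<^sub>R p \<in> T"
    using assms(3) span_breakdown_eq[of w p T] span_eq_iff[THEN iffD2, OF assms(2)] by auto
  then show ?thesis using that[of "w - r *\<^sub>R p" r] by simp
qed

lemma hyperplane_span:
  fixes W :: "'e::euclidean_space set"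
  assumes "subspace W" "dim W = DIM('e) - 1" "q \<notin> W"
  shows "span (insert q W) = UNIV"
proof -
  have "dim (insert q W) = DIM('e)"
    using assms by (simp add: dim_insert span_eq_iff[THEN iffD2])
  then show ?thesis by (simp add: dim_eq_full)
qed

lemma covector_unique:
  assumes "linear \<alpha>" "\<alpha> v = (1::real)" "{u. \<alpha> u = 0} = S"
    and "linear \<beta>" "\<beta> v = (1::real)" "{u. \<beta> u = 0} = S"
  shows "\<alpha> = \<beta>"
proof
  fix u
  have "\<alpha> (u - \<alpha> u *\<^sub>R v) = 0" using assms by (simp add: linear_diff linear_scale)
  then have "\<beta> (u - \<alpha> u *\<^sub>R v) = 0" using assms(3,6) by blast
  then show "\<alpha> u = \<beta> u" using assms by (simp add: linear_diff linear_scale)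
qed

lemma dual_covector:
  fixes S :: "'e::euclidean_space set"
  assumes S: "subspace S" "span (insert v S) = UNIV" "v \<notin> S"
  shows "linear (dual_covector v S)" "dual_covector v S v = 1" "{u. dual_covector v S u = 0} = S"
proof -
  define \<alpha> where "\<alpha> u = (SOME r. u - r *\<^sub>R v \<in> S)" for u
  have ex: "\<exists>r. u - r *\<^sub>R v \<in> S" for u
    using span_breakdown_eq[of u v S] S by (simp add: span_eq_iff[THEN iffD2])
  have mem: "u - \<alpha> u *\<^sub>R v \<in> S" for u unfolding \<alpha>_def using someI_ex[OF ex] .
  have uniq: "\<alpha> u = r" if "u - r *\<^sub>R v \<in> S" for u r
  proof (rule ccontr)
    assume ne: "\<alpha> u \<noteq> r"
    have "(\<alpha> u - r) *\<^sub>R v \<in> S"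
      using subspace_diff[OF S(1) that mem[of u]] by (simp add: algebra_simps)
    from subspace_scale[OF S(1) this, of "inverse (\<alpha> u - r)"] ne S(3) show False by simp
  qed
  have "linear \<alpha>"
  proof (rule linearI)
    show "\<alpha> (u + w) = \<alpha> u + \<alpha> w" for u w
      by (rule uniq) (use subspace_add[OF S(1) mem[of u] mem[of w]] in \<open>simp add: algebra_simps\<close>)
    show "\<alpha> (r *\<^sub>R u) = r *\<^sub>R \<alpha> u" for r u
      by (rule uniq) (use subspace_scale[OF S(1) mem[of u], of r] in \<open>simp add: algebra_simps\<close>)
  qed
  moreover have "\<alpha> v = 1" by (rule uniq) (use S subspace_0 in simp)
  moreover have "{u. \<alpha> u = 0} = S"
  proof (intro set_eqI iffI)
    show "u \<in> S" if "u \<in> {u. \<alpha> u = 0}" for u using mem[of u] that by simp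
    show "u \<in> {u. \<alpha> u = 0}" if "u \<in> S" for u using uniq[of u 0] that by simp
  qed
  ultimately have "linear (dual_covector v S) \<and> dual_covector v S v = 1 \<and>
      {u. dual_covector v S u = 0} = S"
    unfolding dual_covector_def using theI'[of "\<lambda>\<alpha>. linear \<alpha> \<and> \<alpha> v = 1 \<and> {u. \<alpha> u = 0} = S"]
      covector_unique[of \<alpha> v S] by blast
  then show "linear (dual_covector v S)" "dual_covector v S v = 1" "{u. dual_covector v S u = 0} = S"
    by auto
qed

text \<open>The extension is \<open>b\<close> composed with the projection to \<open>W\<close> along \<open>q\<close>; every extension is of this form,
  because \<open>q\<close> lies in the prescribed kernel.\<close>

lemma extend_by_kernel_eq:
  fixes W :: "'e::euclidean_space set"
  assumes W: "subspace W" "span (insert q W) = UNIV" "q \<notin> W"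
    and b: "sym_bilinear_on W b" and K: "{v \<in> W. \<forall>w\<in>W. b v w = 0} = K"
  shows "extend_by_kernel W (span (K \<union> {q})) b u v
    = b (u - dual_covector q W u *\<^sub>R q) (v - dual_covector q W v *\<^sub>R q)"
proof -
  define \<pi> where "\<pi> u = u - dual_covector q W u *\<^sub>R q" for u
  note \<alpha> = dual_covector[OF W] and D = sym_bilinear_onD[OF W(1) b]
  have \<pi>W: "\<pi> u \<in> W" for u
  proof -
    have "dual_covector q W (\<pi> u) = 0" using \<alpha> by (simp add: \<pi>_def linear_diff linear_scale)
    then show ?thesis using \<alpha>(3) by blast
  qed
  have \<pi>id: "\<pi> w = w" if "w \<in> W" for w using that \<alpha>(3) by (auto simp: \<pi>_def)
  have \<pi>add: "\<pi> (u + v) = \<pi> u + \<pi> v" and \<pi>scale: "\<pi> (r *\<^sub>R u) = r *\<^sub>R \<pi> u" for u v r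
    using \<alpha>(1) by (simp_all add: \<pi>_def linear_add linear_scale algebra_simps)
  have KW: "K \<subseteq> W" using K by auto
  have subK: "subspace K"
  proof (rule subspaceI)
    show "0 \<in> K" using K D(6) subspace_0[OF W(1)] by auto
    show "u + v \<in> K" if "u \<in> K" "v \<in> K" for u v
      using that K D(2) subspace_add[OF W(1)] by auto
    show "r *\<^sub>R u \<in> K" if "u \<in> K" for r u
      using that K D(4) subspace_scale[OF W(1)] by auto
  qed
  have mem: "v \<in> span (K \<union> {q}) \<longleftrightarrow> \<pi> v \<in> K" for v
  proof -
    have "v \<in> span (K \<union> {q}) \<longleftrightarrow> (\<exists>r. v - r *\<^sub>R q \<in> K)"
      using span_breakdown_eq[of v q K] subK by (simp add: span_eq_iff[THEN iffD2])
    also have "\<dots> \<longleftrightarrow> \<pi> v \<in> K"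
    proof
      assume "\<exists>r. v - r *\<^sub>R q \<in> K"
      then obtain r where r: "v - r *\<^sub>R q \<in> K" by blast
      then have "dual_covector q W (v - r *\<^sub>R q) = 0" using KW \<alpha>(3) by blast
      then have "dual_covector q W v = r" using \<alpha> by (simp add: linear_diff linear_scale)
      with r show "\<pi> v \<in> K" by (simp add: \<pi>_def)
    qed (auto simp: \<pi>_def)
    finally show ?thesis .
  qed
  let ?P = "\<lambda>k. bilinear k \<and> (\<forall>u v. k u v = k v u) \<and> (\<forall>u\<in>W. \<forall>v\<in>W. k u v = b u v) \<and>
        {v. \<forall>w. k v w = 0} = span (K \<union> {q})"
  have "extend_by_kernel W (span (K \<union> {q})) b = (\<lambda>u v. b (\<pi> u) (\<pi> v))"
    unfolding extend_by_kernel_def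
  proof (rule the_equality)
    have "bilinear (\<lambda>u v. b (\<pi> u) (\<pi> v))"
      unfolding bilinear_def by (auto intro!: linearI simp: \<pi>add \<pi>scale D \<pi>W)
    moreover have "{v. \<forall>w. b (\<pi> v) (\<pi> w) = 0} = span (K \<union> {q})"
    proof (intro set_eqI)
      fix v
      have "(\<forall>w. b (\<pi> v) (\<pi> w) = 0) \<longleftrightarrow> (\<forall>w\<in>W. b (\<pi> v) w = 0)"
        using \<pi>W \<pi>id by metis
      also have "\<dots> \<longleftrightarrow> \<pi> v \<in> K" using K \<pi>W by auto
      finally show "v \<in> {v. \<forall>w. b (\<pi> v) (\<pi> w) = 0} \<longleftrightarrow> v \<in> span (K \<union> {q})" unfolding mem by simp
    qed
    ultimately show "?P (\<lambda>u v. b (\<pi> u) (\<pi> v))" using D(1) \<pi>W \<pi>id by simp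
  next
    fix k assume k: "?P k"
    have "q \<in> {v. \<forall>w. k v w = 0}" using k by (auto intro: span_base)
    then have kq: "k q w = 0" "k w q = 0" for w using k by auto
    show "k = (\<lambda>u v. b (\<pi> u) (\<pi> v))"
    proof (intro ext)
      fix u v
      have "k u v = k (\<pi> u + dual_covector q W u *\<^sub>R q) (\<pi> v + dual_covector q W v *\<^sub>R q)"
        by (simp add: \<pi>_def)
      also have "\<dots> = k (\<pi> u) (\<pi> v)"
        using k by (simp add: bilinear_simps kq)
      also have "\<dots> = b (\<pi> u) (\<pi> v)" using k \<pi>W by blast
      finally show "k u v = b (\<pi> u) (\<pi> v)" .
    qed
  qed
  then show ?thesis by (simp add: \<pi>_def)
qed

lemma orthonormal_basis_of_form:
  fixes S :: "'e::euclidean_space set"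
  assumes B: "bilinear B" "\<And>u v. B u v = B v u"
    and "subspace S" "\<And>v. v \<in> S \<Longrightarrow> v \<noteq> 0 \<Longrightarrow> B v v > (0::real)"
  shows "\<exists>E. finite E \<and> E \<subseteq> S \<and> span E = S \<and> (\<forall>u\<in>E. \<forall>v\<in>E. B u v = (if u = v then 1 else 0))"
  using assms(3,4)
proof (induction "dim S" arbitrary: S rule: less_induct)
  case less
  note bs = bilinear_simps[OF B(1)]
  show ?case
  proof (cases "S = {0}")
    case True
    then show ?thesis by (intro exI[of _ "{}"]) auto
  next
    case False
    then obtain w where w: "w \<in> S" "w \<noteq> 0" using subspace_0[OF less.prems(1)] by blast
    define e where "e = (1 / sqrt (B w w)) *\<^sub>R w"
    have "B w w > 0" using less.prems(2)[OF w] .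
    then have e: "e \<in> S" "B e e = 1"
      using w(1) subspace_scale[OF less.prems(1)] by (auto simp: e_def bs field_simps)
    define T where "T = {v \<in> S. B v e = 0}"
    have T: "subspace T"
      unfolding T_def using less.prems(1)
      by (auto intro!: subspaceI simp: bs subspace_0 subspace_add subspace_scale)
    have "T \<subseteq> S" "e \<notin> T" using e by (auto simp: T_def)
    then have "T \<subset> S" using e(1) by blast
    then have "dim T < dim S"
      using dim_psubset[of T S] T less.prems(1) by (metis span_eq_iff)
    from less.hyps[OF this T] obtain E where E: "finite E" "E \<subseteq> T" "span E = T"
      "\<forall>u\<in>E. \<forall>v\<in>E. B u v = (if u = v then 1 else 0)"
      using less.prems(2) by (auto simp: T_def)
    have eE: "B u e = 0" "B e u = 0" if "u \<in> E" for u using that E(2) B(2) by (auto simp: T_def)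
    have "span (insert e E) = S"
    proof
      show "span (insert e E) \<subseteq> S"
        using less.prems(1) e E(2) by (intro span_minimal) (auto simp: T_def)
      show "S \<subseteq> span (insert e E)"
      proof
        fix v assume v: "v \<in> S"
        have "v - B v e *\<^sub>R e \<in> T"
          unfolding T_def using v e less.prems(1) by (auto simp: bs subspace_diff subspace_scale)
        then show "v \<in> span (insert e E)" using E(3) span_breakdown_eq by blast
      qed
    qed
    then show ?thesis using E e eE
      by (intro exI[of _ "insert e E"]) (auto simp: T_def)
  qed
qed

lemma orthogonal_independent:
  assumes B: "bilinear B" and E: "\<And>u v. u \<in> E \<Longrightarrow> v \<in> E \<Longrightarrow> u \<noteq> v \<Longrightarrow> B u v = (0::real)"
    "\<And>u. u \<in> E \<Longrightarrow> B u u \<noteq> 0"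
  shows "independent E"
  unfolding dependent_def
proof (intro notI, elim bexE)
  fix u assume u: "u \<in> E" "u \<in> span (E - {u})"
  have "span (E - {u}) \<subseteq> {v. B v u = 0}"
    by (rule span_minimal) (use E u in \<open>auto intro!: subspaceI simp: bilinear_simps[OF B]\<close>)
  with u E(2) show False by blast
qed

text \<open>The data of \<open>(\<ast>)\<close> in a single tangent space, with \<open>b\<close> the value of \<open>h\<close>.\<close>

locale rigged_hyperplane =
  fixes W W' :: "'e::euclidean_space set" and p q :: 'e and b :: "'e \<Rightarrow> 'e \<Rightarrow> real"
  assumes W: "subspace W" "dim W = DIM('e) - 1" and W': "subspace W'"
    and q: "q \<notin> W" and p: "p \<noteq> 0"
    and compl: "complementary_in W' (span {p}) W"
    and b: "sym_bilinear_on W b" and ker: "{v \<in> W. \<forall>w\<in>W. b v w = 0} = span {p}"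
begin

text \<open>The covectors \<open>\<alpha>\<close> and \<open>\<beta>\<close> are \<open>q\<^sup>*\<close> and \<open>p\<^sup>*\<close>, and \<open>star\<close> is the value of \<open>(\<ast>)\<close>.\<close>

definition "\<alpha> = dual_covector q W"
definition "\<beta> = dual_covector p (span (W' \<union> {q}))"
definition "star u v = extend_by_kernel W (span (span {p} \<union> {q})) b u v + 2 * sym_prod \<alpha> \<beta> u v"

lemma pW: "p \<in> W" and W'W: "W' \<subseteq> W" and pW': "p \<notin> W'"
proof -
  show "p \<in> W" using ker span_base[of p "{p}"] by blast
  show "W' \<subseteq> W" using compl span_superset[of "W' \<union> span {p}"] unfolding complementary_in_def by blast
  show "p \<notin> W'" using compl p span_base[of p "{p}"] unfolding complementary_in_def by blast
qed

lemmas W_decomp = complement_line_decomp[OF compl W']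

lemma \<alpha>: "linear \<alpha>" "\<alpha> q = 1" "{u. \<alpha> u = 0} = W"
  unfolding \<alpha>_def using dual_covector[OF W(1) hyperplane_span[OF W q] q] .

lemma \<alpha>W: "\<alpha> w = 0 \<longleftrightarrow> w \<in> W" using \<alpha>(3) by blast

lemma decomp: obtains r s w' where "w' \<in> W'" "u = r *\<^sub>R p + w' + s *\<^sub>R q"
proof -
  have "\<alpha> (u - \<alpha> u *\<^sub>R q) = 0" using \<alpha> by (simp add: linear_diff linear_scale)
  then obtain r w' where "w' \<in> W'" "u - \<alpha> u *\<^sub>R q = r *\<^sub>R p + w'" using \<alpha>W W_decomp by metis
  then show ?thesis using that[of w' r "\<alpha> u"] by (simp add: algebra_simps)
qed

lemma \<beta>: "linear \<beta>" "\<beta> p = 1" "{u. \<beta> u = 0} = span (W' \<union> {q})"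
proof -
  have 1: "span (insert p (span (W' \<union> {q}))) = UNIV"
  proof -
    have "u \<in> span (insert p (span (W' \<union> {q})))" for u
    proof -
      obtain r s w' where w': "w' \<in> W'" and u: "u = r *\<^sub>R p + w' + s *\<^sub>R q" by (rule decomp)
      then have "u - r *\<^sub>R p \<in> span (W' \<union> {q})"
        by (auto intro!: span_add span_scale intro: span_base)
      then show ?thesis
        using span_breakdown_eq[of u p "span (W' \<union> {q})"] unfolding span_span by blast
    qed
    then show ?thesis by blast
  qed
  have 2: "p \<notin> span (W' \<union> {q})"
  proof
    assume "p \<in> span (W' \<union> {q})"
    then obtain r where r: "p - r *\<^sub>R q \<in> W'"
      using span_breakdown_eq[of p q W'] span_eq_iff[THEN iffD2, OF W'] by auto
    then have "\<alpha> (p - r *\<^sub>R q) = 0" using W'W \<alpha>W by blast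
    then have "r = 0" using \<alpha>(1,2) \<alpha>W[THEN iffD2, OF pW] by (simp add: linear_diff linear_scale)
    with r pW' show False by simp
  qed
  show "linear \<beta>" "\<beta> p = 1" "{u. \<beta> u = 0} = span (W' \<union> {q})"
    unfolding \<beta>_def using dual_covector[OF subspace_span 1 2] .
qed

lemma \<beta>_zero: "w' \<in> W' \<Longrightarrow> \<beta> w' = 0" "\<beta> q = 0"
  using \<beta>(3) span_base[of _ "W' \<union> {q}"] by blast+

lemma \<pi>W: "u - \<alpha> u *\<^sub>R q \<in> W"
  using \<alpha> \<alpha>W[of "u - \<alpha> u *\<^sub>R q"] by (simp add: linear_diff linear_scale)

lemma star_eq: "star u v = b (u - \<alpha> u *\<^sub>R q) (v - \<alpha> v *\<^sub>R q) + (\<alpha> u * \<beta> v + \<beta> u * \<alpha> v)"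
  unfolding star_def sym_prod_def
  using extend_by_kernel_eq[OF W(1) hyperplane_span[OF W q] q b ker] by (simp add: \<alpha>_def)

lemmas bD = sym_bilinear_onD[OF W(1) b]

lemma star_sym: "star u v = star v u"
  unfolding star_eq using bD(1)[OF \<pi>W \<pi>W] by simp

lemma star_bilinear: "bilinear star"
proof -
  have 1: "(u + v) - \<alpha> (u + v) *\<^sub>R q = (u - \<alpha> u *\<^sub>R q) + (v - \<alpha> v *\<^sub>R q)"
    "r *\<^sub>R u - \<alpha> (r *\<^sub>R u) *\<^sub>R q = r *\<^sub>R (u - \<alpha> u *\<^sub>R q)" for u v r
    using \<alpha>(1) by (simp_all add: linear_add linear_scale algebra_simps)
  have 2: "star (u + v) w = star u w + star v w" "star (r *\<^sub>R u) w = r * star u w" for u v w r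
    unfolding star_eq 1 bD(2)[OF \<pi>W \<pi>W \<pi>W] bD(4)[OF \<pi>W \<pi>W]
    using \<alpha>(1) \<beta>(1) by (simp_all add: linear_add linear_scale algebra_simps)
  then have "star w (u + v) = star w u + star w v" "star w (r *\<^sub>R u) = r * star w u" for u v w r
    using star_sym by metis+
  with 2 show ?thesis unfolding bilinear_def by (auto intro!: linearI)
qed

lemma star_W: "u \<in> W \<Longrightarrow> v \<in> W \<Longrightarrow> star u v = b u v"
  unfolding star_eq using \<alpha>W[THEN iffD2] by simp

lemma star_p: "star p v = \<alpha> v"
proof -
  have "p \<in> span {p}" by (simp add: span_base)
  then have "b p w = 0" if "w \<in> W" for w using ker that by blast
  then show ?thesis unfolding star_eq using \<alpha>W[THEN iffD2, OF pW] \<beta>(2) \<pi>W by simp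
qed

lemma star_q: "star q q = 0" "w' \<in> W' \<Longrightarrow> star w' q = 0"
  unfolding star_eq using \<alpha>(2) \<beta>_zero \<alpha>W[THEN iffD2] W'W bD(7) subspace_0[OF W(1)] by auto

text \<open>Both sides are determined by their values on \<open>W\<close>, by \<open>q\<close> being null, and by the covector
  \<open>G(-, q)\<close>, which is \<open>p\<^sup>*\<close> on \<open>W = \<langle>p\<rangle> + W'\<close>.\<close>

lemma star_unique:
  assumes G: "bilinear G" "\<And>u v. G u v = G v u" "\<And>u v. u \<in> W \<Longrightarrow> v \<in> W \<Longrightarrow> G u v = b u v"
    and q: "G q q = 0" "G p q = 1" "\<And>w'. w' \<in> W' \<Longrightarrow> G w' q = 0"
  shows "G u v = star u v"
proof -
  note gs = bilinear_simps[OF G(1)] and ss = bilinear_simps[OF star_bilinear]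
  obtain r s w where w: "w \<in> W'" and u: "u = r *\<^sub>R p + w + s *\<^sub>R q" by (rule decomp)
  obtain r' s' w' where w': "w' \<in> W'" and v: "v = r' *\<^sub>R p + w' + s' *\<^sub>R q" by (rule decomp)
  have ww: "r *\<^sub>R p + w \<in> W" "r' *\<^sub>R p + w' \<in> W"
    using w w' W'W pW W(1) by (auto intro: subspace_add subspace_scale)
  have Gq: "G (r *\<^sub>R p + x) q = r" if "x \<in> W'" for r x
    using q(2) q(3)[OF that] by (simp add: gs)
  have sq: "star (r *\<^sub>R p + x) q = r" if "x \<in> W'" for r x
    using star_q(2)[OF that] \<alpha>(2) by (simp add: ss star_p)
  have "G u v = b (r *\<^sub>R p + w) (r' *\<^sub>R p + w') + s' * r + s * r'"
    unfolding u v gs(1)[of "r *\<^sub>R p + w"] gs(2)[of _ "r' *\<^sub>R p + w'"] gs(5,6) G(2)[of q "r' *\<^sub>R p + w'"] Gq[OF w] Gq[OF w'] q(1) G(3)[OF ww] by simp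
  moreover have "star u v = b (r *\<^sub>R p + w) (r' *\<^sub>R p + w') + s' * r + s * r'"
    unfolding u v ss(1)[of "r *\<^sub>R p + w"] ss(2)[of _ "r' *\<^sub>R p + w'"] ss(5,6) star_sym[of q "r' *\<^sub>R p + w'"] sq[OF w] sq[OF w'] star_q(1) star_W[OF ww] by simp
  ultimately show ?thesis by simp
qed

text \<open>To an orthonormal basis of \<open>W'\<close> one adds \<open>(p \<plusminus> q)/\<surd>2\<close>, an orthonormal basis of signature \<open>(+,-)\<close> of
  the hyperbolic plane \<open>\<langle>p,q\<rangle>\<close>.\<close>

lemma star_lorentzian:
  assumes "\<And>v. v \<in> W \<Longrightarrow> b v v \<ge> 0"
  shows "\<exists>B t. independent B \<and> span B = UNIV \<and> t \<in> B \<and>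
        (\<forall>u\<in>B. \<forall>v\<in>B. star u v = (if u \<noteq> v then 0 else if u = t then -1 else 1))"
proof -
  note ss = bilinear_simps[OF star_bilinear]
  have pos: "star v v > 0" if v: "v \<in> W'" "v \<noteq> 0" for v
  proof -
    have vW: "v \<in> W" using v W'W by blast
    show ?thesis using definite_on_complement[OF W(1) b assms ker compl v] star_W[OF vW vW] by simp
  qed
  obtain E where E: "finite E" "E \<subseteq> W'" "span E = W'"
    "\<forall>u\<in>E. \<forall>v\<in>E. star u v = (if u = v then 1 else 0)"
    using orthonormal_basis_of_form[OF star_bilinear star_sym W' pos] by blast
  define s t where "s = (1 / sqrt 2) *\<^sub>R (p + q)" and "t = (1 / sqrt 2) *\<^sub>R (p - q)"
  have pq: "star p p = 0" "star p q = 1" "star q p = 1"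
    using \<alpha>W pW \<alpha>(2) star_sym[of q p] by (simp_all add: star_p)
  have st: "star s s = 1" "star t t = -1" "star s t = 0" "star t s = 0"
    by (simp_all add: s_def t_def ss pq star_q(1))
  have E0: "star u s = 0" "star u t = 0" "star s u = 0" "star t u = 0" if "u \<in> E" for u
  proof -
    have "u \<in> W'" using that E(2) by blast
    then have 1: "star u p = 0" "star u q = 0"
      using star_q(2) star_p[of u] star_sym[of u p] \<alpha>W W'W by auto
    then show "star u s = 0" "star u t = 0" by (simp_all add: s_def t_def ss)
    then show "star s u = 0" "star t u = 0" using star_sym by metis+
  qed
  have ne: "s \<notin> E" "t \<notin> E" "s \<noteq> t" using E0 st by force+
  let ?B = "insert s (insert t E)"
  have star: "star u v = (if u \<noteq> v then 0 else if u = t then -1 else 1)" if "u \<in> ?B" "v \<in> ?B" for u v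
    using that ne st E0 E(4) by auto
  moreover have "independent ?B"
    by (rule orthogonal_independent[OF star_bilinear]) (use star in \<open>auto split: if_splits\<close>)
  moreover have "span ?B = UNIV"
  proof -
    have sB: "s \<in> span ?B" "t \<in> span ?B" by (auto intro: span_base)
    have "p = (1 / sqrt 2) *\<^sub>R (s + t)" "q = (1 / sqrt 2) *\<^sub>R (s - t)"
      by (simp_all add: s_def t_def algebra_simps flip: scaleR_2 scaleR_add_left)
    then have "p \<in> span ?B" "q \<in> span ?B" using sB by (metis span_add span_diff span_scale)+
    moreover have "W' \<subseteq> span ?B" using E(3) span_mono[of E ?B] by auto
    ultimately have "u \<in> span ?B" for u
      by (rule_tac decomp[of u]) (auto intro!: span_add span_scale)
    then show ?thesis by blast
  qed
  ultimately show ?thesis by blast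
qed

end

section \<open>Lie derivatives along the kernel of the class\<close>

lemma line_span:
  fixes K :: "'e::euclidean_space set"
  assumes "subspace K" "dim K = 1" "a \<in> K" "a \<noteq> 0"
  shows "K = span {a}"
proof (rule sym, rule subspace_dim_equal)
  show "span {a} \<subseteq> K" using assms by (intro span_minimal) auto
qed (use assms in \<open>simp_all add: dim_insert\<close>)

lemma smooth_sym_form_sym_bilinear: "smooth_sym_form A D h \<Longrightarrow> sym_bilinear_on (D x) (h x)"
  unfolding smooth_sym_form_def sym_bilinear_on_def by (elim conjE) simp

lemma smooth_sym_form_smooth:
  assumes "smooth_sym_form A D h" "open V" "section_of A V D X" "section_of A V D Y"
  shows "smooth_fun A V (\<lambda>x. h x (X x) (Y x))"
  using assms(1) unfolding smooth_sym_form_def by (elim conjE allE[of _ V] allE[of _ X] allE[of _ Y])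
    (use assms(2-4) in simp)

context atlas
begin

lemma coord_field_has_derivative:
  assumes "smooth_field A V X" "x \<in> V"
  defines "c \<equiv> chart_at A x"
  shows "(coord_field A c X has_derivative frechet_derivative (coord_field A c X) (at (snd c x))) (at (snd c x))"
  unfolding c_def
  by (rule Cinf_on_has_derivative[OF smooth_field_chart[OF assms(1) chart_at(1)]])
    (use assms(2) chart_at in blast)

lemma vec_deriv_scale:
  assumes "open V" "smooth_fun A V f" "x \<in> V"
  shows "vec_deriv A x (r *\<^sub>R v) f = r * vec_deriv A x v f"
  using linear_scale[OF has_derivative_linear[OF vec_deriv_has_derivative[OF assms]]] by simp

lemma vec_deriv_mult:
  assumes V: "open V" "x \<in> V" and f: "smooth_fun A V f" and g: "smooth_fun A V g"
    and k: "\<And>y. y \<in> V \<Longrightarrow> k y = f y * g y"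
  shows "vec_deriv A x v k = vec_deriv A x v f * g x + f x * vec_deriv A x v g"
proof -
  let ?c = "chart_at A x"
  have "((\<lambda>y. (f \<circ> chart_inv ?c) y * (g \<circ> chart_inv ?c) y) has_derivative
      (\<lambda>v. f x * vec_deriv A x v g + vec_deriv A x v f * g x)) (at (snd ?c x))"
    using has_derivative_mult[OF vec_deriv_has_derivative[OF V(1) f V(2)]
        vec_deriv_has_derivative[OF V(1) g V(2)]] chart_at by simp
  then have "((k \<circ> chart_inv ?c) has_derivative
      (\<lambda>v. f x * vec_deriv A x v g + vec_deriv A x v f * g x)) (at (snd ?c x))"
  proof (rule has_derivative_transform_within_open)
    show "open (snd ?c ` (fst ?c \<inter> V))" using open_chart_image chart_at(1) V(1) by blast
    show "snd ?c x \<in> snd ?c ` (fst ?c \<inter> V)" using chart_at V(2) by blast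
  qed (use k chart_at(1) in auto)
  from fun_cong[OF frechet_derivative_at[OF this], of v] show ?thesis
    unfolding vec_deriv_def[of A x v k] by simp
qed

text \<open>The identity \<open>[f X, Y] = f [X, Y] - Y(f) X\<close>, read off in the chart preferred at \<open>x\<close>.\<close>

lemma lie_bracket_scale:
  assumes V: "open V" "x \<in> V" and X: "smooth_field A V X" and Y: "smooth_field A V Y"
    and f: "smooth_fun A V f" and Z: "\<And>y. y \<in> V \<Longrightarrow> Z y = f y *\<^sub>R X y"
  shows "lie_bracket A Z Y x = f x *\<^sub>R lie_bracket A X Y x - vec_deriv A x (Y x) f *\<^sub>R X x"
proof -
  let ?c = "chart_at A x"
  let ?z = "snd ?c x"
  let ?X' = "frechet_derivative (coord_field A ?c X) (at ?z)"
    and ?Y' = "frechet_derivative (coord_field A ?c Y) (at ?z)"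
  have "((\<lambda>y. (f \<circ> chart_inv ?c) y *\<^sub>R coord_field A ?c X y) has_derivative
      (\<lambda>v. f x *\<^sub>R ?X' v + vec_deriv A x v f *\<^sub>R X x)) (at ?z)"
    using has_derivative_scaleR[OF vec_deriv_has_derivative[OF V(1) f V(2)]
        coord_field_has_derivative[OF X V(2)]] chart_at by (simp add: coord_field_coord)
  then have "(coord_field A ?c Z has_derivative
      (\<lambda>v. f x *\<^sub>R ?X' v + vec_deriv A x v f *\<^sub>R X x)) (at ?z)"
  proof (rule has_derivative_transform_within_open)
    show "open (snd ?c ` (fst ?c \<inter> V))" using open_chart_image chart_at(1) V(1) by blast
    show "?z \<in> snd ?c ` (fst ?c \<inter> V)" using chart_at V(2) by blast
  qed (use Z chart_at(1) in \<open>auto simp: coord_field_coord linear_scale linear_tcoord\<close>)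
  from frechet_derivative_at[OF this]
  have "frechet_derivative (coord_field A ?c Z) (at ?z) v = f x *\<^sub>R ?X' v + vec_deriv A x v f *\<^sub>R X x" for v
    by (rule fun_cong[THEN sym])
  moreover have "?Y' (Z x) = f x *\<^sub>R ?Y' (X x)"
    using linear_scale[OF has_derivative_linear[OF coord_field_has_derivative[OF Y V(2)]]]
      Z[OF V(2)] by simp
  ultimately show ?thesis by (simp add: lie_bracket_def Let_def algebra_simps)
qed

end

locale shearfree_atlas = atlas A
  for A :: "('a::{t2_space,second_countable_topology}, 'e::euclidean_space) chart set" +
  fixes W :: "'a \<Rightarrow> 'e set" and C :: "('a, 'e) form set"
  assumes shearfree: "shearfree_structure A W C"
begin

lemma W_distribution: "distribution_on A UNIV (DIM('e) - 1) W"
  using shearfree unfolding shearfree_structure_def by blast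

lemma W_hyperplane: "subspace (W x)" "dim (W x) = DIM('e) - 1"
  using W_distribution unfolding distribution_on_def by blast+

text \<open>Conformality is an equivalence relation, so any two members of the class differ by a positive
  smooth factor, and kernel and semidefiniteness may be read off from any of them.\<close>

lemma class_conformal:
  assumes "h \<in> C" "k \<in> C"
  shows "\<exists>l. smooth_fun A UNIV l \<and> (\<forall>x. l x > 0) \<and> (\<forall>x. \<forall>u\<in>W x. \<forall>v\<in>W x. k x u v = l x * h x u v)"
proof -
  obtain h0 where C: "C = conformal_class A W h0"
    using shearfree unfolding shearfree_structure_def by blast
  obtain l where l: "smooth_fun A UNIV l" "\<And>x. l x > 0"
    "\<And>x u v. u \<in> W x \<Longrightarrow> v \<in> W x \<Longrightarrow> h x u v = l x * h0 x u v"
    using assms(1) unfolding C conformal_class_def by blast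
  obtain m where m: "smooth_fun A UNIV m" "\<And>x. m x > 0"
    "\<And>x u v. u \<in> W x \<Longrightarrow> v \<in> W x \<Longrightarrow> k x u v = m x * h0 x u v"
    using assms(2) unfolding C conformal_class_def by blast
  show ?thesis
  proof (intro exI[of _ "\<lambda>x. m x / l x"] conjI allI ballI)
    show "smooth_fun A UNIV (\<lambda>x. m x / l x)"
      by (rule smooth_fun_divide[OF open_UNIV m(1) l(1)]) (use l(2) less_irrefl in metis)
    show "m x / l x > 0" for x using l(2) m(2) by simp
    show "k x u v = m x / l x * h x u v" if "u \<in> W x" "v \<in> W x" for x u v
      using l(2)[of x] l(3)[OF that] m(3)[OF that] by simp
  qed
qed

lemma class_metric:
  "\<exists>h0. h0 \<in> C \<and> degenerate_metric A W h0 \<and> C = conformal_class A W h0 \<and>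
     (\<forall>x. \<exists>U p. open U \<and> x \<in> U \<and> nonvanishing_section A U (form_kernel W h0) p \<and>
           lie_preserves_distribution A U p W \<and> lie_conformal A U p W h0)"
proof -
  obtain h0 where h0: "degenerate_metric A W h0" "C = conformal_class A W h0"
    "\<And>x. \<exists>U p. open U \<and> x \<in> U \<and> nonvanishing_section A U (form_kernel W h0) p \<and>
           lie_preserves_distribution A U p W \<and> lie_conformal A U p W h0"
    using shearfree unfolding shearfree_structure_def by metis
  have "h0 \<in> C" unfolding h0(2) conformal_class_def
    by (auto intro!: exI[of _ "\<lambda>x. 1"] smooth_fun_const)
  with h0 show ?thesis by blast
qed

lemma conformal_class_member: assumes "h \<in> C" shows "conformal_class A W h = C"
proof -
  obtain h0 where h0: "h0 \<in> C" "C = conformal_class A W h0" using class_metric by blast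
  have sub: "conformal_class A W k' \<subseteq> conformal_class A W k" if kk: "k \<in> C" "k' \<in> C" for k k'
  proof
    fix j assume "j \<in> conformal_class A W k'"
    then obtain m where m: "smooth_fun A UNIV m" "\<And>x. m x > 0"
      "\<And>x u v. u \<in> W x \<Longrightarrow> v \<in> W x \<Longrightarrow> j x u v = m x * k' x u v"
      unfolding conformal_class_def by blast
    obtain l where l: "smooth_fun A UNIV l" "\<And>x. l x > 0"
      "\<And>x u v. u \<in> W x \<Longrightarrow> v \<in> W x \<Longrightarrow> k' x u v = l x * k x u v" using class_conformal[OF kk] by blast
    show "j \<in> conformal_class A W k"
      unfolding conformal_class_def
      using smooth_fun_mult[OF open_UNIV m(1) l(1)] m l
      by (auto intro!: exI[of _ "\<lambda>x. m x * l x"])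
  qed
  show ?thesis using sub[OF h0(1) assms] sub[OF assms h0(1)] h0(2) by blast
qed

lemma class_kernel_eq: assumes "h \<in> C" shows "class_kernel W C x = form_kernel W h x"
proof
  show "class_kernel W C x \<subseteq> form_kernel W h x"
    using assms unfolding class_kernel_def form_kernel_def by blast
  show "form_kernel W h x \<subseteq> class_kernel W C x"
  proof
    fix v assume v: "v \<in> form_kernel W h x"
    have "k x v w = 0" if k: "k \<in> C" and w: "w \<in> W x" for k w
    proof -
      obtain l where "\<And>x u v. u \<in> W x \<Longrightarrow> v \<in> W x \<Longrightarrow> k x u v = l x * h x u v"
        using class_conformal[OF assms k] by blast
      with v w show ?thesis unfolding form_kernel_def by simp
    qed
    with v show "v \<in> class_kernel W C x" unfolding class_kernel_def form_kernel_def by blast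
  qed
qed

lemma class_member:
  assumes "h \<in> C"
  shows class_sym_bilinear: "sym_bilinear_on (W x) (h x)"
    and class_nonneg: "v \<in> W x \<Longrightarrow> h x v v \<ge> 0"
    and class_smooth: "open V \<Longrightarrow> section_of A V W X \<Longrightarrow> section_of A V W Y \<Longrightarrow>
      smooth_fun A V (\<lambda>x. h x (X x) (Y x))"
proof -
  obtain h0 where h0: "h0 \<in> C" "degenerate_metric A W h0" using class_metric by blast
  obtain l where l: "smooth_fun A UNIV l" "\<And>x. l x > 0"
    "\<And>x u v. u \<in> W x \<Longrightarrow> v \<in> W x \<Longrightarrow> h x u v = l x * h0 x u v" using class_conformal[OF h0(1) assms] by blast
  have sm: "smooth_sym_form A W h0" and nn: "\<And>x v. v \<in> W x \<Longrightarrow> h0 x v v \<ge> 0"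
    using h0(2) unfolding degenerate_metric_def by simp_all
  have 0: "sym_bilinear_on (W x) (h0 x)" for x
    using smooth_sym_form_sym_bilinear[OF sm] .
  show "sym_bilinear_on (W x) (h x)"
    unfolding sym_bilinear_on_def
  proof (intro conjI ballI allI)
    note D = sym_bilinear_onD[OF W_hyperplane(1) 0]
    fix u v assume uv: "u \<in> W x" "v \<in> W x"
    show "h x u v = h x v u" using uv D(1)[of u x v] by (simp add: l(3))
    show "h x (u + v) w = h x u w + h x v w" if "w \<in> W x" for w
      using uv that D(2)[of u x v w] subspace_add[OF W_hyperplane(1) uv] by (simp add: l(3) algebra_simps)
    show "h x (r *\<^sub>R u) v = r * h x u v" for r
      using uv D(4)[of u x v r] subspace_scale[OF W_hyperplane(1) uv(1)] by (simp add: l(3))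
  qed
  show "h x v v \<ge> 0" if "v \<in> W x" using l(2)[of x] l(3)[OF that that] nn[OF that] by simp
  show "smooth_fun A V (\<lambda>x. h x (X x) (Y x))" if V: "open V" and XY: "section_of A V W X" "section_of A V W Y"
  proof (rule smooth_fun_cong[OF V])
    show "smooth_fun A V (\<lambda>x. l x * h0 x (X x) (Y x))"
      by (intro smooth_fun_mult V smooth_fun_subset[OF l(1)] smooth_sym_form_smooth[OF sm V XY]) simp
    show "l x * h0 x (X x) (Y x) = h x (X x) (Y x)" if "x \<in> V" for x
      using l(3) XY that unfolding section_of_def by simp
  qed
qed

lemma class_kernel_line: "subspace (class_kernel W C x)" "dim (class_kernel W C x) = 1"
  "class_kernel W C x \<subseteq> W x"
proof -
  obtain h0 where h0: "h0 \<in> C" "degenerate_metric A W h0" using class_metric by blast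
  note K = class_kernel_eq[OF h0(1)] and D = sym_bilinear_onD[OF W_hyperplane(1) class_sym_bilinear[OF h0(1)]]
  show "subspace (class_kernel W C x)"
    unfolding K form_kernel_def using W_hyperplane(1)[of x]
    by (auto intro!: subspaceI simp: D subspace_0 subspace_add subspace_scale)
  show "dim (class_kernel W C x) = 1"
    using h0(2) unfolding K degenerate_metric_def by blast
  show "class_kernel W C x \<subseteq> W x" unfolding K form_kernel_def by blast
qed

lemma class_kernel_span:
  "p \<in> class_kernel W C x \<Longrightarrow> p \<noteq> 0 \<Longrightarrow> class_kernel W C x = span {p}"
  using line_span class_kernel_line by blast

text \<open>Let \<open>r\<close> be the local field that the shearfree structure provides for its metric \<open>h\<^sub>0\<close>.  The kernel is
  a line field, so \<open>p = f r\<close>, and \<open>f\<close> is smooth as a quotient of products in the Euclidean metric of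
  a chart.  The term \<open>- X(f) r\<close> of \<open>[f r, X]\<close> is invisible to \<open>h\<^sub>0\<close>, hence
  \<open>\<L>\<^sub>p h\<^sub>0 = f \<L>\<^sub>r h\<^sub>0\<close>; for \<open>h = l h\<^sub>0\<close> the product rule adds the summand \<open>p(l)/l\<close> to the factor.\<close>

lemma kernel_field_factor:
  assumes p: "nonvanishing_section A UNIV (class_kernel W C) p"
  obtains U r f where "open U" "x \<in> U" "smooth_field A U r" "\<And>y. y \<in> U \<Longrightarrow> r y \<in> class_kernel W C y"
    "smooth_fun A U f" "\<And>y. y \<in> U \<Longrightarrow> p y = f y *\<^sub>R r y"
    "lie_preserves_distribution A U r W" "\<And>h. h \<in> C \<Longrightarrow> \<exists>g. smooth_fun A U g \<and>
       (\<forall>V X Y. open V \<longrightarrow> V \<subseteq> U \<longrightarrow> section_of A V W X \<longrightarrow> section_of A V W Y \<longrightarrow>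
           (\<forall>x\<in>V. lie_deriv_form A p h X Y x = g x * h x (X x) (Y x)))"
proof -
  obtain h0 where h0: "h0 \<in> C"
    "\<And>x. \<exists>U p. open U \<and> x \<in> U \<and> nonvanishing_section A U (form_kernel W h0) p \<and>
           lie_preserves_distribution A U p W \<and> lie_conformal A U p W h0"
    using class_metric by blast
  obtain U0 r where U0: "open U0" "x \<in> U0" and r: "nonvanishing_section A U0 (form_kernel W h0) r"
    and pres: "lie_preserves_distribution A U0 r W" and conf: "lie_conformal A U0 r W h0"
    using h0(2)[of x] by blast
  have r0: "smooth_field A U0 r" "\<And>y. y \<in> U0 \<Longrightarrow> r y \<in> class_kernel W C y"
    "\<And>y. y \<in> U0 \<Longrightarrow> r y \<noteq> 0"
    using r unfolding class_kernel_eq[OF h0(1)] nonvanishing_section_def section_of_def by blast+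
  obtain f0 where f0: "smooth_fun A U0 f0"
    and f0': "\<forall>V X Y. open V \<longrightarrow> V \<subseteq> U0 \<longrightarrow> section_of A V W X \<longrightarrow> section_of A V W Y \<longrightarrow>
       (\<forall>x\<in>V. lie_deriv_form A r h0 X Y x = f0 x * h0 x (X x) (Y x))"
    using conf unfolding lie_conformal_def by (elim exE conjE)
  define U where "U = U0 \<inter> fst (chart_at A x)"
  let ?B = "chart_metric (chart_at A x)"
  have U: "open U" "x \<in> U" "U \<subseteq> U0" "U \<subseteq> fst (chart_at A x)"
    using U0 chart_at[of x] open_domain[OF chart_at(1)[of x]] by (auto simp: U_def)
  have B: "smooth_form_on U ?B"
    using smooth_form_on_subset[OF smooth_form_chart_metric U(4)] chart_at by blast
  have pos: "?B y v v > 0" if "y \<in> U" "v \<noteq> 0" for y v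
    using chart_metric_pos chart_at(1) that U(4) by blast
  have rU: "smooth_field A U r" and pU: "smooth_field A U p"
    using smooth_field_subset r0(1) U(3) p unfolding nonvanishing_section_def section_of_def by blast+
  have pK: "p y \<in> class_kernel W C y" for y
    using p unfolding nonvanishing_section_def section_of_def by blast
  define f where "f y = ?B y (p y) (r y) / ?B y (r y) (r y)" for y
  have fS: "smooth_fun A U f"
    unfolding f_def[abs_def] using pos r0(3) U(3)
    by (intro smooth_fun_divide U(1) smooth_form_smooth[OF B U(1) order_refl] rU pU)
      (metis less_irrefl subsetD)
  have pf: "p y = f y *\<^sub>R r y" if y: "y \<in> U" for y
  proof -
    have yU0: "y \<in> U0" using y U(3) by blast
    obtain s where s: "p y = s *\<^sub>R r y"
      using pK[of y] class_kernel_span[OF r0(2,3)[OF yU0]] by (auto simp: span_singleton)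
    have "?B y (r y) (r y) > 0" using pos[OF y r0(3)[OF yU0]] .
    then have "f y = s"
      unfolding f_def s bilinear_simps(5)[OF smooth_form_bilinear[OF B y]] by simp
    with s show ?thesis by simp
  qed
  show ?thesis
  proof (rule that[OF U(1,2) rU _ fS pf])
    show "r y \<in> class_kernel W C y" if "y \<in> U" for y using r0(2) U(3) that by blast
    show "lie_preserves_distribution A U r W"
      using pres U(3) unfolding lie_preserves_distribution_def by (meson subset_trans)
  next
    fix h assume h: "h \<in> C"
    obtain l where l: "smooth_fun A UNIV l" "\<And>x. l x > 0"
      "\<And>x u v. u \<in> W x \<Longrightarrow> v \<in> W x \<Longrightarrow> h x u v = l x * h0 x u v" using class_conformal[OF h0(1) h] by blast
    define g where "g y = vec_deriv A y (p y) l / l y + f y * f0 y" for y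
    have lU: "smooth_fun A U l" using smooth_fun_subset[OF l(1)] by blast
    have gS: "smooth_fun A U g"
      unfolding g_def[abs_def]
      using l(2) smooth_fun_subset[OF f0 U(3)]
      by (intro smooth_fun_add smooth_fun_divide smooth_fun_mult U(1) smooth_vec_deriv lU pU fS)
        (auto simp: less_imp_neq[symmetric])
    have "lie_deriv_form A p h X Y y = g y * h y (X y) (Y y)"
      if V: "open V" "V \<subseteq> U" and X: "section_of A V W X" and Y: "section_of A V W Y" and y: "y \<in> V"
      for V X Y y
    proof -
      have yU: "y \<in> U" "y \<in> U0" using V(2) y U(3) by auto
      have XW: "X z \<in> W z" "Y z \<in> W z" if "z \<in> V" for z using X Y that unfolding section_of_def by auto
      have XS: "smooth_field A V X" "smooth_field A V Y" using X Y unfolding section_of_def by auto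
      note V0 = subset_trans[OF V(2) U(3)]
      note D = sym_bilinear_onD[OF W_hyperplane(1) class_sym_bilinear[OF h0(1)]]
      define H where "H z = h0 z (X z) (Y z)" for z
      have HS: "smooth_fun A V H" unfolding H_def[abs_def] using class_smooth[OF h0(1) V(1) X Y] .
      have rW: "r y \<in> W y" and rK: "\<And>w. w \<in> W y \<Longrightarrow> h0 y (r y) w = 0"
        using r0(2)[OF yU(2)] unfolding class_kernel_eq[OF h0(1)] form_kernel_def by auto
      have br: "lie_bracket A r Z y \<in> W y" if "section_of A V W Z" for Z
        using pres that V(1) V0 y unfolding lie_preserves_distribution_def by blast
      have bp: "lie_bracket A p Z y = f y *\<^sub>R lie_bracket A r Z y + (- vec_deriv A y (Z y) f) *\<^sub>R r y"
        if "smooth_field A V Z" for Z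
        using lie_bracket_scale[OF V(1) y smooth_field_subset[OF rU V(2)] that
            smooth_fun_subset[OF fS V(2)], of p] pf V(2) by auto
      have bpW: "lie_bracket A p Z y \<in> W y" if "section_of A V W Z" for Z
        using bp[of Z] that br[OF that] rW W_hyperplane(1)[of y]
        by (auto simp: section_of_def intro!: subspace_diff subspace_scale)
      have hb: "h0 y (lie_bracket A p Z y) w = f y * h0 y (lie_bracket A r Z y) w"
        "h0 y w (lie_bracket A p Z y) = f y * h0 y w (lie_bracket A r Z y)"
        if Z: "section_of A V W Z" and w: "w \<in> W y" for Z w
      proof -
        have ZS: "smooth_field A V Z" using Z unfolding section_of_def by blast
        have mem: "f y *\<^sub>R lie_bracket A r Z y \<in> W y" "(- vec_deriv A y (Z y) f) *\<^sub>R r y \<in> W y"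
          using subspace_scale[OF W_hyperplane(1)] br[OF Z] rW by blast+
        show 1: "h0 y (lie_bracket A p Z y) w = f y * h0 y (lie_bracket A r Z y) w"
          unfolding bp[OF ZS] D(2)[OF mem w] D(4)[OF rW w] D(4)[OF br[OF Z] w] rK[OF w] by simp
        show "h0 y w (lie_bracket A p Z y) = f y * h0 y w (lie_bracket A r Z y)"
          using 1 D(1)[OF w bpW[OF Z]] D(1)[OF w br[OF Z]] by simp
      qed
      have "vec_deriv A y (p y) (\<lambda>z. h z (X z) (Y z)) = vec_deriv A y (p y) l * H y + l y * vec_deriv A y (p y) H"
        by (rule vec_deriv_mult[OF V(1) y smooth_fun_subset[OF lU V(2)] HS]) (simp add: H_def l(3) XW)
      also have "vec_deriv A y (p y) H = f y * vec_deriv A y (r y) H"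
        using vec_deriv_scale[OF V(1) HS y] pf[OF yU(1)] by simp
      finally have "lie_deriv_form A p h X Y y = vec_deriv A y (p y) l * H y
          + l y * f y * lie_deriv_form A r h0 X Y y"
        unfolding lie_deriv_form_def l(3)[OF bpW[OF X] XW(2)[OF y]] l(3)[OF XW(1)[OF y] bpW[OF Y]]
          hb(1)[OF X XW(2)[OF y]] hb(2)[OF Y XW(1)[OF y]] H_def[abs_def, symmetric]
        by (simp add: algebra_simps)
      moreover have "lie_deriv_form A r h0 X Y y = f0 y * h0 y (X y) (Y y)"
        using f0'[rule_format, OF V(1) V0 X Y y] .
      ultimately show ?thesis
        using l(2)[of y] l(3)[OF XW[OF y]]
        by (simp add: g_def H_def field_simps)
    qed
    with gS show "\<exists>g. smooth_fun A U g \<and>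
       (\<forall>V X Y. open V \<longrightarrow> V \<subseteq> U \<longrightarrow> section_of A V W X \<longrightarrow> section_of A V W Y \<longrightarrow>
           (\<forall>x\<in>V. lie_deriv_form A p h X Y x = g x * h x (X x) (Y x)))" by blast
  qed
qed

lemma kernel_field_preserves:
  assumes p: "nonvanishing_section A UNIV (class_kernel W C) p"
  shows "lie_preserves_distribution A UNIV p W"
  unfolding lie_preserves_distribution_def
proof (intro allI impI ballI)
  fix V X x assume V: "open V" "section_of A V W X" "x \<in> V"
  obtain U r f where U: "open U" "x \<in> U" and r: "smooth_field A U r" "r x \<in> class_kernel W C x"
    and f: "smooth_fun A U f" "\<And>y. y \<in> U \<Longrightarrow> p y = f y *\<^sub>R r y"
    and pres: "lie_preserves_distribution A U r W"
    using kernel_field_factor[OF p, of x] by metis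
  have V': "open (V \<inter> U)" "x \<in> V \<inter> U" using U V by auto
  have X: "section_of A (V \<inter> U) W X" using section_of_subset[OF V(2)] by blast
  then have "lie_bracket A p X x = f x *\<^sub>R lie_bracket A r X x - vec_deriv A x (X x) f *\<^sub>R r x"
    using smooth_field_subset[OF r(1), of "V \<inter> U"] smooth_fun_subset[OF f(1), of "V \<inter> U"] f(2)
    by (intro lie_bracket_scale[OF V']) (auto simp: section_of_def)
  moreover have "lie_bracket A r X x \<in> W x"
    using pres X V' unfolding lie_preserves_distribution_def by blast
  moreover have "r x \<in> W x" using r(2) class_kernel_line(3) by blast
  ultimately show "lie_bracket A p X x \<in> W x"
    using W_hyperplane(1) by (simp add: subspace_diff subspace_scale)
qed

text \<open>The local factors agree on overlaps because a form that does not vanish on \<open>W\<close> determines its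
  factor; in dimension two all forms of the class vanish on \<open>W\<close> and any factor will do.\<close>

lemma kernel_field_conformal:
  assumes p: "nonvanishing_section A UNIV (class_kernel W C) p" and h: "h \<in> C"
  shows "lie_conformal A UNIV p W h"
proof -
  let ?Q = "\<lambda>U g. \<forall>V X Y. open V \<longrightarrow> V \<subseteq> U \<longrightarrow> section_of A V W X \<longrightarrow> section_of A V W Y \<longrightarrow>
           (\<forall>x\<in>V. lie_deriv_form A p h X Y x = g x * h x (X x) (Y x))"
  have "\<exists>U g. open U \<and> x \<in> U \<and> smooth_fun A U g \<and> ?Q U g" for x
    using kernel_field_factor[OF p, of x] h by metis
  then obtain U g where U: "\<And>x. open (U x)" "\<And>x. x \<in> U x" and gS: "\<And>x. smooth_fun A (U x) (g x)"
    and Q: "\<And>x. ?Q (U x) (g x)"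
    by metis
  have Q': "lie_deriv_form A p h X Y x = g z x * h x (X x) (Y x)"
    if "open V" "x \<in> V" "x \<in> U z" "section_of A V W X" "section_of A V W Y" for V X Y x z
  proof -
    have "open (V \<inter> U z)" "section_of A (V \<inter> U z) W X" "section_of A (V \<inter> U z) W Y"
      using that U section_of_subset by blast+
    then show ?thesis using Q[of z] that by blast
  qed
  show ?thesis
  proof (cases "DIM('e) - 1 = 1")
    case True
    have "h x u v = 0" if "u \<in> W x" "v \<in> W x" for x u v
    proof -
      have "class_kernel W C x = W x"
        using class_kernel_line[of x] W_hyperplane[of x] True by (intro subspace_dim_equal) auto
      then show ?thesis using that unfolding class_kernel_eq[OF h] form_kernel_def by blast
    qed
    then have "lie_deriv_form A p h X Y x = 0 * h x (X x) (Y x)"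
      if "open V" "section_of A V W X" "section_of A V W Y" "x \<in> V" for V X Y x
      using Q'[OF that(1,4) U(2) that(2,3)] that unfolding section_of_def by simp
    then show ?thesis unfolding lie_conformal_def
      by (intro exI[of _ "\<lambda>x. 0"]) (auto simp: smooth_fun_const)
  next
    case False
    have agree: "g y y = g x y" if y: "y \<in> U x" for x y
    proof -
      have "class_kernel W C y \<noteq> W y"
        using class_kernel_line(2)[of y] W_hyperplane(2)[of y] False by auto
      then obtain v where v: "v \<in> W y" "v \<notin> form_kernel W h y"
        using class_kernel_line(3)[of y] class_kernel_eq[OF h] by blast
      then have "h y v v \<noteq> 0"
        using semidefinite_null_in_kernel[OF W_hyperplane(1) class_sym_bilinear[OF h] class_nonneg[OF h]]
        unfolding form_kernel_def by blast
      moreover obtain V X where VX: "open V" "y \<in> V" "section_of A V W X" "X y = v"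
        using section_through[OF W_distribution UNIV_I v(1)] by metis
      have "g y y * h y v v = g x y * h y v v"
        using Q'[OF VX(1,2) U(2) VX(3,3)] Q'[OF VX(1,2) y VX(3,3)] VX(4) by auto
      ultimately show ?thesis by simp
    qed
    have "smooth_fun A UNIV (\<lambda>x. g x x)"
    proof (rule smooth_fun_cover)
      fix x
      have "smooth_fun A (U x) (\<lambda>x. g x x)"
        by (rule smooth_fun_cong[OF U(1) _ gS]) (simp add: agree)
      then show "\<exists>V. open V \<and> x \<in> V \<and> smooth_fun A V (\<lambda>x. g x x)" using U by blast
    qed
    then show ?thesis unfolding lie_conformal_def
      using Q'[OF _ _ U(2)] by (intro exI[of _ "\<lambda>x. g x x"]) blast
  qed
qed

end

section \<open>Riggings and shearfree pairs\<close>

context atlas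
begin

lemma distribution_on_subset:
  assumes "distribution_on A U k D" "open V" "V \<subseteq> U" shows "distribution_on A V k D"
proof (rule distribution_onI)
  show "subspace (D x) \<and> dim (D x) = k" if "x \<in> V" for x
    using assms(1,3) that unfolding distribution_on_def by blast
  fix x assume x: "x \<in> V"
  then have "x \<in> U" using assms(3) by blast
  from distribution_frame[OF assms(1) this] obtain V0 F where F: "open V0" "x \<in> V0"
    "\<And>i. i < k \<Longrightarrow> smooth_field A V0 (F i)" "\<And>y. y \<in> V0 \<Longrightarrow> D y = span ((\<lambda>i. F i y) ` {..<k})"
    "\<And>y j. y \<in> V0 \<Longrightarrow> j < k \<Longrightarrow> F j y \<notin> span ((\<lambda>i. F i y) ` {..<j})" by metis
  have "F i y \<in> D y" if "i < k" "y \<in> V0 \<inter> V" for i y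
    using F(4)[of y] that by (auto intro: span_base)
  then show "\<exists>V' F. open V' \<and> x \<in> V' \<and> V' \<subseteq> V \<and> (\<forall>i<k. smooth_field A V' (F i)) \<and>
        (\<forall>i<k. \<forall>y\<in>V'. F i y \<in> D y) \<and> (\<forall>j<k. F j x \<notin> span ((\<lambda>i. F i x) ` {..<j}))"
    using F x assms(2) smooth_field_subset[of V0 _ "V0 \<inter> V"]
    by (intro exI[of _ "V0 \<inter> V"] exI[of _ F]) auto
qed

lemma distribution_add_field:
  assumes D: "distribution_on A U k D"
    and q: "smooth_field A U q" "\<And>x. x \<in> U \<Longrightarrow> q x \<notin> D x"
  shows "distribution_on A U (Suc k) (\<lambda>x. span (D x \<union> {q x}))"
proof (rule distribution_onI)
  fix x assume x: "x \<in> U"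
  have Dx: "subspace (D x)" "dim (D x) = k" using D x unfolding distribution_on_def by blast+
  then show "subspace (span (D x \<union> {q x})) \<and> dim (span (D x \<union> {q x})) = Suc k"
    using q(2)[OF x] by (simp add: dim_insert span_eq_iff[THEN iffD2])
  from distribution_frame[OF D x] obtain V F where V: "open V" "x \<in> V" "V \<subseteq> U"
    and F: "\<And>i. i < k \<Longrightarrow> smooth_field A V (F i)"
    "\<And>y. y \<in> V \<Longrightarrow> D y = span ((\<lambda>i. F i y) ` {..<k})"
    "\<And>y j. y \<in> V \<Longrightarrow> j < k \<Longrightarrow> F j y \<notin> span ((\<lambda>i. F i y) ` {..<j})" by metis
  define G where "G i = (if i < k then F i else q)" for i
  have G: "(\<lambda>i. G i y) ` {..<j} = (\<lambda>i. F i y) ` {..<j}" if "j \<le> k" for j y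
    using that by (intro image_cong) (auto simp: G_def)
  show "\<exists>V F. open V \<and> x \<in> V \<and> V \<subseteq> U \<and> (\<forall>i<Suc k. smooth_field A V (F i)) \<and>
        (\<forall>i<Suc k. \<forall>y\<in>V. F i y \<in> span (D y \<union> {q y})) \<and>
        (\<forall>j<Suc k. F j x \<notin> span ((\<lambda>i. F i x) ` {..<j}))"
  proof (intro exI[of _ V] exI[of _ G] conjI V allI impI ballI)
    show "smooth_field A V (G i)" for i
      using F(1) smooth_field_subset[OF q(1) V(3)] by (simp add: G_def)
    show "G i y \<in> span (D y \<union> {q y})" if "y \<in> V" for i y
    proof (cases "i < k")
      case True
      then have "F i y \<in> D y" using F(2)[OF that] by (auto intro: span_base)
      then show ?thesis using True by (auto simp: G_def intro: span_base)
    qed (auto simp: G_def intro: span_base)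
    show "G j x \<notin> span ((\<lambda>i. G i x) ` {..<j})" if "j < Suc k" for j
    proof (cases "j < k")
      case True
      then show ?thesis using F(3)[OF V(2) True] G[of j x] by (simp add: G_def)
    next
      case False
      with that have "j = k" by simp
      then show ?thesis using q(2)[OF x] F(2)[OF V(2)] G[of k x] by (simp add: G_def)
    qed
  qed
qed

end

lemma conformal_class_cong:
  assumes "\<And>x u v. u \<in> W x \<Longrightarrow> v \<in> W x \<Longrightarrow> h x u v = k x u v"
  shows "conformal_class A W h = conformal_class A W k"
  using assms unfolding conformal_class_def by auto

context shearfree_atlas
begin

lemma class_member_cong:
  assumes "h \<in> C" "\<And>x u v. u \<in> W x \<Longrightarrow> v \<in> W x \<Longrightarrow> k x u v = h x u v"
  shows "k \<in> C"
proof -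
  have "k \<in> conformal_class A W h"
    using assms(2) smooth_fun_const[of UNIV 1] unfolding conformal_class_def
    by (auto intro!: exI[of _ "\<lambda>x. 1"])
  then show ?thesis using conformal_class_member[OF assms(1)] by simp
qed

lemma complementary_distributionD:
  assumes "complementary_distribution A U W C W'" "x \<in> U"
  shows "subspace (W' x)" "complementary_in (W' x) (class_kernel W C x) (W x)"
  using assms unfolding complementary_distribution_def distribution_on_def by blast+

lemma rigged_hyperplane_at:
  assumes h: "h \<in> C" and p: "p x \<in> class_kernel W C x" "p x \<noteq> 0"
    and W': "complementary_distribution A U W C W'" "x \<in> U" and q: "q x \<notin> W x"
  shows "rigged_hyperplane (W x) (W' x) (p x) (q x) (h x)"
    and "star_metric W C h p W' q x = rigged_hyperplane.star (W x) (W' x) (p x) (q x) (h x)"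
proof -
  note K = class_kernel_span[OF p]
  show R: "rigged_hyperplane (W x) (W' x) (p x) (q x) (h x)"
  proof
    show "complementary_in (W' x) (span {p x}) (W x)" "subspace (W' x)"
      using complementary_distributionD[OF W'] unfolding K by blast+
    show "{v \<in> W x. \<forall>w\<in>W x. h x v w = 0} = span {p x}"
      using class_kernel_eq[OF h, of x] unfolding K form_kernel_def by simp
  qed (use W_hyperplane p q class_sym_bilinear[OF h] in auto)
  show "star_metric W C h p W' q x = rigged_hyperplane.star (W x) (W' x) (p x) (q x) (h x)"
    unfolding star_metric_def[abs_def] rigged_hyperplane.star_def[OF R, abs_def] Let_def K
      rigged_hyperplane.\<alpha>_def[OF R] rigged_hyperplane.\<beta>_def[OF R] by (simp add: fun_eq_iff)
qed

text \<open>The metric is smooth because \<open>p\<^sup>*\<close> and \<open>q\<^sup>*\<close> are: \<open>X - q\<^sup>*(X) q\<close> is a section of \<open>W\<close>, and on such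
  sections \<open>h\<close> is smooth.  The rest is the pointwise algebra, which gives the signature and
  \<open>p\<^sup>\<bottom> = W\<close>, combined with what \<open>p\<close> does to \<open>W\<close> and to the members of the class.\<close>

proposition star_metric_shearfree:
  assumes h: "h \<in> C" and p: "nonvanishing_section A UNIV (class_kernel W C) p"
    and rig: "rigging A UNIV W C W' q"
  defines "g \<equiv> star_metric W C h p W' q"
  shows "shearfree_pair A g p" "compatible A W C g p"
proof -
  have W': "complementary_distribution A UNIV W C W'" and qS: "smooth_field A UNIV q"
    and qW: "\<And>x. q x \<notin> W x"
    using rig unfolding rigging_def transversal_field_def by auto
  have pS: "smooth_field A UNIV p" and pK: "\<And>x. p x \<in> class_kernel W C x" "\<And>x. p x \<noteq> 0"
    using p unfolding nonvanishing_section_def section_of_def by auto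
  interpret R: rigged_hyperplane "W x" "W' x" "p x" "q x" "h x" for x
    by (rule rigged_hyperplane_at[OF h pK W' UNIV_I qW])
  have g: "g x = R.star x" for x
    unfolding g_def by (rule rigged_hyperplane_at[OF h pK W' UNIV_I qW])
  obtain k where k: "distribution_on A UNIV k W'" using W' unfolding complementary_distribution_def by blast
  have "q x \<notin> W' x" for x using qW R.W'W by blast
  note dist = distribution_add_field[OF k qS this]
  have "smooth_sym_form A (\<lambda>x. UNIV) g"
    unfolding smooth_sym_form_def g
  proof (intro conjI allI ballI impI)
    fix V X Y assume V: "open V" and "section_of A V (\<lambda>x. UNIV) X" "section_of A V (\<lambda>x. UNIV) Y"
    then have X: "smooth_field A V X" and Y: "smooth_field A V Y" unfolding section_of_def by auto
    have sub: "smooth_field A V q" "smooth_field A V p"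
      using qS pS smooth_field_subset by blast+
    have \<alpha>S: "smooth_fun A V (\<lambda>x. R.\<alpha> x (Z x))" and \<beta>S: "smooth_fun A V (\<lambda>x. R.\<beta> x (Z x))"
      if Z: "smooth_field A V Z" for Z
      using smooth_hyperplane_covector[OF V distribution_on_subset[OF W_distribution V] R.\<alpha>(1,3) sub(1) R.\<alpha>(2) Z]
        smooth_hyperplane_covector[OF V distribution_on_subset[OF dist V] R.\<beta>(1,3) sub(2) R.\<beta>(2) Z]
      by auto
    have sec: "section_of A V W (\<lambda>x. Z x - R.\<alpha> x (Z x) *\<^sub>R q x)" if Z: "smooth_field A V Z" for Z
      unfolding section_of_def using smooth_field_diff_scale[OF V Z \<alpha>S[OF Z] sub(1)] R.\<pi>W by auto
    show "smooth_fun A V (\<lambda>x. R.star x (X x) (Y x))"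
      unfolding R.star_eq
      by (intro smooth_fun_add smooth_fun_mult V class_smooth[OF h V] sec \<alpha>S \<beta>S X Y)
  qed (use R.star_sym bilinear_simps[OF R.star_bilinear] in auto)
  then have lor: "lorentzian_metric A g"
    unfolding lorentzian_metric_def g using R.star_lorentzian class_nonneg[OF h] by blast
  have ker: "{v. g x (p x) v = 0} = W x" for x
    unfolding g R.star_p using R.\<alpha>(3) .
  then have perp: "perp g (\<lambda>x. {p x}) = W"
    unfolding perp_def by (simp add: fun_eq_iff)
  have gW: "restrict_form W g x u v = h x u v" if "u \<in> W x" "v \<in> W x" for x u v
    using that R.star_W unfolding restrict_form_def g by simp
  have "lie_conformal A UNIV p W (restrict_form W g)"
    using kernel_field_conformal[OF p class_member_cong[OF h gW]] .
  then show "shearfree_pair A g p"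
    unfolding shearfree_pair_def perp Let_def nonvanishing_section_def section_of_def
    using lor pS pK(2) kernel_field_preserves[OF p] ker R.pW by blast
  show "compatible A W C g p"
    unfolding compatible_def
    using ker conformal_class_cong[of W "restrict_form W g" h A] gW conformal_class_member[OF h] by blast
qed

end

locale compatible_pair = shearfree_atlas A W C
  for A :: "('a::{t2_space,second_countable_topology}, 'e::euclidean_space) chart set" and W C +
  fixes g :: "('a, 'e) form" and p :: "'a \<Rightarrow> 'e"
  assumes pair: "shearfree_pair A g p" and compat: "compatible A W C g p"
begin

lemma form_g: "smooth_form_on UNIV g"
proof -
  have sm: "smooth_sym_form A (\<lambda>x. UNIV) g"
    using pair unfolding shearfree_pair_def lorentzian_metric_def Let_def by blast
  note D = sym_bilinear_onD[OF subspace_UNIV smooth_sym_form_sym_bilinear[OF sm] UNIV_I UNIV_I]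
  show ?thesis
    unfolding smooth_form_on_def
  proof (intro conjI ballI allI impI)
    show "bilinear (g x)" for x
      unfolding bilinear_def using D(2,3)[OF UNIV_I] D(4,5) by (auto intro!: linearI)
    show "g x u v = g x v u" for x u v by (rule D(1))
    show "smooth_fun A V (\<lambda>x. g x (X x) (Y x))"
      if "open V" "smooth_field A V X" "smooth_field A V Y" for V X Y
      using smooth_sym_form_smooth[OF sm that(1)] that unfolding section_of_def by blast
  qed
qed

lemmas g_simps = bilinear_simps[OF smooth_form_bilinear[OF form_g UNIV_I]]
lemmas g_sym = smooth_form_sym[OF form_g UNIV_I]
lemmas g_smooth = smooth_form_smooth[OF form_g _ subset_UNIV]

lemma p_null: "smooth_field A UNIV p" "p x \<noteq> 0" "g x (p x) (p x) = 0"
  using pair unfolding shearfree_pair_def Let_def nonvanishing_section_def section_of_def by auto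

lemma W_iff: "v \<in> W x \<longleftrightarrow> g x (p x) v = 0"
  using compat unfolding compatible_def by blast

text \<open>Hence \<open>g\<close> inherits from the class that it is positive semidefinite on \<open>W\<close> with kernel spanned
  by \<open>p\<close>; together with \<open>W\<close> being a hyperplane, this is what the linear algebra below rests on.\<close>

lemma g_class: "restrict_form W g \<in> C"
proof -
  have "restrict_form W g \<in> conformal_class A W (restrict_form W g)"
    using smooth_fun_const[of UNIV 1] unfolding conformal_class_def
    by (auto intro!: exI[of _ "\<lambda>x. 1"])
  then show ?thesis using compat unfolding compatible_def by simp
qed

lemma g_W: "u \<in> W x \<Longrightarrow> v \<in> W x \<Longrightarrow> restrict_form W g x u v = g x u v"
  by (simp add: restrict_form_def)

lemma kernel_eq: "class_kernel W C x = {v \<in> W x. \<forall>w\<in>W x. g x v w = 0}"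
  unfolding class_kernel_eq[OF g_class] form_kernel_def using g_W by auto

lemma p_kernel: "p x \<in> class_kernel W C x"
  unfolding kernel_eq using W_iff p_null(3) by auto

lemma kernel_span: "class_kernel W C x = span {p x}"
  using class_kernel_span[OF p_kernel p_null(2)] .

lemma transversal_iff: "v \<notin> W x \<longleftrightarrow> g x (p x) v \<noteq> 0"
  by (simp add: W_iff)

lemma complement_subset: "complementary_distribution A U W C W' \<Longrightarrow> x \<in> U \<Longrightarrow> W' x \<subseteq> W x"
  using complementary_distributionD(2)[of U W' x] span_superset[of "W' x \<union> class_kernel W C x"]
  unfolding complementary_in_def by blast

text \<open>The conditions on \<open>q\<close> in (a) and in (b) both reduce to these equations, which characterise
  \<open>(\<ast>)\<close> among the metrics that restrict to \<open>h\<close> on \<open>W\<close>.\<close>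

definition adapted :: "('a \<Rightarrow> 'e set) \<Rightarrow> 'a \<Rightarrow> 'e \<Rightarrow> bool" where
  "adapted W' x v \<longleftrightarrow> g x v v = 0 \<and> g x (p x) v = 1 \<and> (\<forall>w\<in>W' x. g x w v = 0)"

lemma star_metric_iff:
  assumes W': "complementary_distribution A U W C W'" "x \<in> U" and q: "q x \<notin> W x"
  shows "(\<forall>u v. g x u v = star_metric W C (restrict_form W g) p W' q x u v) \<longleftrightarrow> adapted W' x (q x)"
proof -
  note at = rigged_hyperplane_at[of "restrict_form W g" p x U W' q, OF g_class p_kernel p_null(2) W' q]
  interpret R: rigged_hyperplane "W x" "W' x" "p x" "q x" "restrict_form W g x" by (rule at)
  show ?thesis
    unfolding at(2)
  proof
    assume "\<forall>u v. g x u v = R.star u v"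
    then show "adapted W' x (q x)"
      unfolding adapted_def using R.star_q R.star_p R.\<alpha>(2) by simp
  next
    assume "adapted W' x (q x)"
    then show "\<forall>u v. g x u v = R.star u v"
      unfolding adapted_def
      using R.star_unique[OF smooth_form_bilinear[OF form_g UNIV_I] g_sym g_W[symmetric]] by blast
  qed
qed

lemma adapted_rigging:
  assumes W': "complementary_distribution A U W C W'" and q: "smooth_field A U q"
    "\<And>x. x \<in> U \<Longrightarrow> adapted W' x (q x)"
  shows "rigging A U W C W' q" "is_star_metric_on U W C g p W' q"
proof -
  have qW: "q x \<notin> W x" if "x \<in> U" for x
    using q(2)[OF that] unfolding adapted_def transversal_iff by simp
  then show "rigging A U W C W' q" unfolding rigging_def transversal_field_def using W' q(1) by blast
  show "is_star_metric_on U W C g p W' q"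
    unfolding is_star_metric_on_def using star_metric_iff[of U W' _ q] W' qW q(2) by blast
qed

text \<open>The difference of two solutions is orthogonal to \<open>p\<close> and to \<open>W'\<close>, hence to \<open>W\<close>, hence equal to some
  \<open>c p\<close>; comparing the squares of the solutions gives \<open>2 c = 0\<close>.\<close>

lemma adapted_unique:
  assumes W': "complementary_distribution A U W C W'" "x \<in> U" and v: "adapted W' x v" "adapted W' x v'"
  shows "v = v'"
proof -
  define d where "d = v - v'"
  have dp: "g x (p x) d = 0" and dW': "\<And>w. w \<in> W' x \<Longrightarrow> g x w d = 0"
    using v unfolding adapted_def by (simp_all add: d_def g_simps)
  have "g x d w = 0" if w: "w \<in> W x" for w
  proof -
    obtain r w' where "w' \<in> W' x" "w = r *\<^sub>R p x + w'"
      by (rule complement_line_decomp[OF complementary_distributionD(2,1)[OF W', unfolded kernel_span] w])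
    then show ?thesis using dp dW' by (simp add: g_simps g_sym[of x d])
  qed
  then have "d \<in> span {p x}" using dp W_iff unfolding kernel_span[symmetric] kernel_eq by blast
  then obtain c where c: "d = c *\<^sub>R p x" by (auto simp: span_singleton)
  have "v = v' + c *\<^sub>R p x" using c by (simp add: d_def algebra_simps)
  then have "g x v v = 2 * c"
    using v p_null(3)[of x] g_sym[of x v' "p x"] unfolding adapted_def by (simp add: g_simps)
  then have "c = 0" using v unfolding adapted_def by simp
  with c show ?thesis by (simp add: d_def)
qed

lemma transversal_through:
  obtains U q where "open U" "x \<in> U" "transversal_field A U W q"
proof -
  have "DIM('e) - 1 < DIM('e)" by simp
  then have "W x \<noteq> UNIV" using W_hyperplane(2)[of x] by (metis dim_UNIV less_irrefl)
  then obtain v where v: "v \<notin> W x" by blast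
  obtain V q where V: "open V" "x \<in> V" "smooth_field A V q" "q x = v" by (rule field_through)
  define U where "U = {y \<in> V. g y (p y) (q y) \<noteq> 0}"
  have "open U" unfolding U_def
    by (intro open_nonzero V(1) g_smooth V(3) smooth_field_subset[OF p_null(1) subset_UNIV])
  moreover have "x \<in> U" unfolding U_def using V v transversal_iff by blast
  moreover have "transversal_field A U W q"
    unfolding transversal_field_def using smooth_field_subset[OF V(3)] transversal_iff
    by (auto simp: U_def)
  ultimately show ?thesis using that by blast
qed

text \<open>Starting from any transversal field, subtract its projection to \<open>W'\<close> and then the multiple of
  \<open>p\<close> that makes it null.\<close>

lemma adapted_field_exists:
  assumes U: "open U" and W': "complementary_distribution A U W C W'" and x: "x \<in> U"
  obtains V q where "open V" "x \<in> V" "V \<subseteq> U" "smooth_field A V q" "\<And>y. y \<in> V \<Longrightarrow> adapted W' y (q y)"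
proof -
  obtain k where k: "distribution_on A U k W'"
    using W' unfolding complementary_distribution_def by blast
  from distribution_frame[OF k x] obtain V1 F where V1: "open V1" "x \<in> V1" "V1 \<subseteq> U"
    and F: "\<And>i. i < k \<Longrightarrow> smooth_field A V1 (F i)"
    "\<And>y. y \<in> V1 \<Longrightarrow> W' y = span ((\<lambda>i. F i y) ` {..<k})"
    "\<And>y j. y \<in> V1 \<Longrightarrow> j < k \<Longrightarrow> F j y \<notin> span ((\<lambda>i. F i y) ` {..<j})" by metis
  obtain V2 z where V2: "open V2" "x \<in> V2" "transversal_field A V2 W z"
    by (rule transversal_through)
  define V where "V = V1 \<inter> V2"
  have V: "open V" "x \<in> V" "V \<subseteq> U" "V \<subseteq> V1" "V \<subseteq> V2" using V1 V2 by (auto simp: V_def)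
  have zS: "smooth_field A V z" and zp: "\<And>y. y \<in> V \<Longrightarrow> g y (p y) (z y) \<noteq> 0"
    using V2(3) V(5) smooth_field_subset transversal_iff unfolding transversal_field_def by blast+
  have pS: "smooth_field A V p" using smooth_field_subset[OF p_null(1)] by blast
  have pos: "g y v v > 0" if "y \<in> V" "v \<in> W' y" "v \<noteq> 0" for y v
  proof -
    have yU: "y \<in> U" using that V by blast
    have "restrict_form W g y v v > 0"
      using definite_on_complement[OF W_hyperplane(1) class_sym_bilinear[OF g_class] class_nonneg[OF g_class] _
          complementary_distributionD(2)[OF W' yU] that(2,3)]
        class_kernel_eq[OF g_class, of y] unfolding form_kernel_def by auto
    moreover have "v \<in> W y" using complement_subset[OF W' yU] that by blast
    ultimately show ?thesis using g_W by simp
  qed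
  obtain Y where Y: "smooth_field A V Y" "\<And>y. y \<in> V \<Longrightarrow> Y y \<in> W' y"
    "\<And>y v. y \<in> V \<Longrightarrow> v \<in> W' y \<Longrightarrow> g y (z y - Y y) v = 0"
  proof (rule smooth_projection[OF V(1) smooth_form_on_subset[OF form_g subset_UNIV] _ _ _ zS, of k F])
    show "smooth_field A V (F i)" if "i < k" for i
      using smooth_field_subset[OF F(1)[OF that] V(4)] .
  qed (use F(2,3) pos V(4) in \<open>auto simp: subset_iff\<close>)
  define a where "a y = 1 / g y (p y) (z y)" for y
  define n where "n y = a y *\<^sub>R (z y - Y y)" for y
  define q where "q y = n y - (g y (n y) (n y) / 2) *\<^sub>R p y" for y
  have nS: "smooth_field A V n"
    unfolding n_def[abs_def] a_def
    using smooth_field_diff_scale[OF V(1) zS smooth_fun_const[of V 1] Y(1)] zp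
    by (intro smooth_field_scale smooth_fun_divide smooth_fun_const V(1) g_smooth pS zS) auto
  have qS: "smooth_field A V q"
    unfolding q_def[abs_def]
    by (intro smooth_field_diff_scale smooth_fun_divide smooth_fun_const V(1) g_smooth nS pS) simp
  have "adapted W' y (q y)" if y: "y \<in> V" for y
  proof -
    have W'y: "g y (p y) w = 0" if "w \<in> W' y" for w
      using complement_subset[OF W', of y] that y V(3) W_iff by blast
    have 1: "g y (p y) (n y) = 1"
      using W'y[OF Y(2)[OF y]] zp[OF y] by (simp add: n_def a_def g_simps)
    have "g y w (n y) = 0" if "w \<in> W' y" for w
      using Y(3)[OF y that] g_sym[of y w] by (simp add: n_def g_simps)
    moreover have "g y w (p y) = 0" if "w \<in> W' y" for w using W'y[OF that] g_sym by metis
    moreover have "g y (n y) (p y) = 1" using 1 g_sym by metis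
    ultimately show ?thesis unfolding adapted_def q_def using 1 p_null(3)[of y] by (simp add: g_simps)
  qed
  with that[OF V(1-3) qS] show ?thesis by blast
qed

lemma normalised_iff_adapted:
  assumes W': "complementary_distribution A U W C W'" "x \<in> U"
  shows "(\<forall>w\<in>span (W' x \<union> {v}). g x v w = 0) \<and> g x v (p x) = 1 \<longleftrightarrow> adapted W' x v"
proof
  assume v: "(\<forall>w\<in>span (W' x \<union> {v}). g x v w = 0) \<and> g x v (p x) = 1"
  then have "g x w v = 0" if "w \<in> W' x \<union> {v}" for w
    using span_base[OF that] unfolding g_sym[of x w v] by blast
  then show "adapted W' x v"
    using v unfolding adapted_def g_sym[of x v "p x"] by blast
next
  assume v: "adapted W' x v"
  have "g x v w = 0" if "w \<in> W' x \<union> {v}" for w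
    using v that unfolding adapted_def g_sym[of x v w] by blast
  then have "span (W' x \<union> {v}) \<subseteq> {w. g x v w = 0}"
    by (intro span_minimal) (auto simp: g_simps intro!: subspaceI)
  then show "(\<forall>w\<in>span (W' x \<union> {v}). g x v w = 0) \<and> g x v (p x) = 1"
    using v unfolding adapted_def g_sym[of x v "p x"] by blast
qed

text \<open>A solution of the equations is unique at each point, hence agrees near each point with a smooth
  one, which makes it smooth without assuming so.\<close>

proposition rigging_from_complement:
  assumes U: "open U" and W': "complementary_distribution A U W C W'"
  shows "x \<in> U \<Longrightarrow> \<exists>!v. (\<forall>w\<in>span (W' x \<union> {v}). g x v w = 0) \<and> g x v (p x) = 1"
    and "\<And>q. (\<And>x. x \<in> U \<Longrightarrow> (\<forall>w\<in>span (W' x \<union> {q x}). g x (q x) w = 0) \<and> g x (q x) (p x) = 1) \<Longrightarrow>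
       rigging A U W C W' q \<and> is_star_metric_on U W C g p W' q"
proof -
  show "\<exists>!v. (\<forall>w\<in>span (W' x \<union> {v}). g x v w = 0) \<and> g x v (p x) = 1" if x: "x \<in> U"
  proof -
    from adapted_field_exists[OF U W' x]
    obtain V q where "x \<in> V" "\<And>y. y \<in> V \<Longrightarrow> adapted W' y (q y)" by metis
    then show ?thesis
      unfolding normalised_iff_adapted[OF W' x] using adapted_unique[OF W' x] by blast
  qed
  fix q assume "\<And>x. x \<in> U \<Longrightarrow> (\<forall>w\<in>span (W' x \<union> {q x}). g x (q x) w = 0) \<and> g x (q x) (p x) = 1"
  then have q: "adapted W' x (q x)" if "x \<in> U" for x
    using normalised_iff_adapted[OF W' that] that by blast
  have "smooth_field A U q"
  proof (rule smooth_field_cover)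
    fix x assume "x \<in> U"
    from adapted_field_exists[OF U W' this] obtain V r where V: "open V" "x \<in> V" "V \<subseteq> U"
      and r: "smooth_field A V r" "\<And>y. y \<in> V \<Longrightarrow> adapted W' y (r y)" by metis
    have "r y = q y" if "y \<in> V" for y
      using adapted_unique[OF W' _ r(2)[OF that] q] that V(3) by blast
    with V r(1) show "\<exists>V. open V \<and> x \<in> V \<and> smooth_field A V q" using smooth_field_cong by blast
  qed
  with adapted_rigging[OF W'] q show "rigging A U W C W' q \<and> is_star_metric_on U W C g p W' q" by blast
qed

abbreviation screen :: "('a \<Rightarrow> 'e) \<Rightarrow> 'a \<Rightarrow> 'e set" where
  "screen q \<equiv> perp g (\<lambda>x. span {p x, q x})"

lemma screen_iff: "v \<in> screen q x \<longleftrightarrow> g x (p x) v = 0 \<and> g x (q x) v = 0"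
proof
  assume "g x (p x) v = 0 \<and> g x (q x) v = 0"
  then have "span {p x, q x} \<subseteq> {u. g x u v = 0}"
    by (intro span_minimal) (auto simp: g_simps intro!: subspaceI)
  then show "v \<in> screen q x" unfolding perp_def by blast
qed (auto simp: perp_def span_base)

text \<open>The projection to the screen along \<open>\<langle>p,q\<rangle>\<close>: the coefficients solve the two equations of
  orthogonality to \<open>p\<close> and \<open>q\<close>.\<close>

definition screen_proj :: "('a \<Rightarrow> 'e) \<Rightarrow> 'a \<Rightarrow> 'e \<Rightarrow> 'e" where
  "screen_proj q x v = v - (g x (p x) v / g x (p x) (q x)) *\<^sub>R q x
     - ((g x (q x) v - g x (p x) v / g x (p x) (q x) * g x (q x) (q x)) / g x (p x) (q x)) *\<^sub>R p x"

lemma screen_proj_mem: "g x (p x) (q x) \<noteq> 0 \<Longrightarrow> screen_proj q x v \<in> screen q x"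
  unfolding screen_iff screen_proj_def using p_null(3)[of x] g_sym[of x "q x" "p x"] by (simp add: g_simps)

lemma screen_proj_id: "v \<in> screen q x \<Longrightarrow> screen_proj q x v = v"
  unfolding screen_iff screen_proj_def by simp

lemma subspace_screen: "subspace (screen q x)"
  by (rule subspaceI) (simp_all add: screen_iff g_simps)

lemma dim_screen:
  assumes pq: "g x (p x) (q x) \<noteq> 0"
  shows "dim (screen q x) = DIM('e) - 2"
proof -
  note S = span_eq_iff[THEN iffD2, OF subspace_screen]
  have q: "q x \<notin> screen q x" using pq by (simp add: screen_iff)
  have p: "p x \<notin> span (insert (q x) (screen q x))"
  proof
    assume "p x \<in> span (insert (q x) (screen q x))"
    then obtain r where "p x - r *\<^sub>R q x \<in> screen q x" unfolding span_breakdown_eq S by blast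
    then have "r * g x (p x) (q x) = 0" "g x (q x) (p x) = r * g x (q x) (q x)"
      using p_null(3)[of x] unfolding screen_iff by (simp_all add: g_simps)
    then show False using pq g_sym[of x "q x" "p x"] by simp
  qed
  have "v \<in> span (insert (p x) (insert (q x) (screen q x)))" (is "_ \<in> ?T") for v
  proof -
    have "screen_proj q x v \<in> ?T" "q x \<in> ?T" "p x \<in> ?T"
      using screen_proj_mem[where q = q, OF pq] by (auto intro: span_base)
    then have "screen_proj q x v + r *\<^sub>R q x + s *\<^sub>R p x \<in> ?T" for r s by (intro span_add span_scale)
    moreover obtain r s where "v = screen_proj q x v + r *\<^sub>R q x + s *\<^sub>R p x"
      by (rule that[of "g x (p x) v / g x (p x) (q x)"
            "(g x (q x) v - g x (p x) v / g x (p x) (q x) * g x (q x) (q x)) / g x (p x) (q x)"])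
        (simp add: screen_proj_def)
    ultimately show ?thesis by metis
  qed
  then have "dim (insert (p x) (insert (q x) (screen q x))) = DIM('e)"
    unfolding dim_eq_full by blast
  then show ?thesis using p q S by (simp add: dim_insert)
qed

text \<open>A local frame of the screen: project constant fields that form a basis of it at one point.\<close>

lemma screen_distribution:
  assumes U: "open U" and q: "transversal_field A U W q"
  shows "distribution_on A U (DIM('e) - 2) (screen q)"
proof (rule distribution_onI)
  have qS: "smooth_field A U q" and pq: "\<And>x. x \<in> U \<Longrightarrow> g x (p x) (q x) \<noteq> 0"
    using q transversal_iff unfolding transversal_field_def by blast+
  show "subspace (screen q x) \<and> dim (screen q x) = DIM('e) - 2" if "x \<in> U" for x
    by (intro conjI subspace_screen dim_screen pq that)
  fix x assume x: "x \<in> U"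
  let ?k = "DIM('e) - 2" and ?c = "chart_at A x"
  obtain B where B: "B \<subseteq> screen q x" "independent B" "screen q x \<subseteq> span B"
      "card B = dim (screen q x)"
    by (rule basis_exists)
  have cardB: "card B = ?k" using B(4) dim_screen[where q = q, OF pq[OF x]] by simp
  obtain b where "bij_betw b {0..<card B} B"
    using ex_bij_betw_nat_finite[OF independent_imp_finite[OF B(2)]] by blast
  then have "bij_betw b {0..<?k} B" by (simp only: cardB)
  then have b: "bij_betw b {..<?k} B" by (simp add: lessThan_atLeast0)
  then have bB: "b ` {..<?k} = B" by (simp add: bij_betw_def)
  define V where "V = U \<inter> fst ?c"
  have V: "open V" "x \<in> V" "V \<subseteq> U" "V \<subseteq> fst ?c"
    using U x chart_at[of x] open_domain[OF chart_at(1)[of x]] by (auto simp: V_def)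
  define Z where "Z i = const_field ?c (b i)" for i
  define F where "F i y = screen_proj q y (Z i y)" for i y
  have ZS: "smooth_field A V (Z i)" for i
    unfolding Z_def using smooth_field_subset[OF smooth_const_field[OF chart_at(1)] V(4)] .
  have qV: "smooth_field A V q" "smooth_field A V p"
    using smooth_field_subset qS p_null(1) V(3) by blast+
  have FS: "smooth_field A V (F i)" for i
    unfolding F_def[abs_def] screen_proj_def using pq V(3)
    by (intro smooth_field_diff_scale smooth_fun_divide smooth_fun_diff smooth_fun_mult g_smooth V(1) ZS qV) auto
  have Fx: "F i x = b i" if "i < ?k" for i
  proof -
    have "Z i x = b i" using const_field_tcoord[OF chart_at, of x "b i"] by (simp add: Z_def)
    moreover have "b i \<in> screen q x" using bB B(1) that by blast
    ultimately show ?thesis by (simp add: F_def screen_proj_id)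
  qed
  have "dim (span (b ` {..<?k})) = ?k"
    unfolding bB dim_span using dim_eq_card_independent[OF B(2)] cardB by simp
  then have ind: "\<forall>j<?k. b j \<notin> span (b ` {..<j})" by (simp only: dim_span_lessThan_iff)
  have "F j x \<notin> span ((\<lambda>i. F i x) ` {..<j})" if "j < ?k" for j
  proof -
    have "(\<lambda>i. F i x) ` {..<j} = b ` {..<j}" using Fx that by (intro image_cong) auto
    then show ?thesis using Fx ind that by simp
  qed
  moreover have "F i y \<in> screen q y" if "y \<in> V" for i y
    unfolding F_def by (intro screen_proj_mem pq subsetD[OF V(3)] that)
  ultimately show "\<exists>V F. open V \<and> x \<in> V \<and> V \<subseteq> U \<and> (\<forall>i<?k. smooth_field A V (F i)) \<and>
        (\<forall>i<?k. \<forall>y\<in>V. F i y \<in> screen q y) \<and> (\<forall>j<?k. F j x \<notin> span ((\<lambda>i. F i x) ` {..<j}))"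
    using V FS by (intro exI[of _ V] exI[of _ F]) simp
qed

lemma screen_complementary:
  assumes U: "open U" and q: "transversal_field A U W q"
  shows "complementary_distribution A U W C (screen q)"
  unfolding complementary_distribution_def
proof (intro conjI ballI exI)
  show "distribution_on A U (DIM('e) - 2) (screen q)" using screen_distribution[OF assms] .
  fix x assume x: "x \<in> U"
  have pq: "g x (p x) (q x) \<noteq> 0" using q x transversal_iff unfolding transversal_field_def by blast
  show "complementary_in (screen q x) (class_kernel W C x) (W x)"
    unfolding complementary_in_def kernel_span
  proof
    show "screen q x \<inter> span {p x} = {0}"
    proof -
      have "c = 0" if "c *\<^sub>R p x \<in> screen q x" for c
        using that pq g_sym[of x "q x" "p x"] unfolding screen_iff by (simp add: g_simps)
      moreover have "0 \<in> screen q x" by (rule subspace_0[OF subspace_screen])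
      ultimately show ?thesis by (auto simp: span_singleton intro: rangeI[of _ 0])
    qed
    show "span (screen q x \<union> span {p x}) = W x"
    proof
      have "screen q x \<subseteq> W x" using screen_iff[of _ q x] W_iff by blast
      moreover have "span {p x} \<subseteq> W x" using class_kernel_line(3)[of x] unfolding kernel_span .
      ultimately show "span (screen q x \<union> span {p x}) \<subseteq> W x" using W_hyperplane(1) by (simp add: span_minimal)
      show "W x \<subseteq> span (screen q x \<union> span {p x})"
      proof
        fix v assume v: "v \<in> W x"
        have "v = screen_proj q x v + (g x (q x) v / g x (p x) (q x)) *\<^sub>R p x"
          using v by (simp add: screen_proj_def W_iff)
        moreover have "screen_proj q x v \<in> span (screen q x \<union> span {p x})"
          "p x \<in> span (screen q x \<union> span {p x})"
          using screen_proj_mem[where q = q, OF pq] by (simp_all add: span_base)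
        then have "screen_proj q x v + r *\<^sub>R p x \<in> span (screen q x \<union> span {p x})" for r
          by (intro span_add span_scale)
        ultimately show "v \<in> span (screen q x \<union> span {p x})" by metis
      qed
    qed
  qed
qed

text \<open>Writing \<open>v = a p + b q\<close>, the condition \<open>g(p,v) = 1\<close> fixes \<open>b\<close>, and \<open>g(v,v) = 0\<close> is then linear
  in \<open>a\<close>.\<close>

definition null_normalisation :: "('a \<Rightarrow> 'e) \<Rightarrow> 'a \<Rightarrow> 'e" where
  "null_normalisation q x = (1 / g x (p x) (q x)) *\<^sub>R q x
     - (g x (q x) (q x) / (2 * (g x (p x) (q x) * g x (p x) (q x)))) *\<^sub>R p x"

lemma null_normalisation:
  assumes pq: "g x (p x) (q x) \<noteq> 0"
  shows "v \<in> span {p x, q x} \<and> g x v v = 0 \<and> g x (p x) v = 1 \<longleftrightarrow> v = null_normalisation q x"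
proof
  note sym = g_sym[of x "q x" "p x"]
  assume v: "v \<in> span {p x, q x} \<and> g x v v = 0 \<and> g x (p x) v = 1"
  then obtain a where "v - a *\<^sub>R p x \<in> span {q x}" using span_breakdown_eq[of v "p x" "{q x}"] by blast
  then obtain b where "v - a *\<^sub>R p x = b *\<^sub>R q x" by (auto simp: span_singleton)
  then have ab: "v = a *\<^sub>R p x + b *\<^sub>R q x" by (simp add: algebra_simps)
  have "b * g x (p x) (q x) = 1" using v p_null(3)[of x] by (simp add: ab g_simps)
  then have b: "b = 1 / g x (p x) (q x)" using pq by (simp add: field_simps)
  have "g x v v = 2 * (a * (b * g x (p x) (q x))) + b * b * g x (q x) (q x)"
    using p_null(3)[of x] sym by (simp add: ab g_simps algebra_simps)
  with v have "2 * (a * (b * g x (p x) (q x))) + b * b * g x (q x) (q x) = 0" by simp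
  then have "a = - (g x (q x) (q x) / (2 * (g x (p x) (q x) * g x (p x) (q x))))"
    using pq by (simp add: b field_simps)
  then show "v = null_normalisation q x" by (simp add: ab b null_normalisation_def)
next
  note sym = g_sym[of x "q x" "p x"]
  assume v: "v = null_normalisation q x"
  have "v \<in> span {p x, q x}"
    unfolding v null_normalisation_def by (intro span_diff span_scale span_base) auto
  moreover have "g x (p x) v = 1"
    using pq p_null(3)[of x] by (simp add: v null_normalisation_def g_simps)
  moreover have "g x v v = 0"
    using pq p_null(3)[of x] sym by (simp add: v null_normalisation_def g_simps field_simps)
  ultimately show "v \<in> span {p x, q x} \<and> g x v v = 0 \<and> g x (p x) v = 1" by blast
qed

proposition rigging_from_transversal:
  assumes U: "open U" and q: "transversal_field A U W q"
  shows "rigging A U W C (screen q) q"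
    and "is_star_metric_on U W C g p (screen q) q \<longleftrightarrow> (\<forall>x\<in>U. g x (q x) (q x) = 0 \<and> g x (p x) (q x) = 1)"
    and "x \<in> U \<Longrightarrow> \<exists>!v. v \<in> span {p x, q x} \<and> g x v v = 0 \<and> g x (p x) v = 1"
    and "\<And>q'. (\<And>x. x \<in> U \<Longrightarrow> q' x \<in> span {p x, q x} \<and> g x (q' x) (q' x) = 0 \<and> g x (p x) (q' x) = 1) \<Longrightarrow>
      rigging A U W C (screen q) q' \<and> is_star_metric_on U W C g p (screen q) q'"
proof -
  have qS: "smooth_field A U q" and qW: "\<And>x. x \<in> U \<Longrightarrow> q x \<notin> W x"
    using q unfolding transversal_field_def by blast+
  then have pq: "\<And>x. x \<in> U \<Longrightarrow> g x (p x) (q x) \<noteq> 0" using transversal_iff by blast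
  note S = screen_complementary[OF U q]
  show "rigging A U W C (screen q) q" unfolding rigging_def using S q by blast
  have "adapted (screen q) x (q x) \<longleftrightarrow> g x (q x) (q x) = 0 \<and> g x (p x) (q x) = 1" for x
  proof -
    have "g x w (q x) = 0" if "w \<in> screen q x" for w
      using that unfolding screen_iff g_sym[of x w "q x"] by blast
    then show ?thesis unfolding adapted_def by blast
  qed
  then show "is_star_metric_on U W C g p (screen q) q \<longleftrightarrow>
      (\<forall>x\<in>U. g x (q x) (q x) = 0 \<and> g x (p x) (q x) = 1)"
    unfolding is_star_metric_on_def using star_metric_iff[where q = q, OF S _ qW] by simp
  show "\<exists>!v. v \<in> span {p x, q x} \<and> g x v v = 0 \<and> g x (p x) v = 1" if "x \<in> U"
    unfolding null_normalisation[where q = q, OF pq[OF that]] by simp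
  fix q' assume q': "\<And>x. x \<in> U \<Longrightarrow> q' x \<in> span {p x, q x} \<and> g x (q' x) (q' x) = 0 \<and> g x (p x) (q' x) = 1"
  have eq: "null_normalisation q x = q' x" if "x \<in> U" for x
    using null_normalisation[where q = q, OF pq[OF that]] q'[OF that] by metis
  have "smooth_field A U (null_normalisation q)"
    unfolding null_normalisation_def[abs_def] using pq
    by (intro smooth_field_diff_scale smooth_field_scale smooth_fun_divide smooth_fun_mult
        smooth_fun_const U g_smooth qS smooth_field_subset[OF p_null(1)]) auto
  from smooth_field_cong[OF U eq this] have "smooth_field A U q'" .
  moreover have "adapted (screen q) x (q' x)" if x: "x \<in> U" for x
  proof -
    have "g x w (q' x) = 0" if "w \<in> screen q x" for w
      using that q'[OF x] unfolding perp_def g_sym[of x w "q' x"] by blast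
    then show ?thesis unfolding adapted_def using q'[OF x] by blast
  qed
  ultimately show "rigging A U W C (screen q) q' \<and> is_star_metric_on U W C g p (screen q) q'"
    using adapted_rigging[OF S] by blast
qed

proposition local_rigging:
  "\<exists>U. open U \<and> x \<in> U \<and> (\<exists>W' q. rigging A U W C W' q \<and> is_star_metric_on U W C g p W' q)"
proof -
  obtain U q where U: "open U" "x \<in> U" "transversal_field A U W q" by (rule transversal_through)
  have "g y (p y) (q y) \<noteq> 0" if "y \<in> U" for y
    using U(3) that transversal_iff unfolding transversal_field_def by blast
  then have "rigging A U W C (screen q) (null_normalisation q) \<and>
      is_star_metric_on U W C g p (screen q) (null_normalisation q)"
    by (intro rigging_from_transversal(4)[OF U(1,3)]) (use null_normalisation in blast)
  with U show ?thesis by blast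
qed

end

theorem theorem2p7:
  fixes A :: "('a::{t2_space,second_countable_topology}, 'e::euclidean_space) chart set"
    and W :: "'a \<Rightarrow> 'e set"
    and C :: "('a, 'e) form set"
  assumes "smooth_atlas A"
    and "shearfree_structure A W C"
  shows
    "(\<forall>h p W' q.
        h \<in> C \<and> nonvanishing_section A UNIV (class_kernel W C) p \<and> rigging A UNIV W C W' q \<longrightarrow>
          shearfree_pair A (star_metric W C h p W' q) p \<and>
          compatible A W C (star_metric W C h p W' q) p)
     \<and>
     (\<forall>g p.
        shearfree_pair A g p \<and> compatible A W C g p \<longrightarrow>
          (\<forall>x. \<exists>U. open U \<and> x \<in> U \<and>
             (\<exists>W' q. rigging A U W C W' q \<and> is_star_metric_on U W C g p W' q))
          \<and>
          (\<forall>U W'. open U \<and> complementary_distribution A U W C W' \<longrightarrow>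
             (\<forall>x\<in>U. \<exists>!v. (\<forall>w\<in>span (W' x \<union> {v}). g x v w = 0) \<and> g x v (p x) = 1) \<and>
             (\<forall>q. (\<forall>x\<in>U. (\<forall>w\<in>span (W' x \<union> {q x}). g x (q x) w = 0) \<and> g x (q x) (p x) = 1) \<longrightarrow>
                rigging A U W C W' q \<and> is_star_metric_on U W C g p W' q))
          \<and>
          (\<forall>U q. open U \<and> transversal_field A U W q \<longrightarrow>
             (let W' = perp g (\<lambda>x. span {p x, q x}) in
                rigging A U W C W' q \<and>
                (is_star_metric_on U W C g p W' q \<longleftrightarrow>
                   (\<forall>x\<in>U. g x (q x) (q x) = 0 \<and> g x (p x) (q x) = 1)) \<and>
                (\<forall>x\<in>U. \<exists>!v. v \<in> span {p x, q x} \<and> g x v v = 0 \<and> g x (p x) v = 1) \<and>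
                (\<forall>q'. (\<forall>x\<in>U. q' x \<in> span {p x, q x} \<and> g x (q' x) (q' x) = 0 \<and>
                          g x (p x) (q' x) = 1) \<longrightarrow>
                   rigging A U W C W' q' \<and> is_star_metric_on U W C g p W' q'))))"
proof -
  interpret shearfree_atlas A W C
    using assms by unfold_locales
  show ?thesis
  proof (rule conjI; intro allI impI; elim conjE)
    fix h p W' q
    assume "h \<in> C" "nonvanishing_section A UNIV (class_kernel W C) p" "rigging A UNIV W C W' q"
    then show "shearfree_pair A (star_metric W C h p W' q) p \<and>
        compatible A W C (star_metric W C h p W' q) p"
      by (intro conjI star_metric_shearfree)
  next
    fix g p
    assume pair: "shearfree_pair A g p" "compatible A W C g p"
    interpret compatible_pair A W C g p
      using pair by unfold_locales
    show "(\<forall>x. \<exists>U. open U \<and> x \<in> U \<and>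
             (\<exists>W' q. rigging A U W C W' q \<and> is_star_metric_on U W C g p W' q))
          \<and>
          (\<forall>U W'. open U \<and> complementary_distribution A U W C W' \<longrightarrow>
             (\<forall>x\<in>U. \<exists>!v. (\<forall>w\<in>span (W' x \<union> {v}). g x v w = 0) \<and> g x v (p x) = 1) \<and>
             (\<forall>q. (\<forall>x\<in>U. (\<forall>w\<in>span (W' x \<union> {q x}). g x (q x) w = 0) \<and> g x (q x) (p x) = 1) \<longrightarrow>
                rigging A U W C W' q \<and> is_star_metric_on U W C g p W' q))
          \<and>
          (\<forall>U q. open U \<and> transversal_field A U W q \<longrightarrow>
             (let W' = perp g (\<lambda>x. span {p x, q x}) in
                rigging A U W C W' q \<and>
                (is_star_metric_on U W C g p W' q \<longleftrightarrow>
                   (\<forall>x\<in>U. g x (q x) (q x) = 0 \<and> g x (p x) (q x) = 1)) \<and>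
                (\<forall>x\<in>U. \<exists>!v. v \<in> span {p x, q x} \<and> g x v v = 0 \<and> g x (p x) v = 1) \<and>
                (\<forall>q'. (\<forall>x\<in>U. q' x \<in> span {p x, q x} \<and> g x (q' x) (q' x) = 0 \<and>
                          g x (p x) (q' x) = 1) \<longrightarrow>
                   rigging A U W C W' q' \<and> is_star_metric_on U W C g p W' q')))"
      (is "?local \<and> ?complement \<and> ?transversal")
    proof (intro conjI)
      show ?local using local_rigging by (rule allI)
      show ?complement
      proof (intro allI impI, elim conjE)
        fix U W' assume "open U" "complementary_distribution A U W C W'"
        note T = rigging_from_complement[OF this]
        show "(\<forall>x\<in>U. \<exists>!v. (\<forall>w\<in>span (W' x \<union> {v}). g x v w = 0) \<and> g x v (p x) = 1) \<and>
             (\<forall>q. (\<forall>x\<in>U. (\<forall>w\<in>span (W' x \<union> {q x}). g x (q x) w = 0) \<and> g x (q x) (p x) = 1) \<longrightarrow>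
                rigging A U W C W' q \<and> is_star_metric_on U W C g p W' q)"
          using T(1) by (intro conjI ballI allI impI T(2)) simp_all
      qed
      show ?transversal
      proof (intro allI impI, elim conjE)
        fix U q assume "open U" "transversal_field A U W q"
        note T = rigging_from_transversal[OF this]
        show "let W' = screen q in
                rigging A U W C W' q \<and>
                (is_star_metric_on U W C g p W' q \<longleftrightarrow>
                   (\<forall>x\<in>U. g x (q x) (q x) = 0 \<and> g x (p x) (q x) = 1)) \<and>
                (\<forall>x\<in>U. \<exists>!v. v \<in> span {p x, q x} \<and> g x v v = 0 \<and> g x (p x) v = 1) \<and>
                (\<forall>q'. (\<forall>x\<in>U. q' x \<in> span {p x, q x} \<and> g x (q' x) (q' x) = 0 \<and>
                          g x (p x) (q' x) = 1) \<longrightarrow>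
                   rigging A U W C W' q' \<and> is_star_metric_on U W C g p W' q')"
          unfolding Let_def
        proof (intro conjI ballI allI impI)
          show "rigging A U W C (screen q) q'" "is_star_metric_on U W C g p (screen q) q'"
            if "\<forall>x\<in>U. q' x \<in> span {p x, q x} \<and> g x (q' x) (q' x) = 0 \<and> g x (p x) (q' x) = 1" for q'
            using T(4)[of q'] that by auto
        qed (fact T(1), fact T(2), rule T(3))
      qed
    qed
  qed
qed

end
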